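(* Let $q>0$ and $L>\max\{\mathsf p,q,1\}$. Suppose that the following conditions hold. (1) There exists a sequence of positive $\mathcal C$-measurable random variables $(\epsilon(r))_{r\in\mathbb N}$ such that $\lim_{r\to\infty}\epsilon(r)=0$ a.s. and, for every $\mathcal T\in\mathfrak T$, $$\sup_{T\in\mathcal T}\sup_{r\in\mathbb N}r^LP_{\mathcal C}\big[S_T(r,\epsilon(r))\big]\Psi_T<\infty\quad\text{a.s.}$$ (2) For every $\epsilon>0$, $c>0$ and $\mathcal T\in\mathfrak T$, $\ \limsup_{T\to\infty,\,T\in\mathcal T}P_{\mathcal C}[W_T(\delta,c,\epsilon)]\Psi_T\to^P 0$ as $\delta\downarrow0$. (3) (i) For any $k\in\mathbb N$, $u_1,\dots,u_k\in\mathbb R^{\mathsf p}$, $f\in C_b(\mathbb R^{k})$ and any bounded $\mathcal G$-measurable random variable $Y$, $$E_{\mathcal C}\big[f\big((\mathbb Z_T(u_i))_{i=1,\dots,k}\big)\Psi_TY\big]\to^P\overline E_{\mathcal C}\big[f\big((\mathbb Z(u_i))_{i=1,\dots,k}\big)Y\big]\quad(T\to\infty);$$ (ii) $\Psi_T\to^P1$ as $T\to\infty$. (4) With probability one, there exists a unique element $\hat u\in\mathbb R^{\mathsf p}$ that maximizes $\mathbb Z$. Then $E_{\mathcal C}[F(\mathbb Z_T)Y]\to^P\overline E_{\mathcal C}[F(\mathbb Z)Y]$ as $T\to\infty$ for any $F\in C_b(\hat C)$ and any bounded $\mathcal G$-measurable random variable $Y$. Moreover, $$E_{\mathcal C}[f(\hat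 u_T)Y]\to^P\overline E_{\mathcal C}[f(\hat u)Y]\quad(T\to\infty)$$ for any bounded $\mathcal G$-measurable random variable $Y$ and any $f\in C(\mathbb R^{\mathsf p})$ such that $\limsup_{|u|\to\infty}|f(u)||u|^{-q}<\infty$. In particular, $\hat u_T\to^{d_s(\mathcal G)}\hat u$ as $T\to\infty$.
   Context: $(\Omega,\mathcal F,P)$ is a probability space, $\mathbb T\subset[0,\infty)$ with $\sup\mathbb T=\infty$, $\Theta$ is a bounded domain in $\mathbb R^{\mathsf p}$ with closure $\overline\Theta$, and $\theta^*\in\Theta$. For $T\in\mathbb T$, $\mathbb H_T:\Omega\times\overline\Theta\to\mathbb R$ is a jointly measurable random field, continuous in $\theta\in\overline\Theta$ for every $\omega$. The matrices $a_T\in GL(\mathbb R^{\mathsf p})$ satisfy $a_T\to0$ as $T\to\infty$. Put $\theta_T^\dagger(u)=\theta^*+a_Tu$, $\mathbb U_T=\{u\in\mathbb R^{\mathsf p}:\theta_T^\dagger(u)\in\Theta\}$ and $\mathbb Z_T(u)=\exp\big(\mathbb H_T(\theta_T^\dagger(u))-\mathbb H_T(\theta^* )\big)$ for $u\in\mathbb U_T$. The field $\mathbb Z_T$ is extended to $\mathbb R^{\mathsf p}$ as a (measurable, nonnegative) continuous random field with compact support and $\sup_{u\in\mathbb R^{\mathsf p}\setminus\mathbb U_T}\mathbb Z_T(u)\le\max_{u\in\partial\mathbb U_T}\mathbb Z_T(u)$; the extension is also denoted $\mathbb Z_T$. $\hat C=\{f\in C(\mathbb R^{\mathsf p}):\lim_{|u|\to\infty}f(u)=0\}$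 with the supremum norm. A quasi maximum likelihood estimator is a measurable map $\hat\theta_T:\Omega\to\overline\Theta$ with $\mathbb H_T(\hat\theta_T)=\max_{\theta\in\overline\Theta}\mathbb H_T(\theta)$ for all $\omega$; $\hat u_T=a_T^{-1}(\hat\theta_T-\theta^* )$. $\mathcal C\subset\mathcal G\subset\mathcal F$ are $\sigma$-fields; $P_{\mathcal C}$, $E_{\mathcal C}$ denote conditional probability and expectation given $\mathcal C$. $\Psi_T$ ($T\in\mathbb T$) are $[0,1]$-valued $\mathcal C$-measurable random variables. $T_0>0$ is fixed, and $\mathfrak T$ is the set of sequences $(T_n)_{n\in\mathbb N}$ in $\mathbb T$ with $T_n\ge T_0$ for all $n$ and $T_n\to\infty$. $\mathbb V_T(r)=\{u\in\mathbb U_T:|u|\ge r\}$ and $S_T(r,\epsilon)=\{\sup_{u\in\mathbb V_T(r)}\mathbb Z_T(u)\ge\epsilon\}$ (the supremum over the empty set being $0$). For $c>0$, $B_{c,T}=\{u\in\mathbb R^{\mathsf p}:|u|<c,\ \theta_T^\dagger(u)\in\Theta\}$, $w_T(\delta,c)=\sup\{|\log\mathbb Z_T(u_2)-\log\mathbb Z_T(u_1)|:u_1,u_2\in B_{c,T},|u_2-u_1|\le\delta\}$, and $W_T(\delta,c,\epsilon)=\{w_T(\delta,c)>\epsilon\}$. $(\overline\Omega,\overline{\mathcal F},\overline P)$ is an extension of $(\Omega,\mathcal F,P)$ (random variables on $\Omega$ are regarded as random variables on $\overline\Omega$, and $\overline P|_{\mathcal F}=P$); $\mathbb Z$ is a $\hat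 C$-valued random variable on it, and $\hat u$ is taken $\overline{\mathcal F}$-measurable. For a random variable $W$, $\overline E_{\mathcal C}[W]$ (likewise $E_{\mathcal C}[W]$) is the integral $\int w\,\overline P^W_\omega(dw)$ with respect to a regular conditional distribution of $W$ given $\mathcal C$; unconditional integrability of $W$ is not assumed. $\to^P$ is convergence in probability. $\hat u_T\to^{d_s(\mathcal G)}\hat u$ ($\mathcal G$-stable convergence) means $E[f(\hat u_T)Y]\to\overline E[f(\hat u)Y]$ for all $f\in C_b(\mathbb R^{\mathsf p})$ and all bounded $\mathcal G$-measurable $Y$. *)

theory Defs
  imports "HOL-Probability.Probability"
begin

text \<open>
  An extension of a probability space \<open>M\<close> is a probability space \<open>N\<close> with a measurable map
  \<open>\<pi> : N \<rightarrow> M\<close> whose image measure is \<open>M\<close>. A random variable \<open>X\<close> on \<open>M\<close> is regarded as the random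
  variable \<open>X \<circ> \<pi>\<close> on \<open>N\<close>, and a sub-sigma-field \<open>C\<close> of \<open>M\<close> as the pull-back of \<open>C\<close> under \<open>\<pi>\<close>.
\<close>

definition prob_extension :: "'a measure \<Rightarrow> 'b measure \<Rightarrow> ('b \<Rightarrow> 'a) \<Rightarrow> bool" where
  "prob_extension M N \<pi> \<longleftrightarrow> prob_space N \<and> \<pi> \<in> measurable N M \<and> distr N M \<pi> = M"

text \<open>
  The kernel \<open>\<kappa>\<close> is a regular conditional distribution of the random variable \<open>W\<close> on \<open>N\<close> given (the
  pull-back under \<open>\<pi>\<close> of) \<open>C\<close>. Conditional objects are thus \<open>C\<close>-measurable functions on the base
  space; \<open>\<pi> = id\<close> gives conditioning on the base space itself. The measure \<open>distr N C \<pi>\<close> is the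
  restriction of the base probability measure to \<open>C\<close>.
\<close>

definition regular_cond_distr ::
  "'b measure \<Rightarrow> ('b \<Rightarrow> 'a) \<Rightarrow> 'a measure \<Rightarrow> ('b \<Rightarrow> real) \<Rightarrow> ('a \<Rightarrow> real measure) \<Rightarrow> bool" where
  "regular_cond_distr N \<pi> C W \<kappa> \<longleftrightarrow>
     \<kappa> \<in> measurable C (prob_algebra borel) \<and>
     (\<forall>A\<in>sets C. \<forall>B\<in>sets borel.
        emeasure N {w \<in> space N. \<pi> w \<in> A \<and> W w \<in> B}
          = (\<integral>\<^sup>+\<omega>\<in>A. emeasure (\<kappa> \<omega>) B \<partial>(distr N C \<pi>)))"

text \<open>A fixed version; any two versions agree almost surely, and one exists whenever \<open>W\<close> is
  measurable.\<close>

definition cond_distr ::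
  "'b measure \<Rightarrow> ('b \<Rightarrow> 'a) \<Rightarrow> 'a measure \<Rightarrow> ('b \<Rightarrow> real) \<Rightarrow> 'a \<Rightarrow> real measure" where
  "cond_distr N \<pi> C W = (SOME \<kappa>. regular_cond_distr N \<pi> C W \<kappa>)"

definition cond_expect ::
  "'b measure \<Rightarrow> ('b \<Rightarrow> 'a) \<Rightarrow> 'a measure \<Rightarrow> ('b \<Rightarrow> real) \<Rightarrow> 'a \<Rightarrow> real" where
  "cond_expect N \<pi> C W \<omega> = (\<integral>w. w \<partial>(cond_distr N \<pi> C W \<omega>))"

text \<open>The integral in \<open>cond_expect\<close> is a Bochner integral, which is \<open>0\<close> by convention where it does
  not exist; the following predicate says that it does exist.\<close>

definition cond_integrable ::
  "'b measure \<Rightarrow> ('b \<Rightarrow> 'a) \<Rightarrow> 'a measure \<Rightarrow> ('b \<Rightarrow> real) \<Rightarrow> 'a \<Rightarrow> bool" where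
  "cond_integrable N \<pi> C W \<omega> \<longleftrightarrow> integrable (cond_distr N \<pi> C W \<omega>) (\<lambda>w. w)"

definition condit_prob ::
  "'b measure \<Rightarrow> ('b \<Rightarrow> 'a) \<Rightarrow> 'a measure \<Rightarrow> 'b set \<Rightarrow> 'a \<Rightarrow> real" where
  "condit_prob N \<pi> C A = cond_expect N \<pi> C (indicator A)"

definition tendsto_in_prob ::
  "'a measure \<Rightarrow> ('i \<Rightarrow> 'a \<Rightarrow> real) \<Rightarrow> ('a \<Rightarrow> real) \<Rightarrow> 'i filter \<Rightarrow> bool" where
  "tendsto_in_prob M X Y Fl \<longleftrightarrow>
     (\<forall>\<eta>>0. ((\<lambda>i. measure M {\<omega> \<in> space M. \<eta> < \<bar>X i \<omega> - Y \<omega>\<bar>}) \<longlongrightarrow> 0) Fl)"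

definition bounded_rv :: "'a measure \<Rightarrow> ('a \<Rightarrow> real) \<Rightarrow> bool" where
  "bounded_rv G Y \<longleftrightarrow> Y \<in> borel_measurable G \<and> bounded (Y ` space G)"

definition stable_conv ::
  "'a measure \<Rightarrow> 'b measure \<Rightarrow> ('b \<Rightarrow> 'a) \<Rightarrow> 'a measure
    \<Rightarrow> ('i \<Rightarrow> 'a \<Rightarrow> 'e::topological_space) \<Rightarrow> ('b \<Rightarrow> 'e) \<Rightarrow> 'i filter \<Rightarrow> bool" where
  "stable_conv M N \<pi> G X Y Fl \<longleftrightarrow>
     (\<forall>f \<zeta>. continuous_on UNIV f \<longrightarrow> bounded (range f) \<longrightarrow> bounded_rv G \<zeta> \<longrightarrow>
        ((\<lambda>i. \<integral>\<omega>. f (X i \<omega>) * \<zeta> \<omega> \<partial>M) \<longlongrightarrow> (\<integral>w. (f (Y w) * \<zeta> (\<pi> w) :: real) \<partial>N)) Fl)"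

definition to_infinity_in :: "real set \<Rightarrow> real filter" where
  "to_infinity_in TT = inf at_top (principal TT)"

definition seqs_to_infinity :: "real set \<Rightarrow> real \<Rightarrow> (nat \<Rightarrow> real) set" where
  "seqs_to_infinity TT T0 =
     {\<tau>. (\<forall>n. \<tau> n \<in> TT \<and> T0 \<le> \<tau> n) \<and> filterlim \<tau> at_top sequentially}"

text \<open>The space of continuous functions vanishing at infinity, as a subset of the bounded continuous
  functions with their supremum norm.\<close>

definition C_hat :: "('n::euclidean_space \<Rightarrow>\<^sub>C real) set" where
  "C_hat = {f. (apply_bcontfun f \<longlongrightarrow> 0) at_infinity}"

definition theta_dag :: "real^'p \<Rightarrow> real^'p^'p \<Rightarrow> real^'p \<Rightarrow> real^'p" where
  "theta_dag \<theta>s A u = \<theta>s + A *v u"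

definition U_dom :: "(real^'p) set \<Rightarrow> real^'p \<Rightarrow> real^'p^'p \<Rightarrow> (real^'p) set" where
  "U_dom \<Theta> \<theta>s A = {u. theta_dag \<theta>s A u \<in> \<Theta>}"

definition V_dom :: "(real^'p) set \<Rightarrow> real^'p \<Rightarrow> real^'p^'p \<Rightarrow> real \<Rightarrow> (real^'p) set" where
  "V_dom \<Theta> \<theta>s A r = {u \<in> U_dom \<Theta> \<theta>s A. r \<le> norm u}"

definition B_dom :: "(real^'p) set \<Rightarrow> real^'p \<Rightarrow> real^'p^'p \<Rightarrow> real \<Rightarrow> (real^'p) set" where
  "B_dom \<Theta> \<theta>s A c = {u. norm u < c \<and> theta_dag \<theta>s A u \<in> \<Theta>}"

definition sup_or_zero :: "('u \<Rightarrow> real) \<Rightarrow> 'u set \<Rightarrow> real" where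
  "sup_or_zero z V = (if V = {} then 0 else (SUP u\<in>V. z u))"

text \<open>In the next two definitions, \<open>Z \<omega>\<close> is a path of the (extended) field at a fixed time. The
  threshold \<open>e\<close> is a random variable.\<close>

definition S_event :: "'a measure \<Rightarrow> ('a \<Rightarrow> real^'p \<Rightarrow> real) \<Rightarrow> (real^'p) set \<Rightarrow> ('a \<Rightarrow> real) \<Rightarrow> 'a set"
  where "S_event M Z V e = {\<omega> \<in> space M. e \<omega> \<le> sup_or_zero (Z \<omega>) V}"

definition log_modulus :: "(real^'p \<Rightarrow> real) \<Rightarrow> (real^'p) set \<Rightarrow> real \<Rightarrow> real" where
  "log_modulus z B \<delta> =
     Sup {\<bar>ln (z u2) - ln (z u1)\<bar> | u1 u2. u1 \<in> B \<and> u2 \<in> B \<and> norm (u2 - u1) \<le> \<delta>}"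

definition W_event ::
  "'a measure \<Rightarrow> ('a \<Rightarrow> real^'p \<Rightarrow> real) \<Rightarrow> (real^'p) set \<Rightarrow> real \<Rightarrow> real \<Rightarrow> 'a set" where
  "W_event M Z B \<delta> \<epsilon> = {\<omega> \<in> space M. \<epsilon> < log_modulus (Z \<omega>) B \<delta>}"

definition maximizes :: "('u \<Rightarrow> real) \<Rightarrow> 'u \<Rightarrow> bool" where
  "maximizes z u \<longleftrightarrow> (\<forall>v. z v \<le> z u)"

end

theory Submission
  imports Defs
begin

text \<open>
  The conclusions are about conditional expectations, but every error can be controlled without
  conditioning: \<open>E_C\<close> is a contraction from \<open>L1\<close> of the extension to \<open>L1\<close> of the base space, so
  convergence in probability of \<open>E_C[x_n Y]\<close> survives a replacement of \<open>x_n\<close> by variables that are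
  close to it in mean for large \<open>n\<close> (\<open>cond_conv_approx\<close>). Three such replacements are made, all of
  them along an arbitrary sequence of times tending to infinity.

  First, a bounded Lipschitz functional of the field is replaced by the same functional of an
  interpolation of the field between finitely many points; there the finite-dimensional hypothesis
  applies, and the error is small because the tails and the modulus of continuity of the field are
  tight (\<open>lipschitz_functional\<close>). Second, a bounded continuous functional on \<open>C_hat\<close> is squeezed
  between its Lipschitz sup-convolutions and the corresponding inf-convolutions
  (\<open>continuous_functional_conv\<close>). Third, for bounded continuous \<open>f\<close>, the value of \<open>f\<close> at the
  maximizer of a path \<open>z\<close> is at most
  \<open>sup_u (f u + k z u) - k sup z\<close>, which is Lipschitz in \<open>z\<close> and tends for \<open>k \<rightarrow> \<infinity>\<close> to \<open>f\<close> at the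
  maximizer if that is unique and the maximum is positive; applied to \<open>f\<close> and \<open>- f\<close>, this squeezes
  \<open>f\<close> of the estimator (\<open>argmax_conv\<close>). Positivity of the maximum of the limit is inherited from
  \<open>Z_T(0) = 1\<close>.

  The extension of the field outside its domain is dominated by the boundary values, so the rescaled
  estimator maximizes the whole path, and the tails of the path are dominated by the suprema in the
  polynomial estimate, which gives tightness of the tails. The hypothesis on the modulus of
  continuity of the logarithm becomes unconditional by a reverse Fatou argument, and turns into an
  estimate for the field itself because the logarithm vanishes at \<open>0\<close> and hence is bounded along a
  chain of small steps. The weights \<open>\<Psi>_T\<close> only cost the mean of \<open>1 - \<Psi>_T\<close>, which tends to \<open>0\<close>.

  For \<open>f\<close> of polynomial growth, the path of the field has the value \<open>1\<close> at \<open>0\<close>, so an estimator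
  beyond radius \<open>r\<close> forces the supremum beyond \<open>r\<close> to be at least \<open>1\<close>. The polynomial estimate,
  summed over dyadic radii, therefore bounds the conditional moments of order \<open>q < L\<close> almost surely
  and uniformly along the sequence (\<open>moment_tail\<close>), and this conditional uniform integrability
  removes the truncation of \<open>f\<close> (\<open>cond_conv_unbounded\<close>). The limit need not be integrable, so its
  conditional expectation is handled through the regular conditional distribution; that one exists
  is shown by constructing conditional distribution functions.
\<close>

section \<open>Regular conditional distributions\<close>

text \<open>On the set where the inequality fails, the integral of the positive difference is at most \<open>0\<close>.\<close>

lemma AE_le_if_set_nn_integral_le:
  fixes f g :: "'a \<Rightarrow> ennreal"
  assumes [measurable]: "f \<in> borel_measurable Q" "g \<in> borel_measurable Q"
    and le: "\<And>A. A \<in> sets Q \<Longrightarrow> (\<integral>\<^sup>+x\<in>A. f x \<partial>Q) \<le> (\<integral>\<^sup>+x\<in>A. g x \<partial>Q)"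
    and fin: "(\<integral>\<^sup>+x. g x \<partial>Q) < \<infinity>"
  shows "AE x in Q. f x \<le> g x"
proof -
  define A where "A = {x \<in> space Q. g x < f x}"
  have [measurable]: "A \<in> sets Q" unfolding A_def by measurable
  have gA: "(\<integral>\<^sup>+x\<in>A. g x \<partial>Q) < \<infinity>"
    by (rule le_less_trans[OF nn_integral_mono fin]) (auto simp: indicator_def)
  have "(\<integral>\<^sup>+x. f x * indicator A x - g x * indicator A x \<partial>Q)
      = (\<integral>\<^sup>+x\<in>A. f x \<partial>Q) - (\<integral>\<^sup>+x\<in>A. g x \<partial>Q)"
    by (rule nn_integral_diff) (use gA in \<open>auto simp: A_def indicator_def\<close>)
  also have "\<dots> = 0" using le[of A] gA by (simp add: diff_eq_0_iff_ennreal)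
  finally have "AE x in Q. f x * indicator A x - g x * indicator A x = 0"
    by (subst (asm) nn_integral_0_iff_AE) auto
  then show ?thesis using AE_space
  proof (eventually_elim)
    fix x assume *: "f x * indicator A x - g x * indicator A x = 0" "x \<in> space Q"
    show "f x \<le> g x"
    proof (cases "x \<in> A")
      case True
      with * show ?thesis
        by (auto simp: A_def ennreal_minus_eq_0)
    qed (use * in \<open>auto simp: A_def not_less\<close>)
  qed
qed

text \<open>Radon-Nikodym derivatives give, for each level \<open>x\<close>, a version \<open>g x\<close> of the conditional probability
  of \<open>V \<le> x\<close>. The infimum of \<open>g q\<close> over the rationals \<open>q > x\<close> is a right-continuous monotone function
  of \<open>x\<close> for every \<open>\<omega>\<close>, whatever the versions are, and since \<open>V\<close> is bounded the versions can be
  chosen such that it is \<open>0\<close> to the left of \<open>-2\<close> and \<open>1\<close> from \<open>2\<close> on. It is thus a distribution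
  function without exceptional set. Its conditional meaning comes from the versions being almost
  surely monotone along the rationals.\<close>

lemma regular_cond_distr_exists_bounded:
  fixes V :: "'b \<Rightarrow> real"
  assumes N: "prob_space N" and \<pi>[measurable]: "\<pi> \<in> measurable N C"
    and V[measurable]: "V \<in> borel_measurable N" and bd: "\<And>w. \<bar>V w\<bar> < 2"
  shows "\<exists>\<kappa>. regular_cond_distr N \<pi> C V \<kappa>"
proof -
  interpret N: prob_space N by fact
  define Q where "Q = distr N C \<pi>"
  interpret Q: prob_space Q unfolding Q_def by (rule N.prob_space_distr) measurable
  have sQ[measurable_cong]: "sets Q = sets C" by (simp add: Q_def)
  have spQ: "space Q = space C" by (simp add: Q_def)
  define p where "p A x = emeasure N {w \<in> space N. \<pi> w \<in> A \<and> V w \<le> x}" for A x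
  have pU: "p A x = emeasure Q A" if "x \<ge> 2" "A \<in> sets C" for A x
    unfolding p_def Q_def using that bd order_less_le_trans[OF abs_ge_self[THEN le_less_trans, OF bd] that(1)]
    by (subst emeasure_distr) (auto intro!: arg_cong[where f="emeasure N"] simp: less_imp_le)
  have p0: "p A x = 0" if "x < - 2" for A x
  proof -
    have "x < V w" for w using bd[of w] that by (auto simp: abs_less_iff)
    then have "{w \<in> space N. \<pi> w \<in> A \<and> V w \<le> x} = {}" by (auto simp: not_le)
    then show ?thesis unfolding p_def by (simp only: emeasure_empty)
  qed
  have p_mono: "p A x \<le> p A y" if "x \<le> y" "A \<in> sets C" for A x y
    unfolding p_def using that(2) by (intro emeasure_mono) (use that in auto)
  have pQ: "p A x \<le> emeasure Q A" if "A \<in> sets C" for A x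
    using p_mono[OF _ that, of x "max x 2"] pU[OF _ that, of "max x 2"] by simp
  have ex: "\<exists>g. g \<in> borel_measurable C \<and> (\<forall>\<omega>. 0 \<le> g \<omega> \<and> g \<omega> \<le> (1::real)) \<and>
      (x < -2 \<longrightarrow> g = (\<lambda>_. 0)) \<and> (2 \<le> x \<longrightarrow> g = (\<lambda>_. 1)) \<and>
      (\<forall>A\<in>sets C. (\<integral>\<^sup>+\<omega>\<in>A. ennreal (g \<omega>) \<partial>Q) = p A x)" for x
  proof -
    consider "x < -2" | "2 \<le> x" | "-2 \<le> x" "x < 2" by linarith
    then show ?thesis
    proof cases
      case 1
      show ?thesis by (rule exI[of _ "\<lambda>_. 0"]) (use 1 p0 in auto)
    next
      case 2
      show ?thesis by (rule exI[of _ "\<lambda>_. 1"]) (use 2 pU in auto)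
    next
      case 3
      define \<nu> where "\<nu> = distr (density N (indicator {w \<in> space N. V w \<le> x})) C \<pi>"
      have \<nu>: "emeasure \<nu> A = p A x" if A[measurable]: "A \<in> sets C" for A
      proof -
        have "emeasure \<nu> A = (\<integral>\<^sup>+w. indicator {w \<in> space N. V w \<le> x} w * indicator (\<pi> -` A \<inter> space N) w \<partial>N)"
          unfolding \<nu>_def by (simp add: emeasure_distr emeasure_density)
        also have "\<dots> = (\<integral>\<^sup>+w. indicator {w \<in> space N. \<pi> w \<in> A \<and> V w \<le> x} w \<partial>N)"
          by (intro nn_integral_cong) (auto simp: indicator_def)
        finally show ?thesis by (simp add: p_def)
      qed
      have ac: "absolutely_continuous Q \<nu>"
        unfolding absolutely_continuous_def
      proof
        fix A assume "A \<in> null_sets Q"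
        then have A: "A \<in> sets C" "emeasure Q A = 0" by (auto simp: null_sets_def Q_def)
        then show "A \<in> null_sets \<nu>" using pQ[of A x] \<nu>[of A] by (auto simp: null_sets_def \<nu>_def)
      qed
      have s\<nu>: "sets \<nu> = sets Q" by (simp add: \<nu>_def Q_def)
      define h where "h = RN_deriv Q \<nu>"
      have h[measurable]: "h \<in> borel_measurable Q" by (simp add: h_def)
      have hA: "(\<integral>\<^sup>+\<omega>\<in>A. h \<omega> \<partial>Q) = p A x" if "A \<in> sets C" for A
        using Q.density_RN_deriv[OF ac s\<nu>] \<nu>[OF that] emeasure_density[OF h, of A] that
        by (simp add: h_def)
      have h1: "AE \<omega> in Q. h \<omega> \<le> 1"
        by (rule AE_le_if_set_nn_integral_le) (use hA pQ Q.emeasure_space_1 in \<open>auto simp: sQ\<close>)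
      show ?thesis
      proof (intro exI[of _ "\<lambda>\<omega>. enn2real (min 1 (h \<omega>))"] conjI allI impI ballI)
        show "(\<lambda>\<omega>. enn2real (min 1 (h \<omega>))) \<in> borel_measurable C"
          using h by measurable
        fix \<omega>
        show "enn2real (min 1 (h \<omega>)) \<le> 1"
          using enn2real_mono[of "min 1 (h \<omega>)" 1] by simp
      next
        fix A assume A: "A \<in> sets C"
        have "(\<integral>\<^sup>+\<omega>\<in>A. ennreal (enn2real (min 1 (h \<omega>))) \<partial>Q) = (\<integral>\<^sup>+\<omega>\<in>A. h \<omega> \<partial>Q)"
        proof (rule nn_integral_cong_AE, use h1 in eventually_elim)
          fix \<omega> assume h: "h \<omega> \<le> 1"
          have "h \<omega> < top" using h ennreal_one_less_top by (rule le_less_trans)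
          with h show "ennreal (enn2real (min 1 (h \<omega>))) * indicator A \<omega> = h \<omega> * indicator A \<omega>"
            by (simp add: min_absorb2)
        qed
        then show "(\<integral>\<^sup>+\<omega>\<in>A. ennreal (enn2real (min 1 (h \<omega>))) \<partial>Q) = p A x" using hA[OF A] by simp
      qed (use 3 in auto)
    qed
  qed
  from choice[OF allI[OF ex]] obtain g where G: "\<forall>x. g x \<in> borel_measurable C \<and> (\<forall>\<omega>. 0 \<le> g x \<omega> \<and> g x \<omega> \<le> (1::real)) \<and>
      (x < -2 \<longrightarrow> g x = (\<lambda>_. 0)) \<and> (2 \<le> x \<longrightarrow> g x = (\<lambda>_. 1)) \<and>
      (\<forall>A\<in>sets C. (\<integral>\<^sup>+\<omega>\<in>A. ennreal (g x \<omega>) \<partial>Q) = p A x)" ..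
  then have g[measurable]: "\<And>x. g x \<in> borel_measurable C"
    and g01: "\<And>x \<omega>. 0 \<le> g x \<omega>" "\<And>x \<omega>. g x \<omega> \<le> (1::real)"
    and g0: "\<And>x \<omega>. x < -2 \<Longrightarrow> g x \<omega> = 0" and g1: "\<And>x \<omega>. 2 \<le> x \<Longrightarrow> g x \<omega> = 1"
    and gA: "\<And>x A. A \<in> sets C \<Longrightarrow> (\<integral>\<^sup>+\<omega>\<in>A. ennreal (g x \<omega>) \<partial>Q) = p A x"
    by simp_all
  \<comment> \<open>Rational levels strictly to the right of \<open>x\<close>: the strictness makes \<open>F \<omega>\<close> right-continuous.\<close>
  define F where "F \<omega> x = (INF q\<in>{q\<in>\<rat>. x < q}. g q \<omega>)" for \<omega> x
  have ne: "{q\<in>\<rat>. x < q} \<noteq> {}" for x :: real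
    using Rats_dense_in_real[of x "x+1"] by auto
  have bb: "bdd_below ((\<lambda>q. g q \<omega>) ` X)" for \<omega> X
    using g01(1) by (auto intro!: bdd_belowI[of _ 0])
  have F_le: "F \<omega> x \<le> g q \<omega>" if "q \<in> \<rat>" "x < q" for q x \<omega>
    unfolding F_def by (rule cINF_lower[OF bb]) (use that in auto)
  have F_ge: "c \<le> F \<omega> x" if "\<And>q. q \<in> \<rat> \<Longrightarrow> x < q \<Longrightarrow> c \<le> g q \<omega>" for c \<omega> x
    unfolding F_def by (rule cINF_greatest[OF ne]) (use that in auto)
  have F_less: "\<exists>q\<in>\<rat>. x < q \<and> g q \<omega> < c" if "F \<omega> x < c" for c \<omega> x
    using F_ge[of x c \<omega>] that by (meson not_le)
  have F01: "0 \<le> F \<omega> x" "F \<omega> x \<le> 1" for \<omega> x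
  proof -
    obtain q where "q \<in> \<rat>" "x < q" using ne by blast
    then show "F \<omega> x \<le> 1" using F_le[of q x \<omega>] g01(2)[of q \<omega>] by simp
  qed (use F_ge g01 in auto)
  have F_mono: "F \<omega> x \<le> F \<omega> y" if "x \<le> y" for \<omega> x y
    by (rule F_ge, rule F_le) (use that in auto)
  have F_rc: "continuous (at_right x) (F \<omega>)" for x \<omega>
    unfolding continuous_within
  proof (rule order_tendstoI)
    fix c assume "c < F \<omega> x"
    then show "eventually (\<lambda>y. c < F \<omega> y) (at_right x)"
      by (intro eventually_at_rightI[of x "x+1"]) (use F_mono[of x] in \<open>force intro: less_le_trans\<close>)+
  next
    fix c assume "F \<omega> x < c"
    then obtain q where q: "q \<in> \<rat>" "x < q" "g q \<omega> < c" using F_less by blast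
    then show "eventually (\<lambda>y. F \<omega> y < c) (at_right x)"
      by (intro eventually_at_rightI[of x q]) (auto intro: le_less_trans[OF F_le])
  qed
  have F_bot: "(F \<omega> \<longlongrightarrow> 0) at_bot" for \<omega>
  proof (rule tendsto_eventually, rule eventually_at_bot_linorderI[of "-4"])
    fix x :: real assume "x \<le> -4"
    then show "F \<omega> x = 0" using F_le[of "-3" x \<omega>] g0[of "-3" \<omega>] F01[of \<omega> x] by simp
  qed
  have F_top: "(F \<omega> \<longlongrightarrow> 1) at_top" for \<omega>
  proof (rule tendsto_eventually, rule eventually_at_top_linorderI[of 2])
    fix x :: real assume "2 \<le> x"
    then have "1 \<le> F \<omega> x" by (intro F_ge) (use g1 in auto)
    then show "F \<omega> x = 1" using F01[of \<omega> x] by simp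
  qed
  have FM[measurable]: "(\<lambda>\<omega>. F \<omega> x) \<in> borel_measurable C" for x
    unfolding F_def
    by (rule borel_measurable_cINF) (auto intro: bb countable_subset[OF _ countable_rat])
  define \<kappa> where "\<kappa> \<omega> = interval_measure (F \<omega>)" for \<omega>
  have rd: "real_distribution (\<kappa> \<omega>)" for \<omega>
    unfolding \<kappa>_def by (rule real_distribution_interval_measure[OF F_mono F_rc F_bot F_top])
  have cdf: "cdf (\<kappa> \<omega>) x = F \<omega> x" for \<omega> x
    unfolding \<kappa>_def by (subst cdf_interval_measure[OF F_mono F_rc F_bot]) auto
  have em: "emeasure (\<kappa> \<omega>) {..x} = ennreal (F \<omega> x)" for \<omega> x
  proof -
    interpret real_distribution "\<kappa> \<omega>" by (rule rd)
    show ?thesis using cdf[of \<omega> x] by (simp add: cdf_def emeasure_eq_measure)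
  qed
  have \<kappa>sub[measurable]: "\<kappa> \<in> measurable C (subprob_algebra borel)"
  proof (rule measurable_subprob_algebra_generated[where \<Omega>=UNIV and G="range atMost"])
    show "sets borel = sigma_sets UNIV (range (atMost :: real \<Rightarrow> _))"
      by (subst borel_eq_atMost) simp
    show "Int_stable (range (atMost :: real \<Rightarrow> _))"
      by (auto simp: Int_stable_def)
    fix \<omega>
    interpret real_distribution "\<kappa> \<omega>" by (rule rd)
    show "subprob_space (\<kappa> \<omega>)" by unfold_locales
    show "sets (\<kappa> \<omega>) = sets borel" by simp
  next
    fix A :: "real set" assume "A \<in> range atMost"
    then show "(\<lambda>a. emeasure (\<kappa> a) A) \<in> borel_measurable C" by (auto simp: em)
  next
    have "emeasure (\<kappa> \<omega>) UNIV = 1" for \<omega>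
    proof -
      interpret real_distribution "\<kappa> \<omega>" by (rule rd)
      show ?thesis using emeasure_space_1 by simp
    qed
    then show "(\<lambda>a. emeasure (\<kappa> a) UNIV) \<in> borel_measurable C" by simp
  qed simp
  have \<kappa>M: "\<kappa> \<in> measurable C (prob_algebra borel)"
    using \<kappa>sub rd
    by (auto simp: prob_algebra_def real_distribution_def intro!: measurable_restrict_space2)
  \<comment> \<open>\<open>g x\<close> lies below \<open>F\<close> almost surely, and \<open>F\<close> lies below \<open>g q\<close> for rational \<open>q\<close> decreasing to \<open>x\<close>.\<close>
  have FA: "(\<integral>\<^sup>+\<omega>\<in>A. ennreal (F \<omega> x) \<partial>Q) = p A x" if A[measurable]: "A \<in> sets C" for A x
  proof (rule antisym)
    have gmono: "AE \<omega> in Q. g x \<omega> \<le> g q \<omega>" if "x \<le> q" for q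
    proof -
      have "AE \<omega> in Q. ennreal (g x \<omega>) \<le> ennreal (g q \<omega>)"
      proof (rule AE_le_if_set_nn_integral_le)
        show "(\<integral>\<^sup>+\<omega>. ennreal (g q \<omega>) \<partial>Q) < \<infinity>"
          by (rule le_less_trans[OF nn_integral_mono[where v="\<lambda>_. 1"]])
             (auto simp: g01 Q.emeasure_space_1)
      qed (use gA p_mono[OF that] in \<open>auto simp: sQ\<close>)
      then show ?thesis by (simp add: g01)
    qed
    have "AE \<omega> in Q. \<forall>q\<in>{q\<in>\<rat>. x < q}. g x \<omega> \<le> g q \<omega>"
      by (subst AE_ball_countable)
         (auto intro!: gmono intro: countable_subset[OF _ countable_rat] less_imp_le)
    then have gF: "AE \<omega> in Q. g x \<omega> \<le> F \<omega> x"
      by eventually_elim (auto intro!: F_ge)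
    have "p A x = (\<integral>\<^sup>+\<omega>\<in>A. ennreal (g x \<omega>) \<partial>Q)" using gA[OF A] by simp
    also have "\<dots> \<le> (\<integral>\<^sup>+\<omega>\<in>A. ennreal (F \<omega> x) \<partial>Q)"
      by (rule nn_integral_mono_AE, use gF in eventually_elim)
         (auto simp: indicator_def intro!: ennreal_leI)
    finally show "p A x \<le> (\<integral>\<^sup>+\<omega>\<in>A. ennreal (F \<omega> x) \<partial>Q)" .
    have "\<exists>q\<in>\<rat>. x < q \<and> q < x + 1 / real (Suc n)" for n
      by (rule Rats_dense_in_real) simp
    then obtain r where r: "\<And>n. r n \<in> \<rat>" "\<And>n. x < r n" "\<And>n. r n < x + 1 / real (Suc n)" by metis
    have le: "(\<integral>\<^sup>+\<omega>\<in>A. ennreal (F \<omega> x) \<partial>Q) \<le> p A (x + 1 / real (Suc n))" for n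
    proof -
      have "(\<integral>\<^sup>+\<omega>\<in>A. ennreal (F \<omega> x) \<partial>Q) \<le> (\<integral>\<^sup>+\<omega>\<in>A. ennreal (g (r n) \<omega>) \<partial>Q)"
        by (intro nn_integral_mono mult_right_mono ennreal_leI F_le r) auto
      also have "\<dots> \<le> p A (x + 1 / real (Suc n))"
        using p_mono[of "r n" "x + 1 / real (Suc n)" A] r(3)[of n] by (simp add: gA less_imp_le)
      finally show ?thesis .
    qed
    have "(\<lambda>n. p A (x + 1 / real (Suc n))) \<longlonglongrightarrow> emeasure N (\<Inter>n. {w \<in> space N. \<pi> w \<in> A \<and> V w \<le> x + 1 / real (Suc n)})"
      unfolding p_def
    proof (rule Lim_emeasure_decseq)
      have "V w \<le> x + 1 / real (Suc i) \<longrightarrow> V w \<le> x + 1 / real (Suc j)" if "j \<le> i" for w i j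
        using that frac_le[of 1 1 "real (Suc j)" "real (Suc i)"] by fastforce
      then show "decseq (\<lambda>n. {w \<in> space N. \<pi> w \<in> A \<and> V w \<le> x + 1 / real (Suc n)})"
        unfolding decseq_def by blast
    qed auto
    also have "(\<Inter>n. {w \<in> space N. \<pi> w \<in> A \<and> V w \<le> x + 1 / real (Suc n)}) = {w \<in> space N. \<pi> w \<in> A \<and> V w \<le> x}"
    proof -
      have "V w \<le> x" if "\<forall>n. V w \<le> x + 1 / real (Suc n)" for w
        by (rule LIMSEQ_le_const[OF tendsto_add[OF tendsto_const LIMSEQ_Suc[OF lim_1_over_n], of x, simplified]])
           (use that in auto)
      moreover have "V w \<le> x + 1 / real (Suc n)" if "V w \<le> x" for w n
        using that by (rule order_trans) simp
      ultimately show ?thesis by blast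
    qed
    finally show "(\<integral>\<^sup>+\<omega>\<in>A. ennreal (F \<omega> x) \<partial>Q) \<le> p A x"
      unfolding p_def[symmetric] by (rule LIMSEQ_le_const) (use le in auto)
  qed
  have "emeasure N {w \<in> space N. \<pi> w \<in> A \<and> V w \<in> B} = (\<integral>\<^sup>+\<omega>\<in>A. emeasure (\<kappa> \<omega>) B \<partial>Q)"
    if A[measurable]: "A \<in> sets C" and B[measurable]: "B \<in> sets borel" for A B
  proof -
    \<comment> \<open>For fixed \<open>A\<close> both sides are finite measures in \<open>B\<close>, so equal distribution functions suffice.\<close>
    define D where "D = density N (indicator {w \<in> space N. \<pi> w \<in> A})"
    define M1 where "M1 = distr D borel V"
    define M2 where "M2 = bind (density Q (indicator A)) \<kappa>"
    have e1: "emeasure M1 B = emeasure N {w \<in> space N. \<pi> w \<in> A \<and> V w \<in> B}"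
      if [measurable]: "B \<in> sets borel" for B
    proof -
      have "emeasure M1 B = (\<integral>\<^sup>+w. indicator {w \<in> space N. \<pi> w \<in> A} w * indicator (V -` B \<inter> space N) w \<partial>N)"
        unfolding M1_def D_def by (simp add: emeasure_distr emeasure_density)
      also have "\<dots> = (\<integral>\<^sup>+w. indicator {w \<in> space N. \<pi> w \<in> A \<and> V w \<in> B} w \<partial>N)"
        by (intro nn_integral_cong) (auto simp: indicator_def)
      finally show ?thesis by simp
    qed
    have Cne: "space C \<noteq> {}" using Q.not_empty spQ by simp
    have s2: "sets M2 = sets borel"
      unfolding M2_def by (rule sets_bind) (use subprob_measurableD(2)[OF \<kappa>sub] Cne in \<open>auto simp: spQ\<close>)
    have e2: "emeasure M2 B = (\<integral>\<^sup>+\<omega>\<in>A. emeasure (\<kappa> \<omega>) B \<partial>Q)" if [measurable]: "B \<in> sets borel" for B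
    proof -
      have "emeasure M2 B = (\<integral>\<^sup>+\<omega>. emeasure (\<kappa> \<omega>) B \<partial>density Q (indicator A))"
        unfolding M2_def by (rule emeasure_bind[where N=borel]) (use Cne in \<open>auto simp: spQ\<close>)
      also have "\<dots> = (\<integral>\<^sup>+\<omega>. indicator A \<omega> * emeasure (\<kappa> \<omega>) B \<partial>Q)"
        by (subst nn_integral_density) auto
      finally show ?thesis by (simp add: mult.commute)
    qed
    have "finite_measure M1"
      by (rule finite_measureI) (use e1[of UNIV] N.emeasure_finite in \<open>simp add: M1_def\<close>)
    then have c1: "finite_borel_measure M1"
      by (simp add: finite_borel_measure_def finite_borel_measure_axioms_def M1_def)
    have "emeasure M2 UNIV \<le> (\<integral>\<^sup>+\<omega>. 1 \<partial>Q)"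
    proof (subst e2)
      have "emeasure (\<kappa> \<omega>) UNIV \<le> 1" for \<omega>
      proof -
        interpret real_distribution "\<kappa> \<omega>" by (rule rd)
        show ?thesis using emeasure_space_1 by simp
      qed
      then show "(\<integral>\<^sup>+\<omega>\<in>A. emeasure (\<kappa> \<omega>) UNIV \<partial>Q) \<le> (\<integral>\<^sup>+\<omega>. 1 \<partial>Q)"
        by (intro nn_integral_mono) (auto simp: indicator_def)
    qed simp
    then have "finite_measure M2"
      using sets_eq_imp_space_eq[OF s2] Q.emeasure_space_1
      by (intro finite_measureI) (auto simp: top_unique)
    then have c2: "finite_borel_measure M2"
      by (simp add: finite_borel_measure_def finite_borel_measure_axioms_def s2)
    have "M1 = M2"
    proof (rule cdf_unique'[OF c1 c2], rule ext)
      fix x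
      have "emeasure M1 {..x} = emeasure M2 {..x}"
        by (subst e1, simp, subst e2, simp) (simp add: em FA p_def)
      then show "cdf M1 x = cdf M2 x" by (simp add: cdf_def measure_def)
    qed
    then show ?thesis using e1[OF B] e2[OF B] by simp
  qed
  then show ?thesis
    unfolding regular_cond_distr_def Q_def[symmetric] using \<kappa>M by blast
qed

text \<open>Conditioning is compatible with the injective change of variables \<open>arctan\<close>, which reduces the claim
  to bounded variables. The kernel of \<open>arctan W\<close> may charge the points \<open>\<plusminus>\<pi>/2\<close> for some \<open>\<omega>\<close>, but this
  is harmless because \<open>tan\<close> is defined, and measurable, everywhere.\<close>

lemma regular_cond_distr_exists:
  fixes W :: "'b \<Rightarrow> real"
  assumes N: "prob_space N" and \<pi>[measurable]: "\<pi> \<in> measurable N C"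
    and W[measurable]: "W \<in> borel_measurable N"
  shows "\<exists>\<kappa>. regular_cond_distr N \<pi> C W \<kappa>"
proof -
  have "\<bar>arctan x\<bar> < 2" for x :: real
    using arctan_bounded[of x] pi_less_4 by (auto simp: abs_less_iff)
  moreover have "(\<lambda>w. arctan (W w)) \<in> borel_measurable N"
    by measurable
  ultimately obtain \<kappa> where \<kappa>: "regular_cond_distr N \<pi> C (\<lambda>w. arctan (W w)) \<kappa>"
    using regular_cond_distr_exists_bounded[OF N \<pi>, of "\<lambda>w. arctan (W w)"] by blast
  have tan[measurable]: "(tan :: real \<Rightarrow> real) \<in> borel_measurable borel"
    unfolding tan_def[abs_def] using borel_measurable_continuous_onI[of "sin :: real \<Rightarrow> real"]
      borel_measurable_continuous_onI[of "cos :: real \<Rightarrow> real"]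
    by (auto intro!: borel_measurable_divide continuous_intros)
  have \<kappa>M: "\<kappa> \<in> measurable C (prob_algebra borel)"
    and \<kappa>A: "\<And>A B. A \<in> sets C \<Longrightarrow> B \<in> sets borel \<Longrightarrow>
        emeasure N {w \<in> space N. \<pi> w \<in> A \<and> arctan (W w) \<in> B}
          = (\<integral>\<^sup>+\<omega>\<in>A. emeasure (\<kappa> \<omega>) B \<partial>(distr N C \<pi>))"
    using \<kappa> unfolding regular_cond_distr_def by blast+
  have "regular_cond_distr N \<pi> C W (\<lambda>\<omega>. distr (\<kappa> \<omega>) borel tan)"
    unfolding regular_cond_distr_def
  proof (intro conjI ballI)
    show "(\<lambda>\<omega>. distr (\<kappa> \<omega>) borel tan) \<in> measurable C (prob_algebra borel)"
      by (rule measurable_compose[OF \<kappa>M measurable_distr_prob_space[OF tan]])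
    fix A B assume A: "A \<in> sets C" and B[measurable]: "B \<in> sets (borel :: real measure)"
    have tB: "tan -` B \<in> sets (borel :: real measure)"
      using measurable_sets[OF tan B] by simp
    have "emeasure N {w \<in> space N. \<pi> w \<in> A \<and> W w \<in> B}
        = emeasure N {w \<in> space N. \<pi> w \<in> A \<and> arctan (W w) \<in> tan -` B}"
      by (simp add: arctan)
    also have "\<dots> = (\<integral>\<^sup>+\<omega>\<in>A. emeasure (\<kappa> \<omega>) (tan -` B) \<partial>(distr N C \<pi>))"
      by (rule \<kappa>A[OF A tB])
    also have "\<dots> = (\<integral>\<^sup>+\<omega>\<in>A. emeasure (distr (\<kappa> \<omega>) borel tan) B \<partial>(distr N C \<pi>))"
    proof (rule nn_integral_cong)
      fix \<omega> assume "\<omega> \<in> space (distr N C \<pi>)"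
      then have "\<kappa> \<omega> \<in> space (prob_algebra borel)" using measurable_space[OF \<kappa>M] by simp
      then have s: "sets (\<kappa> \<omega>) = sets borel" by (simp add: space_prob_algebra)
      then have "space (\<kappa> \<omega>) = UNIV" using sets_eq_imp_space_eq[OF s] by simp
      moreover have "tan \<in> measurable (\<kappa> \<omega>) borel" using tan s by (simp cong: measurable_cong_sets)
      ultimately show "emeasure (\<kappa> \<omega>) (tan -` B) * indicator A \<omega>
          = emeasure (distr (\<kappa> \<omega>) borel tan) B * indicator A \<omega>"
        by (simp add: emeasure_distr)
    qed
    finally show "emeasure N {w \<in> space N. \<pi> w \<in> A \<and> W w \<in> B}
        = (\<integral>\<^sup>+\<omega>\<in>A. emeasure (distr (\<kappa> \<omega>) borel tan) B \<partial>(distr N C \<pi>))" .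
  qed
  then show ?thesis by blast
qed

section \<open>Truncation and bounded random variables\<close>

definition trunc :: "real \<Rightarrow> real \<Rightarrow> real" where
  "trunc c x = max (- c) (min c x)"

lemma trunc_abs_le: "0 \<le> c \<Longrightarrow> \<bar>trunc c x\<bar> \<le> c"
  by (auto simp: trunc_def)

lemma trunc_abs_le_arg: "0 \<le> c \<Longrightarrow> \<bar>trunc c x\<bar> \<le> \<bar>x\<bar>"
  by (auto simp: trunc_def)

lemma trunc_id: "\<bar>x\<bar> \<le> c \<Longrightarrow> trunc c x = x"
  by (auto simp: trunc_def)

lemma abs_diff_trunc: "0 \<le> c \<Longrightarrow> \<bar>x - trunc c x\<bar> = max 0 (\<bar>x\<bar> - c)"
  by (auto simp: trunc_def)

lemma continuous_on_trunc[continuous_intros]: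
  "continuous_on S f \<Longrightarrow> continuous_on S (\<lambda>x. trunc c (f x))"
  unfolding trunc_def by (intro continuous_intros)

lemma borel_measurable_trunc[measurable]: "trunc c \<in> borel_measurable borel"
  unfolding trunc_def by measurable

lemma trunc_tendsto: "(\<lambda>j. trunc (real j) x) \<longlonglongrightarrow> x"
proof (rule tendsto_eventually)
  obtain n :: nat where "\<bar>x\<bar> \<le> real n" using real_arch_simple by blast
  then have "\<forall>j\<ge>n. trunc (real j) x = x" by (auto intro!: trunc_id)
  then show "\<forall>\<^sub>F j in sequentially. trunc (real j) x = x" by (auto simp: eventually_sequentially)
qed

text \<open>Truncating a product \<open>x y\<close> at a high level differs from truncating the factor \<open>x\<close> only by the excess
  of \<open>\<bar>x\<bar>\<close> over the lower level. This exchanges the truncation that defines the conditional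
  expectation of a product with a truncation of one of its factors.\<close>

lemma trunc_mult_diff:
  fixes x y B j m :: real
  assumes y: "\<bar>y\<bar> \<le> B" and B: "1 \<le> B" and m: "0 \<le> m" and j: "m * B \<le> j"
  shows "\<bar>trunc j (x * y) - trunc m x * y\<bar> \<le> B * min (max 0 (\<bar>x\<bar> - m)) j"
proof -
  have j0: "0 \<le> j" using m B j by (meson mult_nonneg_nonneg order_trans zero_le_one)
  have my: "m * \<bar>y\<bar> \<le> j" using mult_left_mono[OF y m] j by linarith
  show ?thesis
  proof (cases "\<bar>x\<bar> \<le> m")
    case True
    have "\<bar>x * y\<bar> \<le> m * B" unfolding abs_mult by (rule mult_mono) (use True y m in auto)
    then show ?thesis using True j j0 B by (simp add: trunc_id)
  next
    case False
    define s where "s = sgn x * sgn y"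
    have xy: "x * y = s * (\<bar>x\<bar> * \<bar>y\<bar>)" unfolding s_def by (simp add: sgn_if abs_if)
    have cm: "trunc m x = sgn x * m" using False m by (auto simp: trunc_def sgn_if)
    have c2: "trunc m x * y = s * (m * \<bar>y\<bar>)" unfolding cm s_def by (simp add: sgn_if abs_if)
    have c1: "trunc j (x * y) = s * min (\<bar>x\<bar> * \<bar>y\<bar>) j"
    proof -
      have "s = 1 \<or> s = -1 \<or> s = 0" by (auto simp: s_def sgn_if)
      moreover have "s = 0 \<Longrightarrow> \<bar>x\<bar> * \<bar>y\<bar> = 0" by (auto simp: s_def sgn_if split: if_splits)
      moreover have "trunc j (s * t) = s * min t j" if "0 \<le> t" "s = 1 \<or> s = -1 \<or> s = 0 \<and> t = 0" for t
        using that j0 by (auto simp: trunc_def min_def max_def)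
      ultimately show ?thesis unfolding xy by (metis abs_ge_zero mult_nonneg_nonneg)
    qed
    have "m * \<bar>y\<bar> \<le> \<bar>x\<bar> * \<bar>y\<bar>" by (rule mult_right_mono) (use False in auto)
    then have nn: "0 \<le> min (\<bar>x\<bar> * \<bar>y\<bar>) j - m * \<bar>y\<bar>" using my by simp
    have "\<bar>s\<bar> \<le> 1" by (auto simp: s_def sgn_if)
    have "\<bar>trunc j (x * y) - trunc m x * y\<bar> = \<bar>s\<bar> * (min (\<bar>x\<bar> * \<bar>y\<bar>) j - m * \<bar>y\<bar>)"
      unfolding c1 c2 using nn by (simp add: abs_mult right_diff_distrib[symmetric])
    also have "\<dots> \<le> 1 * (min (\<bar>x\<bar> * \<bar>y\<bar>) j - m * \<bar>y\<bar>)"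
      by (rule mult_right_mono[OF \<open>\<bar>s\<bar> \<le> 1\<close> nn])
    also have "\<dots> \<le> min (B * (\<bar>x\<bar> - m)) (B * j)"
    proof -
      have "\<bar>y\<bar> * (\<bar>x\<bar> - m) \<le> B * (\<bar>x\<bar> - m)" by (rule mult_right_mono) (use y False in auto)
      moreover have "1 * j \<le> B * j" by (rule mult_right_mono[OF B j0])
      moreover have "0 \<le> m * \<bar>y\<bar>" using m by simp
      ultimately show ?thesis by (auto simp: algebra_simps min_def)
    qed
    also have "\<dots> = B * min (max 0 (\<bar>x\<bar> - m)) j"
      using B False by (simp add: min_mult_distrib_left)
    finally show ?thesis .
  qed
qed

lemma bounded_rvI:
  "X \<in> borel_measurable S \<Longrightarrow> (\<And>w. w \<in> space S \<Longrightarrow> \<bar>X w\<bar> \<le> c) \<Longrightarrow> bounded_rv S X"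
  unfolding bounded_rv_def by (auto intro!: boundedI[of _ c])

lemma bounded_rvE:
  assumes "bounded_rv S X"
  obtains c where "0 \<le> c" "X \<in> borel_measurable S" "\<And>w. w \<in> space S \<Longrightarrow> \<bar>X w\<bar> \<le> c"
proof -
  obtain c where "\<forall>x\<in>X ` space S. norm x \<le> c" using assms by (auto simp: bounded_rv_def bounded_iff)
  then show ?thesis using assms by (intro that[of "max c 0"]) (auto simp: bounded_rv_def le_max_iff_disj)
qed

lemma bounded_rv_measurable: "bounded_rv S X \<Longrightarrow> X \<in> borel_measurable S"
  by (simp add: bounded_rv_def)

lemma bounded_rv_const: "bounded_rv S (\<lambda>_. c)"
  by (rule bounded_rvI[of _ _ "\<bar>c\<bar>"]) auto

lemma bounded_rv_add:
  assumes "bounded_rv S X" "bounded_rv S Y" shows "bounded_rv S (\<lambda>w. X w + Y w)"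
proof -
  obtain c d where c: "X \<in> borel_measurable S" "Y \<in> borel_measurable S"
    "\<And>w. w \<in> space S \<Longrightarrow> \<bar>X w\<bar> \<le> c" "\<And>w. w \<in> space S \<Longrightarrow> \<bar>Y w\<bar> \<le> d"
    using assms by (auto elim!: bounded_rvE)
  have "\<bar>X w + Y w\<bar> \<le> c + d" if "w \<in> space S" for w using c(3,4)[OF that] by linarith
  with c(1,2) show ?thesis by (intro bounded_rvI[of _ _ "c + d"]) auto
qed

lemma bounded_rv_mult:
  assumes "bounded_rv S X" "bounded_rv S Y" shows "bounded_rv S (\<lambda>w. X w * Y w)"
proof -
  obtain c d where c: "0 \<le> c" "X \<in> borel_measurable S" "Y \<in> borel_measurable S"
    "\<And>w. w \<in> space S \<Longrightarrow> \<bar>X w\<bar> \<le> c" "\<And>w. w \<in> space S \<Longrightarrow> \<bar>Y w\<bar> \<le> d"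
    using assms by (auto elim!: bounded_rvE)
  have "\<bar>X w * Y w\<bar> \<le> c * d" if "w \<in> space S" for w
    using mult_mono[OF c(4)[OF that] c(5)[OF that] c(1)] by (simp add: abs_mult)
  with c(2,3) show ?thesis by (intro bounded_rvI[of _ _ "c * d"]) auto
qed

lemma bounded_rv_cmult: "bounded_rv S X \<Longrightarrow> bounded_rv S (\<lambda>w. c * X w)"
  using bounded_rv_mult[OF bounded_rv_const] .

lemma bounded_rv_diff: "bounded_rv S X \<Longrightarrow> bounded_rv S Y \<Longrightarrow> bounded_rv S (\<lambda>w. X w - Y w)"
  using bounded_rv_add[of S X "\<lambda>w. - 1 * Y w"] bounded_rv_cmult[of S Y "-1"] by simp

lemma bounded_rv_abs: "bounded_rv S X \<Longrightarrow> bounded_rv S (\<lambda>w. \<bar>X w\<bar>)"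
  by (erule bounded_rvE, rule bounded_rvI) auto

lemma bounded_rv_sum:
  "(\<And>i. i \<in> I \<Longrightarrow> bounded_rv S (X i)) \<Longrightarrow> bounded_rv S (\<lambda>w. \<Sum>i\<in>I. X i w)"
  by (induction I rule: infinite_finite_induct) (auto intro: bounded_rv_const bounded_rv_add)

lemma bounded_rv_indicator: "A \<in> sets S \<Longrightarrow> bounded_rv S (indicator A)"
  by (rule bounded_rvI[of _ _ 1]) (auto simp: indicator_def)

lemma bounded_rv_compose:
  assumes "f \<in> measurable S S'" "bounded_rv S' X" shows "bounded_rv S (\<lambda>w. X (f w))"
  using assms(2) by (rule bounded_rvE) (rule bounded_rvI, auto intro: measurable_compose[OF assms(1)] measurable_space[OF assms(1)])

lemma bounded_rv_subalgebra: "subalgebra M C \<Longrightarrow> bounded_rv C X \<Longrightarrow> bounded_rv M X"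
  by (auto simp: bounded_rv_def subalgebra_def intro: measurable_from_subalg)

lemma (in prob_space) bounded_rv_integrable: "bounded_rv M X \<Longrightarrow> integrable M X"
  by (erule bounded_rvE) (rule integrable_const_bound[where B=c for c], auto)

section \<open>Conditional expectations\<close>

text \<open>As for nonnegative functions, but only sets of a sub-sigma-field are tested.\<close>

lemma AE_le_if_set_integral_le:
  fixes f g :: "'a \<Rightarrow> real"
  assumes C: "subalgebra M C" and f[measurable]: "f \<in> borel_measurable C" and g[measurable]: "g \<in> borel_measurable C"
    and int: "integrable M f" "integrable M g"
    and le: "\<And>A. A \<in> sets C \<Longrightarrow> (\<integral>x. indicator A x * f x \<partial>M) \<le> (\<integral>x. indicator A x * g x \<partial>M)"
  shows "AE x in M. f x \<le> g x"
proof -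
  define A where "A = {x \<in> space C. g x < f x}"
  have A[measurable]: "A \<in> sets C" unfolding A_def by measurable
  have AM[measurable]: "A \<in> sets M" using A C by (auto simp: subalgebra_def)
  have i: "integrable M (\<lambda>x. indicator A x * f x)" "integrable M (\<lambda>x. indicator A x * g x)"
    using integrable_mult_indicator[OF AM int(1)] integrable_mult_indicator[OF AM int(2)] by auto
  have nn: "0 \<le> indicator A x * f x - indicator A x * g x" for x
    by (auto simp: A_def indicator_def)
  have "(\<integral>x. indicator A x * f x - indicator A x * g x \<partial>M) \<le> 0"
    using le[OF A] i by simp
  moreover have "0 \<le> (\<integral>x. indicator A x * f x - indicator A x * g x \<partial>M)"
    by (rule integral_nonneg_AE) (use nn in auto)
  ultimately have "AE x in M. indicator A x * f x - indicator A x * g x = 0"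
    using integral_nonneg_eq_0_iff_AE[OF Bochner_Integration.integrable_diff[OF i]] nn by auto
  then show ?thesis using AE_space
  proof eventually_elim
    fix x assume "indicator A x * f x - indicator A x * g x = 0" "x \<in> space M"
    then show "f x \<le> g x" using C by (cases "x \<in> A") (auto simp: A_def subalgebra_def)
  qed
qed

text \<open>The base space \<open>M\<close> with a sub-sigma-field \<open>C\<close>, and an extension \<open>N\<close>; conditional expectations of
  variables on \<open>N\<close> are functions on \<open>M\<close>. The choice \<open>N = M\<close>, \<open>\<pi> = id\<close> is a special case.\<close>

locale conditioning =
  fixes M :: "'a measure" and N :: "'b measure" and \<pi> :: "'b \<Rightarrow> 'a" and C :: "'a measure"
  assumes prob_M: "prob_space M" and ext: "prob_extension M N \<pi>" and sub_C: "subalgebra M C"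
begin

sublocale M: prob_space M by (rule prob_M)
sublocale N: prob_space N using ext by (simp add: prob_extension_def)

lemma space_C: "space C = space M" and sets_C: "sets C \<subseteq> sets M"
  using sub_C by (auto simp: subalgebra_def)

lemma pi_M[measurable]: "\<pi> \<in> measurable N M"
  using ext by (simp add: prob_extension_def)

lemma pi_C: "\<pi> \<in> measurable N C"
  using pi_M sub_C by (auto simp: measurable_def subalgebra_def)

lemma borel_C_M: "f \<in> borel_measurable C \<Longrightarrow> f \<in> borel_measurable M"
  using measurable_from_subalg[OF sub_C] .

lemma distr_pi_C: "distr N C \<pi> = restr_to_subalg M C"
proof (rule measure_eqI)
  show "sets (distr N C \<pi>) = sets (restr_to_subalg M C)"
    by (simp add: sets_restr_to_subalg[OF sub_C])
  fix A assume "A \<in> sets (distr N C \<pi>)"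
  then have A: "A \<in> sets C" "A \<in> sets M" using sets_C by auto
  have "emeasure (distr N C \<pi>) A = emeasure (distr N M \<pi>) A"
    using A pi_C by (simp add: emeasure_distr)
  also have "distr N M \<pi> = M" using ext by (simp add: prob_extension_def)
  finally show "emeasure (distr N C \<pi>) A = emeasure (restr_to_subalg M C) A"
    using A by (simp add: emeasure_restr_to_subalg[OF sub_C])
qed

lemma nn_integral_pi_C: "f \<in> borel_measurable C \<Longrightarrow> (\<integral>\<^sup>+x. f x \<partial>distr N C \<pi>) = (\<integral>\<^sup>+x. f x \<partial>M)"
  unfolding distr_pi_C by (rule nn_integral_subalgebra2[OF sub_C])

lemma integral_pi: "f \<in> borel_measurable M \<Longrightarrow> (\<integral>w. f (\<pi> w) \<partial>N) = (\<integral>x. (f x :: real) \<partial>M)"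
  using integral_distr[OF pi_M, of f] ext by (simp add: prob_extension_def)

abbreviation K where "K \<equiv> cond_distr N \<pi> C"
abbreviation E where "E \<equiv> cond_expect N \<pi> C"

lemma cond_distr_regular:
  assumes "W \<in> borel_measurable N" shows "regular_cond_distr N \<pi> C W (K W)"
  unfolding cond_distr_def
  using someI_ex[OF regular_cond_distr_exists[OF N.prob_space_axioms pi_C assms]] .

lemma cond_distr_measurable:
  assumes "W \<in> borel_measurable N" shows "K W \<in> measurable C (prob_algebra borel)"
  using cond_distr_regular[OF assms] by (simp add: regular_cond_distr_def)

lemma cond_distr_sets_prob:
  assumes "W \<in> borel_measurable N" "\<omega> \<in> space M"
  shows "sets (K W \<omega>) = sets borel" "prob_space (K W \<omega>)"
  using measurable_space[OF cond_distr_measurable[OF assms(1)], of \<omega>] assms(2) space_C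
  by (auto simp: space_prob_algebra)

text \<open>The defining identity for rectangles says that two measures on the line coincide, namely the
  distribution of \<open>W\<close> on the event \<open>\<pi> \<in> A\<close> and the mixture of the kernel over \<open>A\<close>.\<close>

lemma cond_distr_nn_integral:
  fixes g :: "real \<Rightarrow> ennreal"
  assumes W[measurable]: "W \<in> borel_measurable N" and g[measurable]: "g \<in> borel_measurable borel"
    and A[measurable]: "A \<in> sets C"
  shows "(\<integral>\<^sup>+\<omega>. indicator A \<omega> * (\<integral>\<^sup>+x. g x \<partial>K W \<omega>) \<partial>M) = (\<integral>\<^sup>+w. indicator A (\<pi> w) * g (W w) \<partial>N)"
proof -
  define Q where "Q = distr N C \<pi>"
  have sQ[measurable_cong]: "sets Q = sets C" and spQ: "space Q = space C" by (simp_all add: Q_def)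
  have K[measurable]: "K W \<in> measurable C (subprob_algebra borel)"
    using cond_distr_measurable[OF W] by (rule measurable_prob_algebraD)
  have [measurable]: "\<pi> \<in> measurable N C" by (rule pi_C)
  have Cne: "space C \<noteq> {}" using M.not_empty space_C by simp
  define M1 where "M1 = distr (density N (\<lambda>w. indicator A (\<pi> w))) borel W"
  define M2 where "M2 = bind (density Q (indicator A)) (K W)"
  have "M1 = M2"
  proof (rule measure_eqI)
    have s2: "sets M2 = sets borel"
      unfolding M2_def by (rule sets_bind) (use subprob_measurableD(2)[OF K] Cne in \<open>auto simp: spQ\<close>)
    show "sets M1 = sets M2" by (simp add: s2) (simp add: M1_def)
    fix B assume "B \<in> sets M1"
    then have B[measurable]: "B \<in> sets borel" by (simp add: M1_def)
    have "emeasure M1 B = (\<integral>\<^sup>+w. indicator A (\<pi> w) * indicator (W -` B \<inter> space N) w \<partial>N)"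
      unfolding M1_def by (simp add: emeasure_distr emeasure_density)
    also have "\<dots> = (\<integral>\<^sup>+w. indicator {w \<in> space N. \<pi> w \<in> A \<and> W w \<in> B} w \<partial>N)"
      by (intro nn_integral_cong) (auto simp: indicator_def)
    also have "\<dots> = emeasure N {w \<in> space N. \<pi> w \<in> A \<and> W w \<in> B}"
      by simp
    also have "\<dots> = (\<integral>\<^sup>+\<omega>\<in>A. emeasure (K W \<omega>) B \<partial>Q)"
      using cond_distr_regular[OF W] A B by (simp add: regular_cond_distr_def Q_def)
    also have "\<dots> = (\<integral>\<^sup>+\<omega>. emeasure (K W \<omega>) B \<partial>density Q (indicator A))"
      by (subst nn_integral_density) (auto simp: mult.commute)
    also have "\<dots> = emeasure M2 B"
      unfolding M2_def by (rule emeasure_bind[where N=borel, symmetric]) (use Cne in \<open>auto simp: spQ\<close>)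
    finally show "emeasure M1 B = emeasure M2 B" .
  qed
  have "(\<integral>\<^sup>+w. indicator A (\<pi> w) * g (W w) \<partial>N) = (\<integral>\<^sup>+x. g x \<partial>M1)"
    unfolding M1_def by (subst nn_integral_distr) (auto simp: nn_integral_density)
  also have "\<dots> = (\<integral>\<^sup>+\<omega>. (\<integral>\<^sup>+x. g x \<partial>K W \<omega>) \<partial>density Q (indicator A))"
    unfolding \<open>M1 = M2\<close> M2_def by (rule nn_integral_bind[where B=borel]) auto
  also have "\<dots> = (\<integral>\<^sup>+\<omega>. indicator A \<omega> * (\<integral>\<^sup>+x. g x \<partial>K W \<omega>) \<partial>Q)"
    by (subst nn_integral_density) auto
  also have "\<dots> = (\<integral>\<^sup>+\<omega>. indicator A \<omega> * (\<integral>\<^sup>+x. g x \<partial>K W \<omega>) \<partial>M)"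
    unfolding Q_def by (rule nn_integral_pi_C) auto
  finally show ?thesis by simp
qed

lemma cond_distr_integral_measurable:
  fixes g :: "real \<Rightarrow> real"
  assumes W: "W \<in> borel_measurable N" and g[measurable]: "g \<in> borel_measurable borel"
  shows "(\<lambda>\<omega>. \<integral>x. g x \<partial>K W \<omega>) \<in> borel_measurable C"
  using measurable_prob_algebraD[OF cond_distr_measurable[OF W]] by measurable

lemma cond_distr_integral_bounded:
  fixes g :: "real \<Rightarrow> real"
  assumes W: "W \<in> borel_measurable N" and g[measurable]: "g \<in> borel_measurable borel"
    and b: "\<And>x. \<bar>g x\<bar> \<le> c" and \<omega>: "\<omega> \<in> space M"
  shows "integrable (K W \<omega>) g" "\<bar>\<integral>x. g x \<partial>K W \<omega>\<bar> \<le> c"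
proof -
  note s = cond_distr_sets_prob[OF W \<omega>]
  interpret K: prob_space "K W \<omega>" by (rule s)
  have gK[measurable]: "g \<in> borel_measurable (K W \<omega>)" using g s(1) by (simp cong: measurable_cong_sets)
  show i: "integrable (K W \<omega>) g"
    by (rule K.integrable_const_bound[where B=c]) (use b in auto)
  have "\<bar>\<integral>x. g x \<partial>K W \<omega>\<bar> \<le> (\<integral>x. \<bar>g x\<bar> \<partial>K W \<omega>)" by (rule integral_abs_bound)
  also have "\<dots> \<le> (\<integral>x. c \<partial>K W \<omega>)" by (rule integral_mono) (use i b in auto)
  finally show "\<bar>\<integral>x. g x \<partial>K W \<omega>\<bar> \<le> c" using K.prob_space by simp
qed

text \<open>From the nonnegative case, applied to \<open>g + c \<ge> 0\<close>.\<close>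

lemma cond_distr_set_integral:
  fixes g :: "real \<Rightarrow> real"
  assumes W[measurable]: "W \<in> borel_measurable N" and g[measurable]: "g \<in> borel_measurable borel"
    and b: "\<And>x. \<bar>g x\<bar> \<le> c" and A[measurable]: "A \<in> sets C"
  shows "(\<integral>\<omega>. indicator A \<omega> * (\<integral>x. g x \<partial>K W \<omega>) \<partial>M) = (\<integral>w. indicator A (\<pi> w) * g (W w) \<partial>N)"
proof -
  define h where "h \<omega> = (\<integral>x. g x \<partial>K W \<omega>)" for \<omega>
  have c0: "0 \<le> c" using b[of 0] by linarith
  have hC[measurable]: "h \<in> borel_measurable C"
    unfolding h_def by (rule cond_distr_integral_measurable[OF W g])
  have [measurable]: "h \<in> borel_measurable M" by (rule borel_C_M[OF hC])
  have AM[measurable]: "A \<in> sets M" using A sets_C by auto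
  have hb: "\<bar>h \<omega>\<bar> \<le> c" if "\<omega> \<in> space M" for \<omega>
    unfolding h_def by (rule cond_distr_integral_bounded[OF W g b that])
  have hnn: "ennreal (h \<omega> + c) = (\<integral>\<^sup>+x. ennreal (g x + c) \<partial>K W \<omega>)" if \<omega>: "\<omega> \<in> space M" for \<omega>
  proof -
    note s = cond_distr_sets_prob[OF W \<omega>]
    interpret K: prob_space "K W \<omega>" by (rule s)
    note i = cond_distr_integral_bounded(1)[OF W g b \<omega>]
    have "(\<integral>\<^sup>+x. ennreal (g x + c) \<partial>K W \<omega>) = ennreal (\<integral>x. g x + c \<partial>K W \<omega>)"
      by (rule nn_integral_eq_integral) (use i b in \<open>auto simp: add_nonneg_nonneg abs_le_iff intro!: AE_I2\<close>, smt (verit) b)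
    also have "(\<integral>x. g x + c \<partial>K W \<omega>) = h \<omega> + c" using i K.prob_space by (simp add: h_def)
    finally show ?thesis by simp
  qed
  have gc: "0 \<le> g x + c" for x using b[of x] by linarith
  have bh: "bounded_rv M (\<lambda>\<omega>. indicator A \<omega> * h \<omega>)"
    by (intro bounded_rv_mult bounded_rv_indicator bounded_rvI[of h _ c]) (use hb in auto)
  have [measurable]: "\<pi> \<in> measurable N C" by (rule pi_C)
  have bA: "bounded_rv N (\<lambda>w. indicator A (\<pi> w))"
    by (rule bounded_rvI[of _ _ 1]) (auto simp: indicator_def)
  have bW: "bounded_rv N (\<lambda>w. indicator A (\<pi> w) * g (W w))"
    by (intro bounded_rv_mult bA bounded_rvI[of "\<lambda>w. g (W w)" _ c]) (use b in auto)
  have "(\<integral>\<omega>. indicator A \<omega> * (h \<omega> + c) \<partial>M) = enn2real (\<integral>\<^sup>+\<omega>. ennreal (indicator A \<omega> * (h \<omega> + c)) \<partial>M)"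
    by (rule integral_eq_nn_integral) (auto simp: indicator_def dest!: hb intro!: AE_I2)
  also have "(\<integral>\<^sup>+\<omega>. ennreal (indicator A \<omega> * (h \<omega> + c)) \<partial>M)
      = (\<integral>\<^sup>+\<omega>. indicator A \<omega> * (\<integral>\<^sup>+x. ennreal (g x + c) \<partial>K W \<omega>) \<partial>M)"
    by (intro nn_integral_cong) (auto simp: indicator_def hnn)
  also have "\<dots> = (\<integral>\<^sup>+w. indicator A (\<pi> w) * ennreal (g (W w) + c) \<partial>N)"
    by (rule cond_distr_nn_integral) auto
  also have "\<dots> = (\<integral>\<^sup>+w. ennreal (indicator A (\<pi> w) * (g (W w) + c)) \<partial>N)"
    by (intro nn_integral_cong) (auto simp: indicator_def)
  also have "enn2real \<dots> = (\<integral>w. indicator A (\<pi> w) * (g (W w) + c) \<partial>N)"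
    by (rule integral_eq_nn_integral[symmetric]) (use gc in \<open>auto simp: indicator_def intro!: AE_I2\<close>)
  finally have eq: "(\<integral>\<omega>. indicator A \<omega> * (h \<omega> + c) \<partial>M) = (\<integral>w. indicator A (\<pi> w) * (g (W w) + c) \<partial>N)" .
  have "(\<integral>\<omega>. indicator A \<omega> * (h \<omega> + c) \<partial>M) = (\<integral>\<omega>. indicator A \<omega> * h \<omega> \<partial>M) + (\<integral>\<omega>. c * indicator A \<omega> \<partial>M)"
    using M.bounded_rv_integrable[OF bh] M.bounded_rv_integrable[OF bounded_rv_cmult[OF bounded_rv_indicator[OF AM]], of c]
    by (subst Bochner_Integration.integral_add[symmetric]) (auto simp: algebra_simps)
  moreover have "(\<integral>w. indicator A (\<pi> w) * (g (W w) + c) \<partial>N)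
      = (\<integral>w. indicator A (\<pi> w) * g (W w) \<partial>N) + (\<integral>w. c * indicator A (\<pi> w) \<partial>N)"
    using N.bounded_rv_integrable[OF bW] N.bounded_rv_integrable[OF bounded_rv_cmult[OF bA], of c]
    by (subst Bochner_Integration.integral_add[symmetric]) (auto simp: algebra_simps)
  moreover have "(\<integral>w. c * indicator A (\<pi> w) \<partial>N) = (\<integral>\<omega>. c * indicator A \<omega> \<partial>M)"
    by (rule integral_pi) auto
  ultimately show ?thesis using eq unfolding h_def by linarith
qed

lemma cond_expect_measurable:
  "W \<in> borel_measurable N \<Longrightarrow> E W \<in> borel_measurable C"
  using cond_distr_integral_measurable[of W "\<lambda>x. x"] by (simp add: cond_expect_def[abs_def])

lemma cond_expect_measurable_M:
  "W \<in> borel_measurable N \<Longrightarrow> E W \<in> borel_measurable M"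
  by (rule borel_C_M[OF cond_expect_measurable])

text \<open>The kernel of a bounded variable is almost surely concentrated on the interval of its values.
  The identity function may therefore be replaced by a bounded one.\<close>

lemma cond_expect_trunc:
  assumes W[measurable]: "W \<in> borel_measurable N" and b: "\<And>w. w \<in> space N \<Longrightarrow> \<bar>W w\<bar> \<le> c"
  shows "AE \<omega> in M. E W \<omega> = (\<integral>x. trunc c x \<partial>K W \<omega>)"
proof -
  have [measurable]: "K W \<in> measurable C (subprob_algebra borel)"
    using cond_distr_measurable[OF W] by (rule measurable_prob_algebraD)
  have m: "(\<lambda>\<omega>. \<integral>\<^sup>+x. indicator {x. c < \<bar>x\<bar>} x \<partial>K W \<omega>) \<in> borel_measurable C"
    by measurable
  have "(\<integral>\<^sup>+\<omega>. indicator (space C) \<omega> * (\<integral>\<^sup>+x. indicator {x. c < \<bar>x\<bar>} x \<partial>K W \<omega>) \<partial>M)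
      = (\<integral>\<^sup>+w. indicator (space C) (\<pi> w) * indicator {x. c < \<bar>x\<bar>} (W w) \<partial>N)"
    by (rule cond_distr_nn_integral) auto
  also have "\<dots> = (\<integral>\<^sup>+w. 0 \<partial>N)"
    by (intro nn_integral_cong) (use b in \<open>auto simp: indicator_def not_less\<close>)
  also have "(\<integral>\<^sup>+\<omega>. indicator (space C) \<omega> * (\<integral>\<^sup>+x. indicator {x. c < \<bar>x\<bar>} x \<partial>K W \<omega>) \<partial>M)
      = (\<integral>\<^sup>+\<omega>. (\<integral>\<^sup>+x. indicator {x. c < \<bar>x\<bar>} x \<partial>K W \<omega>) \<partial>M)"
    by (intro nn_integral_cong) (auto simp: space_C)
  finally have "AE \<omega> in M. (\<integral>\<^sup>+x. indicator {x. c < \<bar>x\<bar>} x \<partial>K W \<omega>) = 0"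
    using borel_C_M[OF m] by (simp add: nn_integral_0_iff_AE)
  then show ?thesis using AE_space
  proof eventually_elim
    fix \<omega> assume 0: "(\<integral>\<^sup>+x. indicator {x. c < \<bar>x\<bar>} x \<partial>K W \<omega>) = 0" and \<omega>: "\<omega> \<in> space M"
    have [measurable_cong]: "sets (K W \<omega>) = sets borel" using cond_distr_sets_prob[OF W \<omega>] by simp
    have "AE x in K W \<omega>. indicator {x. c < \<bar>x\<bar>} x = (0::ennreal)"
      using 0 by (subst (asm) nn_integral_0_iff_AE) auto
    then have "AE x in K W \<omega>. x = trunc c x"
      by eventually_elim (auto simp: indicator_def trunc_id split: if_splits)
    then show "E W \<omega> = (\<integral>x. trunc c x \<partial>K W \<omega>)"
      unfolding cond_expect_def by (intro integral_cong_AE) auto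
  qed
qed

lemma cond_expect_abs_le:
  assumes W: "W \<in> borel_measurable N" and b: "\<And>w. w \<in> space N \<Longrightarrow> \<bar>W w\<bar> \<le> c"
  shows "AE \<omega> in M. \<bar>E W \<omega>\<bar> \<le> c"
proof -
  obtain w where "w \<in> space N" using N.not_empty by blast
  then have "0 \<le> c" using b[of w] by linarith
  then have "AE \<omega> in M. \<bar>\<integral>x. trunc c x \<partial>K W \<omega>\<bar> \<le> c"
    by (intro AE_I2 cond_distr_integral_bounded(2)[OF W] trunc_abs_le) auto
  moreover have "AE \<omega> in M. E W \<omega> = (\<integral>x. trunc c x \<partial>K W \<omega>)"
    by (rule cond_expect_trunc[OF W]) (rule b)
  ultimately show ?thesis by eventually_elim simp
qed

lemma cond_expect_integrable: "bounded_rv N W \<Longrightarrow> integrable M (E W)"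
  by (erule bounded_rvE, rule M.integrable_const_bound)
     (auto intro: cond_expect_measurable_M cond_expect_abs_le)

text \<open>For bounded variables the integral of the kernel is a conditional expectation in the sense of
  Kolmogorov; this identity determines it almost surely and gives linearity and monotonicity.\<close>

lemma cond_expect_set_integral:
  assumes "bounded_rv N W" and A[measurable]: "A \<in> sets C"
  shows "(\<integral>\<omega>. indicator A \<omega> * E W \<omega> \<partial>M) = (\<integral>w. indicator A (\<pi> w) * W w \<partial>N)"
proof -
  obtain c where c: "0 \<le> c" and W[measurable]: "W \<in> borel_measurable N"
    and b: "\<And>w. w \<in> space N \<Longrightarrow> \<bar>W w\<bar> \<le> c"
    using assms(1) by (rule bounded_rvE) blast
  have [measurable]: "A \<in> sets M" using A sets_C by auto
  have m: "E W \<in> borel_measurable M" "(\<lambda>\<omega>. \<integral>x. trunc c x \<partial>K W \<omega>) \<in> borel_measurable M"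
    using cond_expect_measurable_M[OF W] borel_C_M[OF cond_distr_integral_measurable[OF W borel_measurable_trunc]] by auto
  have "(\<integral>\<omega>. indicator A \<omega> * E W \<omega> \<partial>M) = (\<integral>\<omega>. indicator A \<omega> * (\<integral>x. trunc c x \<partial>K W \<omega>) \<partial>M)"
    by (rule integral_cong_AE) (use m cond_expect_trunc[OF W b] in auto)
  also have "\<dots> = (\<integral>w. indicator A (\<pi> w) * trunc c (W w) \<partial>N)"
    by (rule cond_distr_set_integral[where c=c]) (use c trunc_abs_le in auto)
  also have "\<dots> = (\<integral>w. indicator A (\<pi> w) * W w \<partial>N)"
    by (rule Bochner_Integration.integral_cong) (use b trunc_id in auto)
  finally show ?thesis .
qed

lemma cond_expect_total: "bounded_rv N W \<Longrightarrow> (\<integral>\<omega>. E W \<omega> \<partial>M) = (\<integral>w. W w \<partial>N)"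
proof -
  assume W: "bounded_rv N W"
  have "(\<integral>\<omega>. E W \<omega> \<partial>M) = (\<integral>\<omega>. indicator (space C) \<omega> * E W \<omega> \<partial>M)"
    by (rule Bochner_Integration.integral_cong) (auto simp: space_C)
  also have "\<dots> = (\<integral>w. indicator (space C) (\<pi> w) * W w \<partial>N)"
    by (rule cond_expect_set_integral[OF W]) auto
  also have "\<dots> = (\<integral>w. W w \<partial>N)"
    by (rule Bochner_Integration.integral_cong) (use measurable_space[OF pi_C] in auto)
  finally show ?thesis .
qed

lemma bounded_rv_indicator_pi: "A \<in> sets C \<Longrightarrow> bounded_rv N (\<lambda>w. indicator A (\<pi> w))"
  using bounded_rv_compose[OF pi_C bounded_rv_indicator] .

lemma cond_expect_mono:
  assumes W: "bounded_rv N W" "bounded_rv N W'" and le: "AE w in N. W w \<le> W' w"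
  shows "AE \<omega> in M. E W \<omega> \<le> E W' \<omega>"
proof (rule AE_le_if_set_integral_le[OF sub_C])
  fix A assume A: "A \<in> sets C"
  have "(\<integral>w. indicator A (\<pi> w) * W w \<partial>N) \<le> (\<integral>w. indicator A (\<pi> w) * W' w \<partial>N)"
  proof (rule integral_mono_AE)
    show "AE w in N. indicator A (\<pi> w) * W w \<le> indicator A (\<pi> w) * W' w"
      using le by eventually_elim (auto simp: indicator_def)
  qed (intro N.bounded_rv_integrable bounded_rv_mult bounded_rv_indicator_pi[OF A] W)+
  then show "(\<integral>x. indicator A x * E W x \<partial>M) \<le> (\<integral>x. indicator A x * E W' x \<partial>M)"
    by (simp add: cond_expect_set_integral[OF W(1) A] cond_expect_set_integral[OF W(2) A])
qed (use W in \<open>auto intro: cond_expect_measurable bounded_rv_measurable cond_expect_integrable\<close>)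

lemma cond_expect_unique:
  assumes W: "bounded_rv N W" and f: "f \<in> borel_measurable C" "integrable M f"
    and eq: "\<And>A. A \<in> sets C \<Longrightarrow> (\<integral>\<omega>. indicator A \<omega> * f \<omega> \<partial>M) = (\<integral>w. indicator A (\<pi> w) * W w \<partial>N)"
  shows "AE \<omega> in M. E W \<omega> = f \<omega>"
proof -
  have "AE \<omega> in M. E W \<omega> \<le> f \<omega>"
    by (rule AE_le_if_set_integral_le[OF sub_C])
       (use W f eq in \<open>auto intro: cond_expect_measurable bounded_rv_measurable cond_expect_integrable simp: cond_expect_set_integral\<close>)
  moreover have "AE \<omega> in M. f \<omega> \<le> E W \<omega>"
    by (rule AE_le_if_set_integral_le[OF sub_C])
       (use W f eq in \<open>auto intro: cond_expect_measurable bounded_rv_measurable cond_expect_integrable simp: cond_expect_set_integral\<close>)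
  ultimately show ?thesis by eventually_elim auto
qed

lemma cond_expect_lin:
  assumes W: "bounded_rv N W" "bounded_rv N W'"
  shows "AE \<omega> in M. E (\<lambda>w. a * W w + b * W' w) \<omega> = a * E W \<omega> + b * E W' \<omega>"
proof (rule cond_expect_unique)
  fix A assume A: "A \<in> sets C"
  then have AM: "A \<in> sets M" using sets_C by auto
  note i = N.bounded_rv_integrable[OF bounded_rv_mult[OF bounded_rv_indicator_pi[OF A] W(1)]]
    N.bounded_rv_integrable[OF bounded_rv_mult[OF bounded_rv_indicator_pi[OF A] W(2)]]
  have i2: "integrable M (\<lambda>\<omega>. indicator A \<omega> * E W \<omega>)" "integrable M (\<lambda>\<omega>. indicator A \<omega> * E W' \<omega>)"
    using integrable_mult_indicator[OF AM cond_expect_integrable[OF W(1)]]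
      integrable_mult_indicator[OF AM cond_expect_integrable[OF W(2)]] by auto
  have "(\<integral>\<omega>. indicator A \<omega> * (a * E W \<omega> + b * E W' \<omega>) \<partial>M)
      = (\<integral>\<omega>. a * (indicator A \<omega> * E W \<omega>) + b * (indicator A \<omega> * E W' \<omega>) \<partial>M)"
    by (simp add: algebra_simps)
  also have "\<dots> = a * (\<integral>\<omega>. indicator A \<omega> * E W \<omega> \<partial>M) + b * (\<integral>\<omega>. indicator A \<omega> * E W' \<omega> \<partial>M)"
    using i2 by simp
  also have "\<dots> = (\<integral>w. a * (indicator A (\<pi> w) * W w) + b * (indicator A (\<pi> w) * W' w) \<partial>N)"
    using i by (simp add: cond_expect_set_integral[OF W(1) A] cond_expect_set_integral[OF W(2) A])
  also have "\<dots> = (\<integral>w. indicator A (\<pi> w) * (a * W w + b * W' w) \<partial>N)"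
    by (simp add: algebra_simps)
  finally show "(\<integral>\<omega>. indicator A \<omega> * (a * E W \<omega> + b * E W' \<omega>) \<partial>M)
      = (\<integral>w. indicator A (\<pi> w) * (a * W w + b * W' w) \<partial>N)" .
qed (use W in \<open>auto intro!: bounded_rv_add bounded_rv_cmult borel_measurable_add borel_measurable_times
       cond_expect_measurable cond_expect_integrable intro: bounded_rv_measurable\<close>)

lemma cond_expect_base:
  assumes "bounded_rv C \<xi>"
  shows "AE \<omega> in M. E (\<lambda>w. \<xi> (\<pi> w)) \<omega> = \<xi> \<omega>"
proof (rule cond_expect_unique)
  note xM = bounded_rv_subalgebra[OF sub_C assms]
  show "bounded_rv N (\<lambda>w. \<xi> (\<pi> w))" by (rule bounded_rv_compose[OF pi_C assms])
  show "\<xi> \<in> borel_measurable C" by (rule bounded_rv_measurable[OF assms])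
  show "integrable M \<xi>" by (rule M.bounded_rv_integrable[OF xM])
  fix A assume "A \<in> sets C"
  then have "A \<in> sets M" using sets_C by auto
  then show "(\<integral>\<omega>. indicator A \<omega> * \<xi> \<omega> \<partial>M) = (\<integral>w. indicator A (\<pi> w) * \<xi> (\<pi> w) \<partial>N)"
    using bounded_rv_measurable[OF xM] by (intro integral_pi[symmetric]) auto
qed

text \<open>The contraction property: unconditional \<open>L1\<close> estimates control conditional expectations in mean.\<close>

lemma cond_expect_L1:
  assumes W: "bounded_rv N W" "bounded_rv N W'"
  shows "(\<integral>\<omega>. \<bar>E W \<omega> - E W' \<omega>\<bar> \<partial>M) \<le> (\<integral>w. \<bar>W w - W' w\<bar> \<partial>N)"
proof -
  note d = bounded_rv_diff[OF W] and ad = bounded_rv_abs[OF bounded_rv_diff[OF W]]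
  have "AE \<omega> in M. E (\<lambda>w. 1 * W w + (-1) * W' w) \<omega> = 1 * E W \<omega> + (-1) * E W' \<omega>"
    by (rule cond_expect_lin[OF W])
  moreover have "AE \<omega> in M. E (\<lambda>w. W w - W' w) \<omega> \<le> E (\<lambda>w. \<bar>W w - W' w\<bar>) \<omega>"
    by (rule cond_expect_mono[OF d ad]) auto
  moreover have "AE \<omega> in M. E (\<lambda>w. -1 * (W w - W' w) + 0 * 0) \<omega> \<le> E (\<lambda>w. \<bar>W w - W' w\<bar>) \<omega>"
    using bounded_rv_cmult[OF d, of "-1"] by (intro cond_expect_mono[OF _ ad]) auto
  moreover have "AE \<omega> in M. E (\<lambda>w. -1 * (W w - W' w) + 0 * 0) \<omega> = -1 * E (\<lambda>w. W w - W' w) \<omega> + 0 * E (\<lambda>w. 0) \<omega>"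
    by (rule cond_expect_lin[OF d bounded_rv_const])
  ultimately have "AE \<omega> in M. \<bar>E W \<omega> - E W' \<omega>\<bar> \<le> E (\<lambda>w. \<bar>W w - W' w\<bar>) \<omega>"
    by eventually_elim auto
  then have "(\<integral>\<omega>. \<bar>E W \<omega> - E W' \<omega>\<bar> \<partial>M) \<le> (\<integral>\<omega>. E (\<lambda>w. \<bar>W w - W' w\<bar>) \<omega> \<partial>M)"
    by (intro integral_mono_AE) (use W ad in \<open>auto intro!: cond_expect_integrable integrable_abs\<close>)
  also have "\<dots> = (\<integral>w. \<bar>W w - W' w\<bar> \<partial>N)" by (rule cond_expect_total[OF ad])
  finally show ?thesis .
qed

lemma cond_expect_function:
  fixes g :: "real \<Rightarrow> real"
  assumes W[measurable]: "W \<in> borel_measurable N" and g[measurable]: "g \<in> borel_measurable borel"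
    and b: "\<And>x. \<bar>g x\<bar> \<le> c"
  shows "AE \<omega> in M. E (\<lambda>w. g (W w)) \<omega> = (\<integral>x. g x \<partial>K W \<omega>)"
proof (rule cond_expect_unique)
  show "bounded_rv N (\<lambda>w. g (W w))" by (rule bounded_rvI[of _ _ c]) (use b in auto)
  show m: "(\<lambda>\<omega>. \<integral>x. g x \<partial>K W \<omega>) \<in> borel_measurable C"
    by (rule cond_distr_integral_measurable[OF W g])
  show "integrable M (\<lambda>\<omega>. \<integral>x. g x \<partial>K W \<omega>)"
    by (rule M.bounded_rv_integrable, rule bounded_rvI[of _ _ c])
       (use borel_C_M[OF m] cond_distr_integral_bounded(2)[OF W g b] in auto)
qed (rule cond_distr_set_integral[OF W g b])

text \<open>The variable \<open>W\<close> need not be integrable: the conditional means of the truncations of \<open>\<bar>W\<bar>\<close>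
  decide, for almost every \<open>\<omega>\<close> separately, whether the conditional mean of \<open>W\<close> exists. This is
  monotone, and then dominated, convergence under the kernel at \<open>\<omega>\<close>.\<close>

lemma cond_expect_truncation:
  assumes W[measurable]: "W \<in> borel_measurable N"
  shows "AE \<omega> in M. \<forall>c. (\<forall>j. E (\<lambda>w. min \<bar>W w\<bar> (real j)) \<omega> \<le> c) \<longrightarrow>
    cond_integrable N \<pi> C W \<omega> \<and> (\<lambda>j. E (\<lambda>w. trunc (real j) (W w)) \<omega>) \<longlonglongrightarrow> E W \<omega>"
proof -
  have "AE \<omega> in M. \<forall>j. E (\<lambda>w. min \<bar>W w\<bar> (real j)) \<omega> = (\<integral>x. min \<bar>x\<bar> (real j) \<partial>K W \<omega>)"
  proof (subst AE_all_countable, intro allI)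
    fix j :: nat
    show "AE \<omega> in M. E (\<lambda>w. min \<bar>W w\<bar> (real j)) \<omega> = (\<integral>x. min \<bar>x\<bar> (real j) \<partial>K W \<omega>)"
      by (rule cond_expect_function[OF W, where c="real j"]) auto
  qed
  moreover have "AE \<omega> in M. \<forall>j. E (\<lambda>w. trunc (real j) (W w)) \<omega> = (\<integral>x. trunc (real j) x \<partial>K W \<omega>)"
    by (subst AE_all_countable, intro allI)
       (rule cond_expect_function[OF W _ trunc_abs_le], auto)
  ultimately show ?thesis using AE_space
  proof eventually_elim
    fix \<omega> assume a: "\<forall>j. E (\<lambda>w. min \<bar>W w\<bar> (real j)) \<omega> = (\<integral>x. min \<bar>x\<bar> (real j) \<partial>K W \<omega>)"
      and b: "\<forall>j. E (\<lambda>w. trunc (real j) (W w)) \<omega> = (\<integral>x. trunc (real j) x \<partial>K W \<omega>)"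
      and \<omega>: "\<omega> \<in> space M"
    note s = cond_distr_sets_prob[OF W \<omega>]
    have [measurable_cong]: "sets (K W \<omega>) = sets borel" by (rule s)
    show "\<forall>c. (\<forall>j. E (\<lambda>w. min \<bar>W w\<bar> (real j)) \<omega> \<le> c) \<longrightarrow>
      cond_integrable N \<pi> C W \<omega> \<and> (\<lambda>j. E (\<lambda>w. trunc (real j) (W w)) \<omega>) \<longlonglongrightarrow> E W \<omega>"
    proof (intro allI impI)
      fix c assume c: "\<forall>j. E (\<lambda>w. min \<bar>W w\<bar> (real j)) \<omega> \<le> c"
      have i: "integrable (K W \<omega>) (\<lambda>x. min \<bar>x\<bar> (real j))" for j
        by (rule cond_distr_integral_bounded(1)[OF W _ _ \<omega>, where c="real j"]) auto
      have lim: "(\<lambda>j. min \<bar>x\<bar> (real j)) \<longlonglongrightarrow> \<bar>x\<bar>" for x :: real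
      proof (rule tendsto_eventually)
        obtain n :: nat where "\<bar>x\<bar> \<le> real n" using real_arch_simple by blast
        then have "\<forall>j\<ge>n. min \<bar>x\<bar> (real j) = \<bar>x\<bar>" by auto
        then show "\<forall>\<^sub>F j in sequentially. min \<bar>x\<bar> (real j) = \<bar>x\<bar>" by (auto simp: eventually_sequentially)
      qed
      have "incseq (\<lambda>j. \<integral>x. min \<bar>x\<bar> (real j) \<partial>K W \<omega>)"
        by (intro incseq_SucI integral_mono i) auto
      then obtain l where "(\<lambda>j. \<integral>x. min \<bar>x\<bar> (real j) \<partial>K W \<omega>) \<longlonglongrightarrow> l"
        using incseq_convergent[of "\<lambda>j. \<integral>x. min \<bar>x\<bar> (real j) \<partial>K W \<omega>" c] a c by metis
      then have int: "integrable (K W \<omega>) (\<lambda>x. \<bar>x\<bar>)"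
        by (intro integrable_monotone_convergence[OF i]) (auto simp: incseq_def lim)
      have int': "integrable (K W \<omega>) (\<lambda>x. x)"
        using int by (subst (asm) integrable_abs_iff) auto
      have "(\<lambda>j. \<integral>x. trunc (real j) x \<partial>K W \<omega>) \<longlonglongrightarrow> (\<integral>x. x \<partial>K W \<omega>)"
        by (rule integral_dominated_convergence[where w="\<lambda>x. \<bar>x\<bar>"])
           (use int trunc_tendsto trunc_abs_le_arg in auto)
      then show "cond_integrable N \<pi> C W \<omega> \<and> (\<lambda>j. E (\<lambda>w. trunc (real j) (W w)) \<omega>) \<longlonglongrightarrow> E W \<omega>"
        using int' b by (simp add: cond_integrable_def cond_expect_def)
    qed
  qed
qed

end

section \<open>Convergence in probability\<close>

context prob_space begin

lemma bounded_rv_min1: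
  "X \<in> borel_measurable M \<Longrightarrow> bounded_rv M (\<lambda>\<omega>. min 1 \<bar>X \<omega>\<bar>)"
  by (rule bounded_rvI[of _ _ 1]) auto

lemma integral_min1_triangle:
  fixes X Y Z :: "'a \<Rightarrow> real"
  assumes "X \<in> borel_measurable M" "Y \<in> borel_measurable M" "Z \<in> borel_measurable M"
  shows "(\<integral>\<omega>. min 1 \<bar>X \<omega> - Z \<omega>\<bar> \<partial>M) \<le> (\<integral>\<omega>. min 1 \<bar>X \<omega> - Y \<omega>\<bar> \<partial>M) + (\<integral>\<omega>. min 1 \<bar>Y \<omega> - Z \<omega>\<bar> \<partial>M)"
proof -
  have i: "integrable M (\<lambda>\<omega>. min 1 \<bar>X \<omega> - Y \<omega>\<bar>)" "integrable M (\<lambda>\<omega>. min 1 \<bar>Y \<omega> - Z \<omega>\<bar>)" "integrable M (\<lambda>\<omega>. min 1 \<bar>X \<omega> - Z \<omega>\<bar>)"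
    by (intro bounded_rv_integrable bounded_rv_min1 borel_measurable_diff assms)+
  have "(\<integral>\<omega>. min 1 \<bar>X \<omega> - Z \<omega>\<bar> \<partial>M) \<le> (\<integral>\<omega>. min 1 \<bar>X \<omega> - Y \<omega>\<bar> + min 1 \<bar>Y \<omega> - Z \<omega>\<bar> \<partial>M)"
    by (rule integral_mono) (use i in auto)
  then show ?thesis using i by simp
qed

lemma integral_min1_le_integral_abs:
  fixes X :: "'a \<Rightarrow> real"
  assumes "integrable M X"
  shows "(\<integral>\<omega>. min 1 \<bar>X \<omega>\<bar> \<partial>M) \<le> (\<integral>\<omega>. \<bar>X \<omega>\<bar> \<partial>M)"
  by (rule integral_mono) (use assms in \<open>auto intro!: bounded_rv_integrable bounded_rv_min1\<close>)

lemma integral_mult_diff_le: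
  assumes "bounded_rv M X" "bounded_rv M X'" "bounded_rv M Y" and B: "\<And>w. w \<in> space M \<Longrightarrow> \<bar>Y w\<bar> \<le> B"
  shows "(\<integral>w. \<bar>X w * Y w - X' w * Y w\<bar> \<partial>M) \<le> B * (\<integral>w. \<bar>X w - X' w\<bar> \<partial>M)"
proof -
  have "(\<integral>w. \<bar>X w * Y w - X' w * Y w\<bar> \<partial>M) \<le> (\<integral>w. B * \<bar>X w - X' w\<bar> \<partial>M)"
  proof (rule integral_mono)
    show "\<bar>X w * Y w - X' w * Y w\<bar> \<le> B * \<bar>X w - X' w\<bar>" if "w \<in> space M" for w
    proof -
      have "\<bar>X w * Y w - X' w * Y w\<bar> = \<bar>Y w\<bar> * \<bar>X w - X' w\<bar>"
        by (simp add: abs_mult[symmetric] algebra_simps)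
      also have "\<dots> \<le> B * \<bar>X w - X' w\<bar>" by (intro mult_right_mono B that) auto
      finally show ?thesis .
    qed
  qed (intro bounded_rv_integrable bounded_rv_abs bounded_rv_diff bounded_rv_mult bounded_rv_cmult assms)+
  then show ?thesis by simp
qed

text \<open>The integral of \<open>min 1 \<bar>X - Y\<bar>\<close> is a pseudometric for convergence in probability. Its triangle
  inequality replaces splittings of events in all later arguments.\<close>

lemma tendsto_in_prob_iff_integral:
  fixes X :: "'i \<Rightarrow> 'a \<Rightarrow> real"
  assumes X[measurable]: "\<And>i. X i \<in> borel_measurable M" and Y[measurable]: "Y \<in> borel_measurable M"
  shows "tendsto_in_prob M X Y F \<longleftrightarrow> ((\<lambda>i. \<integral>\<omega>. min 1 \<bar>X i \<omega> - Y \<omega>\<bar> \<partial>M) \<longlongrightarrow> 0) F"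
proof
  assume a: "tendsto_in_prob M X Y F"
  show "((\<lambda>i. \<integral>\<omega>. min 1 \<bar>X i \<omega> - Y \<omega>\<bar> \<partial>M) \<longlongrightarrow> 0) F"
  proof (rule tendstoI)
    fix e :: real assume e: "0 < e"
    have "((\<lambda>i. measure M {\<omega> \<in> space M. e / 2 < \<bar>X i \<omega> - Y \<omega>\<bar>}) \<longlongrightarrow> 0) F"
      using a half_gt_zero[OF e] unfolding tendsto_in_prob_def by blast
    then have "\<forall>\<^sub>F i in F. measure M {\<omega> \<in> space M. e / 2 < \<bar>X i \<omega> - Y \<omega>\<bar>} < e / 2"
      using e by (intro order_tendstoD(2)) auto
    then show "\<forall>\<^sub>F i in F. dist (\<integral>\<omega>. min 1 \<bar>X i \<omega> - Y \<omega>\<bar> \<partial>M) 0 < e"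
    proof eventually_elim
      fix i assume i: "measure M {\<omega> \<in> space M. e / 2 < \<bar>X i \<omega> - Y \<omega>\<bar>} < e / 2"
      define A where "A = {\<omega> \<in> space M. e / 2 < \<bar>X i \<omega> - Y \<omega>\<bar>}"
      have A[measurable]: "A \<in> sets M" unfolding A_def by measurable
      have "(\<integral>\<omega>. min 1 \<bar>X i \<omega> - Y \<omega>\<bar> \<partial>M) \<le> (\<integral>\<omega>. e / 2 + indicator A \<omega> \<partial>M)"
      proof (rule integral_mono)
        show "integrable M (\<lambda>\<omega>. min 1 \<bar>X i \<omega> - Y \<omega>\<bar>)"
          by (intro bounded_rv_integrable bounded_rv_min1) auto
        show "integrable M (\<lambda>\<omega>. e / 2 + indicator A \<omega>)"
          by (intro bounded_rv_integrable bounded_rv_add bounded_rv_const bounded_rv_indicator A)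
        show "min 1 \<bar>X i \<omega> - Y \<omega>\<bar> \<le> e / 2 + indicator A \<omega>" if "\<omega> \<in> space M" for \<omega>
          using e that by (auto simp: A_def indicator_def min_def)
      qed
      also have "(\<integral>\<omega>. e / 2 + indicator A \<omega> \<partial>M) = e / 2 + measure M A"
        by (subst Bochner_Integration.integral_add)
           (auto simp: prob_space intro!: bounded_rv_integrable bounded_rv_indicator)
      also have "\<dots> < e" using i by (simp add: A_def)
      finally show "dist (\<integral>\<omega>. min 1 \<bar>X i \<omega> - Y \<omega>\<bar> \<partial>M) 0 < e"
        by (simp add: abs_of_nonneg)
    qed
  qed
next
  assume a: "((\<lambda>i. \<integral>\<omega>. min 1 \<bar>X i \<omega> - Y \<omega>\<bar> \<partial>M) \<longlongrightarrow> 0) F"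
  show "tendsto_in_prob M X Y F"
    unfolding tendsto_in_prob_def
  proof (intro allI impI)
    fix \<eta> :: real assume \<eta>: "0 < \<eta>"
    have le: "measure M {\<omega> \<in> space M. \<eta> < \<bar>X i \<omega> - Y \<omega>\<bar>} \<le> (\<integral>\<omega>. min 1 \<bar>X i \<omega> - Y \<omega>\<bar> \<partial>M) / min 1 \<eta>" for i
    proof -
      define A where "A = {\<omega> \<in> space M. \<eta> < \<bar>X i \<omega> - Y \<omega>\<bar>}"
      have A[measurable]: "A \<in> sets M" unfolding A_def by measurable
      have "min 1 \<eta> * measure M A = (\<integral>\<omega>. min 1 \<eta> * indicator A \<omega> \<partial>M)" by simp
      also have "\<dots> \<le> (\<integral>\<omega>. min 1 \<bar>X i \<omega> - Y \<omega>\<bar> \<partial>M)"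
      proof (rule integral_mono)
        show "integrable M (\<lambda>\<omega>. min 1 \<bar>X i \<omega> - Y \<omega>\<bar>)"
          by (intro bounded_rv_integrable bounded_rv_min1) auto
        show "integrable M (\<lambda>\<omega>. min 1 \<eta> * indicator A \<omega>)"
          by (intro bounded_rv_integrable bounded_rv_cmult bounded_rv_indicator A)
      qed (auto simp: A_def indicator_def)
      finally show ?thesis using \<eta> by (simp add: A_def field_simps)
    qed
    have "((\<lambda>i. (\<integral>\<omega>. min 1 \<bar>X i \<omega> - Y \<omega>\<bar> \<partial>M) / min 1 \<eta>) \<longlongrightarrow> 0 / min 1 \<eta>) F"
      by (intro tendsto_divide a tendsto_const) (use \<eta> in auto)
    then have lim: "((\<lambda>i. (\<integral>\<omega>. min 1 \<bar>X i \<omega> - Y \<omega>\<bar> \<partial>M) / min 1 \<eta>) \<longlongrightarrow> 0) F" by simp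
    show "((\<lambda>i. measure M {\<omega> \<in> space M. \<eta> < \<bar>X i \<omega> - Y \<omega>\<bar>}) \<longlongrightarrow> 0) F"
      by (rule Lim_null_comparison[OF _ lim]) (use le in \<open>simp add: always_eventually\<close>)
  qed
qed

lemma tendsto_in_prob_AE_subseq:
  fixes X :: "nat \<Rightarrow> 'a \<Rightarrow> real"
  assumes X[measurable]: "\<And>i. X i \<in> borel_measurable M" and Y[measurable]: "Y \<in> borel_measurable M"
    and lim: "tendsto_in_prob M X Y sequentially"
  obtains r :: "nat \<Rightarrow> nat" where "strict_mono r" "AE \<omega> in M. (\<lambda>k. X (r k) \<omega>) \<longlonglongrightarrow> Y \<omega>"
proof -
  have "\<exists>r::nat\<Rightarrow>nat. strict_mono r \<and> (AE \<omega> in M. (\<lambda>k. min 1 \<bar>X (r k) \<omega> - Y \<omega>\<bar>) \<longlonglongrightarrow> 0)"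
  proof (rule tendsto_L1_AE_subseq)
    show "integrable M (\<lambda>\<omega>. min 1 \<bar>X n \<omega> - Y \<omega>\<bar>)" for n
      by (intro bounded_rv_integrable bounded_rv_min1) auto
    show "(\<lambda>n. \<integral>\<omega>. norm (min 1 \<bar>X n \<omega> - Y \<omega>\<bar>) \<partial>M) \<longlonglongrightarrow> 0"
      using lim by (simp add: tendsto_in_prob_iff_integral)
  qed
  then obtain r :: "nat \<Rightarrow> nat" where r: "strict_mono r" and
    ae: "AE \<omega> in M. (\<lambda>k. min 1 \<bar>X (r k) \<omega> - Y \<omega>\<bar>) \<longlonglongrightarrow> 0" by blast
  from ae have "AE \<omega> in M. (\<lambda>k. X (r k) \<omega>) \<longlonglongrightarrow> Y \<omega>"
  proof eventually_elim
    fix \<omega> assume a: "(\<lambda>k. min 1 \<bar>X (r k) \<omega> - Y \<omega>\<bar>) \<longlonglongrightarrow> 0"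
    have "\<forall>\<^sub>F k in sequentially. min 1 \<bar>X (r k) \<omega> - Y \<omega>\<bar> < 1"
      by (rule order_tendstoD(2)[OF a]) simp
    then have "\<forall>\<^sub>F k in sequentially. min 1 \<bar>X (r k) \<omega> - Y \<omega>\<bar> = \<bar>X (r k) \<omega> - Y \<omega>\<bar>"
      by eventually_elim auto
    with a have "(\<lambda>k. \<bar>X (r k) \<omega> - Y \<omega>\<bar>) \<longlonglongrightarrow> 0" by (rule Lim_transform_eventually)
    then have "(\<lambda>k. X (r k) \<omega> - Y \<omega>) \<longlonglongrightarrow> 0" by (rule tendsto_rabs_zero_cancel)
    then show "(\<lambda>k. X (r k) \<omega>) \<longlonglongrightarrow> Y \<omega>" by (simp add: LIM_zero_iff)
  qed
  with r show ?thesis by (rule that)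
qed

end

lemma tendsto_in_prob_compose:
  "tendsto_in_prob M X Y F \<Longrightarrow> filterlim g F F' \<Longrightarrow> tendsto_in_prob M (\<lambda>i. X (g i)) Y F'"
  unfolding tendsto_in_prob_def by (auto intro: filterlim_compose)

section \<open>Convergence of conditional expectations\<close>

locale stable_conditioning = conditioning M N \<pi> C
  for M :: "'a measure" and N :: "'b measure" and \<pi> and C +
  fixes G :: "'a measure"
  assumes sub_G: "subalgebra M G"
begin

sublocale base: conditioning M M id C
  by unfold_locales (auto intro: prob_M sub_C simp: prob_extension_def id_def)

abbreviation EM where "EM \<equiv> cond_expect M id C"

definition cond_conv :: "(nat \<Rightarrow> 'a \<Rightarrow> real) \<Rightarrow> ('b \<Rightarrow> real) \<Rightarrow> bool" where
  "cond_conv x x' \<longleftrightarrow> (\<forall>Y. bounded_rv G Y \<longrightarrow>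
     tendsto_in_prob M (\<lambda>n. EM (\<lambda>\<omega>. x n \<omega> * Y \<omega>)) (E (\<lambda>w. x' w * Y (\<pi> w))) sequentially)"

lemma bounded_rv_G: "bounded_rv G Y \<Longrightarrow> bounded_rv M Y"
  by (rule bounded_rv_subalgebra[OF sub_G])

lemma bounded_rv_pi: "bounded_rv G Y \<Longrightarrow> bounded_rv N (\<lambda>w. Y (\<pi> w))"
  by (rule bounded_rv_compose[OF pi_M bounded_rv_G])

text \<open>An approximation principle: the errors of \<open>x\<close> and \<open>x'\<close> are measured in mean and without
  conditioning, and enter the distance of the conditional expectations multiplied by the bound of
  \<open>Y\<close>. The order of the limits is first \<open>n \<rightarrow> \<infinity>\<close>, then \<open>k \<rightarrow> \<infinity>\<close>.\<close>

lemma cond_conv_approx: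
  assumes x: "\<And>n. bounded_rv M (x n)" and x': "bounded_rv N x'"
    and xk: "\<And>k n. bounded_rv M (xk k n)" and xk': "\<And>k. bounded_rv N (xk' k)"
    and conv: "\<And>k. cond_conv (xk k) (xk' k)"
    and ev: "\<And>k. \<forall>\<^sub>F n in sequentially. (\<integral>\<omega>. \<bar>x n \<omega> - xk k n \<omega>\<bar> \<partial>M) \<le> e k"
    and e: "e \<longlonglongrightarrow> 0" and lim: "(\<lambda>k. \<integral>w. \<bar>x' w - xk' k w\<bar> \<partial>N) \<longlonglongrightarrow> 0"
  shows "cond_conv x x'"
  unfolding cond_conv_def
proof (intro allI impI)
  fix Y assume Y: "bounded_rv G Y"
  note YM = bounded_rv_G[OF Y] and YN = bounded_rv_pi[OF Y]
  obtain B where B: "0 \<le> B" "\<And>\<omega>. \<omega> \<in> space M \<Longrightarrow> \<bar>Y \<omega>\<bar> \<le> B"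
    using YM by (rule bounded_rvE) blast
  have BN: "\<bar>Y (\<pi> w)\<bar> \<le> B" if "w \<in> space N" for w
    using B(2) measurable_space[OF pi_M that] by blast
  define d where "d k = (\<integral>w. \<bar>x' w - xk' k w\<bar> \<partial>N)" for k
  define X where "X n = EM (\<lambda>\<omega>. x n \<omega> * Y \<omega>)" for n
  define X' where "X' = E (\<lambda>w. x' w * Y (\<pi> w))"
  define XK where "XK k n = EM (\<lambda>\<omega>. xk k n \<omega> * Y \<omega>)" for k n
  define XK' where "XK' k = E (\<lambda>w. xk' k w * Y (\<pi> w))" for k
  have bM: "bounded_rv M (\<lambda>\<omega>. x n \<omega> * Y \<omega>)" "bounded_rv M (\<lambda>\<omega>. xk k n \<omega> * Y \<omega>)" for k n
    by (intro bounded_rv_mult x xk YM)+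
  have bN: "bounded_rv N (\<lambda>w. x' w * Y (\<pi> w))" "bounded_rv N (\<lambda>w. xk' k w * Y (\<pi> w))" for k
    by (intro bounded_rv_mult x' xk' YN)+
  have m: "X n \<in> borel_measurable M" "XK k n \<in> borel_measurable M" "X' \<in> borel_measurable M" "XK' k \<in> borel_measurable M" for n k
    unfolding X_def XK_def X'_def XK'_def
    by (rule base.cond_expect_measurable_M cond_expect_measurable_M, rule bounded_rv_measurable, rule bM bN)+
  have i: "integrable M (X n)" "integrable M (XK k n)" "integrable M X'" "integrable M (XK' k)" for n k
    unfolding X_def XK_def X'_def XK'_def
    by (intro base.cond_expect_integrable cond_expect_integrable bM bN)+
  have 1: "(\<integral>\<omega>. min 1 \<bar>X n \<omega> - XK k n \<omega>\<bar> \<partial>M) \<le> B * (\<integral>\<omega>. \<bar>x n \<omega> - xk k n \<omega>\<bar> \<partial>M)" for n k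
  proof -
    have "(\<integral>\<omega>. min 1 \<bar>X n \<omega> - XK k n \<omega>\<bar> \<partial>M) \<le> (\<integral>\<omega>. \<bar>X n \<omega> - XK k n \<omega>\<bar> \<partial>M)"
      by (intro M.integral_min1_le_integral_abs Bochner_Integration.integrable_diff i)
    also have "\<dots> \<le> (\<integral>\<omega>. \<bar>x n \<omega> * Y \<omega> - xk k n \<omega> * Y \<omega>\<bar> \<partial>M)"
      unfolding X_def XK_def by (rule base.cond_expect_L1[OF bM])
    also have "\<dots> \<le> B * (\<integral>\<omega>. \<bar>x n \<omega> - xk k n \<omega>\<bar> \<partial>M)"
      by (rule M.integral_mult_diff_le[OF x xk YM B(2)])
    finally show ?thesis .
  qed
  have 2: "(\<integral>\<omega>. min 1 \<bar>XK' k \<omega> - X' \<omega>\<bar> \<partial>M) \<le> B * d k" for k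
  proof -
    have "(\<integral>\<omega>. min 1 \<bar>XK' k \<omega> - X' \<omega>\<bar> \<partial>M) \<le> (\<integral>\<omega>. \<bar>X' \<omega> - XK' k \<omega>\<bar> \<partial>M)"
      using M.integral_min1_le_integral_abs[OF Bochner_Integration.integrable_diff[OF i(3) i(4)[of k]]]
      by (simp add: abs_minus_commute)
    also have "\<dots> \<le> (\<integral>w. \<bar>x' w * Y (\<pi> w) - xk' k w * Y (\<pi> w)\<bar> \<partial>N)"
      unfolding X'_def XK'_def by (rule cond_expect_L1[OF bN])
    also have "\<dots> \<le> B * d k"
      unfolding d_def by (rule N.integral_mult_diff_le[OF x' xk' YN BN])
    finally show ?thesis .
  qed
  have tri: "(\<integral>\<omega>. min 1 \<bar>X n \<omega> - X' \<omega>\<bar> \<partial>M) \<le> B * (\<integral>\<omega>. \<bar>x n \<omega> - xk k n \<omega>\<bar> \<partial>M)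
      + (\<integral>\<omega>. min 1 \<bar>XK k n \<omega> - XK' k \<omega>\<bar> \<partial>M) + B * d k" for n k
    using M.integral_min1_triangle[OF m(1)[of n] m(2)[of k n] m(3)]
      M.integral_min1_triangle[OF m(2)[of k n] m(4)[of k] m(3)] 1[of n k] 2[of k] by linarith
  have "(\<lambda>n. \<integral>\<omega>. min 1 \<bar>X n \<omega> - X' \<omega>\<bar> \<partial>M) \<longlonglongrightarrow> 0"
  proof (rule tendstoI)
    fix \<eta> :: real assume \<eta>: "0 < \<eta>"
    have "(\<lambda>k. B * e k + B * d k) \<longlonglongrightarrow> B * 0 + B * 0"
      unfolding d_def by (intro tendsto_intros e lim)
    then have "\<forall>\<^sub>F k in sequentially. B * e k + B * d k < \<eta> / 2"
      using \<eta> by (intro order_tendstoD(2)) auto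
    then obtain k where k: "B * e k + B * d k < \<eta> / 2"
      by (auto simp: eventually_sequentially)
    have "(\<lambda>n. \<integral>\<omega>. min 1 \<bar>XK k n \<omega> - XK' k \<omega>\<bar> \<partial>M) \<longlonglongrightarrow> 0"
      using conv[of k] Y m unfolding cond_conv_def XK_def XK'_def
      by (subst M.tendsto_in_prob_iff_integral[symmetric]) auto
    then have "\<forall>\<^sub>F n in sequentially. (\<integral>\<omega>. min 1 \<bar>XK k n \<omega> - XK' k \<omega>\<bar> \<partial>M) < \<eta> / 2"
      using \<eta> by (intro order_tendstoD(2)) auto
    with ev[of k] show "\<forall>\<^sub>F n in sequentially. dist (\<integral>\<omega>. min 1 \<bar>X n \<omega> - X' \<omega>\<bar> \<partial>M) 0 < \<eta>"
    proof eventually_elim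
      fix n assume n: "(\<integral>\<omega>. \<bar>x n \<omega> - xk k n \<omega>\<bar> \<partial>M) \<le> e k" "(\<integral>\<omega>. min 1 \<bar>XK k n \<omega> - XK' k \<omega>\<bar> \<partial>M) < \<eta> / 2"
      have "B * (\<integral>\<omega>. \<bar>x n \<omega> - xk k n \<omega>\<bar> \<partial>M) \<le> B * e k"
        by (rule mult_left_mono[OF n(1) B(1)])
      then have "(\<integral>\<omega>. min 1 \<bar>X n \<omega> - X' \<omega>\<bar> \<partial>M) < \<eta>" using tri[of n k] n(2) k by linarith
      then show "dist (\<integral>\<omega>. min 1 \<bar>X n \<omega> - X' \<omega>\<bar> \<partial>M) 0 < \<eta>" by (simp add: abs_of_nonneg)
    qed
  qed
  then show "tendsto_in_prob M (\<lambda>n. EM (\<lambda>\<omega>. x n \<omega> * Y \<omega>)) (E (\<lambda>w. x' w * Y (\<pi> w))) sequentially"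
    using m by (subst M.tendsto_in_prob_iff_integral) (auto simp: X_def[symmetric] X'_def[symmetric])
qed

text \<open>Uniformly bounded variables that converge in probability also converge in mean, and the mean of a
  conditional expectation is the unconditional mean.\<close>

lemma cond_conv_integral:
  assumes x: "\<And>n. bounded_rv M (x n)" and b: "\<And>n \<omega>. \<omega> \<in> space M \<Longrightarrow> \<bar>x n \<omega>\<bar> \<le> c"
    and x': "bounded_rv N x'" and conv: "cond_conv x x'" and Y: "bounded_rv G Y"
  shows "(\<lambda>n. \<integral>\<omega>. x n \<omega> * Y \<omega> \<partial>M) \<longlonglongrightarrow> (\<integral>w. x' w * Y (\<pi> w) \<partial>N)"
proof -
  note YM = bounded_rv_G[OF Y] and YN = bounded_rv_pi[OF Y]
  obtain B where B: "0 \<le> B" "\<And>\<omega>. \<omega> \<in> space M \<Longrightarrow> \<bar>Y \<omega>\<bar> \<le> B"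
    using YM by (rule bounded_rvE) blast
  have bM: "bounded_rv M (\<lambda>\<omega>. x n \<omega> * Y \<omega>)" for n
    by (intro bounded_rv_mult x YM)
  have bN: "bounded_rv N (\<lambda>w. x' w * Y (\<pi> w))"
    by (intro bounded_rv_mult x' YN)
  obtain D where D: "0 \<le> D" "\<And>w. w \<in> space N \<Longrightarrow> \<bar>x' w * Y (\<pi> w)\<bar> \<le> D"
    using bN by (rule bounded_rvE) blast
  define X where "X n = EM (\<lambda>\<omega>. x n \<omega> * Y \<omega>)" for n
  define X' where "X' = E (\<lambda>w. x' w * Y (\<pi> w))"
  have m[measurable]: "X n \<in> borel_measurable M" "X' \<in> borel_measurable M" for n
    unfolding X_def X'_def
    by (rule base.cond_expect_measurable_M cond_expect_measurable_M, rule bounded_rv_measurable, rule bM bN)+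
  have i: "integrable M (X n)" "integrable M X'" for n
    unfolding X_def X'_def by (intro base.cond_expect_integrable cond_expect_integrable bM bN)+
  have bX: "AE \<omega> in M. \<bar>X n \<omega>\<bar> \<le> c * B" for n
    unfolding X_def
  proof (rule base.cond_expect_abs_le)
    fix \<omega> assume \<omega>: "\<omega> \<in> space M"
    show "\<bar>x n \<omega> * Y \<omega>\<bar> \<le> c * B"
      unfolding abs_mult using b[OF \<omega>, of n] B(2)[OF \<omega>] by (intro mult_mono) auto
  qed (rule bounded_rv_measurable[OF bM])
  have bX': "AE \<omega> in M. \<bar>X' \<omega>\<bar> \<le> D"
    unfolding X'_def by (rule cond_expect_abs_le) (use bN D in \<open>auto intro: bounded_rv_measurable\<close>)
  have tp: "tendsto_in_prob M X X' sequentially"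
    using conv Y unfolding cond_conv_def X_def[abs_def] X'_def by blast
  define L where "L = \<bar>c * B\<bar> + D + 1"
  have lim: "(\<lambda>n. L * (\<integral>\<omega>. min 1 \<bar>X n \<omega> - X' \<omega>\<bar> \<partial>M)) \<longlonglongrightarrow> L * 0"
    using tp by (intro tendsto_mult tendsto_const) (simp add: M.tendsto_in_prob_iff_integral)
  have "\<bar>(\<integral>\<omega>. X n \<omega> \<partial>M) - (\<integral>\<omega>. X' \<omega> \<partial>M)\<bar> \<le> L * (\<integral>\<omega>. min 1 \<bar>X n \<omega> - X' \<omega>\<bar> \<partial>M)" for n
  proof -
    have "\<bar>(\<integral>\<omega>. X n \<omega> \<partial>M) - (\<integral>\<omega>. X' \<omega> \<partial>M)\<bar> \<le> (\<integral>\<omega>. \<bar>X n \<omega> - X' \<omega>\<bar> \<partial>M)"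
      using i integral_abs_bound[of M "\<lambda>\<omega>. X n \<omega> - X' \<omega>"] by simp
    also have "\<dots> \<le> (\<integral>\<omega>. L * min 1 \<bar>X n \<omega> - X' \<omega>\<bar> \<partial>M)"
    proof (rule integral_mono_AE)
      show "integrable M (\<lambda>\<omega>. L * min 1 \<bar>X n \<omega> - X' \<omega>\<bar>)"
        by (intro M.bounded_rv_integrable bounded_rv_cmult M.bounded_rv_min1) auto
      show "AE \<omega> in M. \<bar>X n \<omega> - X' \<omega>\<bar> \<le> L * min 1 \<bar>X n \<omega> - X' \<omega>\<bar>"
        using bX[of n] bX'
      proof eventually_elim
        fix \<omega> assume a: "\<bar>X n \<omega>\<bar> \<le> c * B" "\<bar>X' \<omega>\<bar> \<le> D"
        have "\<bar>X n \<omega> - X' \<omega>\<bar> \<le> L" using a unfolding L_def by linarith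
        moreover have "1 \<le> L" using D(1) by (simp add: L_def)
        ultimately show "\<bar>X n \<omega> - X' \<omega>\<bar> \<le> L * min 1 \<bar>X n \<omega> - X' \<omega>\<bar>"
          using mult_right_mono[of 1 L "\<bar>X n \<omega> - X' \<omega>\<bar>"] by (simp add: min_def)
      qed
    qed (use i in auto)
    finally show ?thesis by simp
  qed
  then have "\<forall>\<^sub>F n in sequentially. norm ((\<integral>\<omega>. X n \<omega> \<partial>M) - (\<integral>\<omega>. X' \<omega> \<partial>M))
      \<le> L * (\<integral>\<omega>. min 1 \<bar>X n \<omega> - X' \<omega>\<bar> \<partial>M)"
    by (intro always_eventually) auto
  from Lim_null_comparison[OF this] have "(\<lambda>n. (\<integral>\<omega>. X n \<omega> \<partial>M) - (\<integral>\<omega>. X' \<omega> \<partial>M)) \<longlonglongrightarrow> 0"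
    using lim by simp
  then have "(\<lambda>n. \<integral>\<omega>. X n \<omega> \<partial>M) \<longlonglongrightarrow> (\<integral>\<omega>. X' \<omega> \<partial>M)" by (simp add: LIM_zero_iff)
  then show ?thesis
    unfolding X_def X'_def base.cond_expect_total[OF bM] cond_expect_total[OF bN] .
qed

text \<open>Conditional uniform integrability, which is assumed only almost surely, with an \<open>\<omega>\<close>-dependent
  truncation level, and only after multiplication by \<open>\<Psi>\<close>, extends the convergence from bounded
  functions of \<open>X n\<close> to \<open>X n\<close> itself. The bound on the conditional mean of the excess over a level
  passes to the limit \<open>X'\<close> along almost surely convergent subsequences (step \<open>clos\<close>); this yields
  both the existence of the conditional mean of \<open>X'\<close> and the convergence of its truncations. On the
  side of \<open>X n\<close> the factor \<open>\<Psi>\<close> is removed because it is at least \<open>1/2\<close> with probability close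
  to \<open>1\<close>.\<close>

lemma cond_conv_unbounded:
  assumes X: "\<And>n. bounded_rv M (X n)" and X'[measurable]: "X' \<in> borel_measurable N"
    and conv: "\<And>\<phi>. continuous_on UNIV \<phi> \<Longrightarrow> bounded (range \<phi>) \<Longrightarrow> cond_conv (\<lambda>n \<omega>. \<phi> (X n \<omega>)) (\<lambda>w. \<phi> (X' w))"
    and \<Psi>[measurable]: "\<And>n. \<Psi> n \<in> borel_measurable M" and \<Psi>01: "\<And>n \<omega>. \<omega> \<in> space M \<Longrightarrow> \<Psi> n \<omega> \<in> {0..1}"
    and \<Psi>1: "tendsto_in_prob M \<Psi> (\<lambda>_. 1) sequentially"
    and ui: "AE \<omega> in M. \<forall>\<eta>>0. \<exists>m::nat. \<forall>n. \<Psi> n \<omega> * EM (\<lambda>\<omega>. max 0 (\<bar>X n \<omega>\<bar> - real m)) \<omega> \<le> \<eta>"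
    and Y: "bounded_rv G Y"
  shows "AE \<omega> in M. cond_integrable N \<pi> C (\<lambda>w. X' w * Y (\<pi> w)) \<omega>"
    and "tendsto_in_prob M (\<lambda>n. EM (\<lambda>\<omega>. X n \<omega> * Y \<omega>)) (E (\<lambda>w. X' w * Y (\<pi> w))) sequentially"
proof -
  note YM = bounded_rv_G[OF Y] and YN = bounded_rv_pi[OF Y]
  obtain B0 where B0: "0 \<le> B0" "\<And>\<omega>. \<omega> \<in> space M \<Longrightarrow> \<bar>Y \<omega>\<bar> \<le> B0"
    using YM by (rule bounded_rvE) blast
  define B where "B = max 1 B0"
  have B1: "1 \<le> B" and B: "\<And>\<omega>. \<omega> \<in> space M \<Longrightarrow> \<bar>Y \<omega>\<bar> \<le> B"
    using B0 by (auto simp: B_def le_max_iff_disj)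
  have BN: "\<bar>Y (\<pi> w)\<bar> \<le> B" if "w \<in> space N" for w
    using B measurable_space[OF pi_M that] by blast
  define h :: "nat \<Rightarrow> real \<Rightarrow> real" where "h m x = max 0 (\<bar>x\<bar> - real m)" for m x
  have hm[measurable]: "h m \<in> borel_measurable borel" for m unfolding h_def[abs_def] by measurable
  have h0: "0 \<le> h m x" for m x by (simp add: h_def)
  have bh: "bounded_rv M (\<lambda>\<omega>. h m (X n \<omega>))" for m n
  proof -
    obtain c where c: "0 \<le> c" "X n \<in> borel_measurable M" "\<And>\<omega>. \<omega> \<in> space M \<Longrightarrow> \<bar>X n \<omega>\<bar> \<le> c"
      using X[of n] by (rule bounded_rvE) blast
    show ?thesis
      by (rule bounded_rvI[of _ _ c]) (use c in \<open>auto simp: h_def dest!: c(3)\<close>)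
  qed
  have Xm[measurable]: "X n \<in> borel_measurable M" for n by (rule bounded_rv_measurable[OF X])
  define D where "D m n = EM (\<lambda>\<omega>. h m (X n \<omega>))" for m n
  have Dm[measurable]: "D m n \<in> borel_measurable M" for m n
    unfolding D_def by (rule base.cond_expect_measurable_M[OF bounded_rv_measurable[OF bh]])
  have D0: "AE \<omega> in M. \<forall>m n. 0 \<le> D m n \<omega>"
  proof -
    have "AE \<omega> in M. EM (\<lambda>_. 0) \<omega> \<le> D m n \<omega>" for m n
      unfolding D_def by (rule base.cond_expect_mono[OF bounded_rv_const bh]) (simp add: h_def)
    moreover have "AE \<omega> in M. EM (\<lambda>_. 0) \<omega> = 0"
      using base.cond_expect_base[OF bounded_rv_const, of 0] by simp
    ultimately have "AE \<omega> in M. 0 \<le> D m n \<omega>" for m n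
    proof -
      have "AE \<omega> in M. EM (\<lambda>_. 0) \<omega> \<le> D m n \<omega>" "AE \<omega> in M. EM (\<lambda>_. 0) \<omega> = 0" by fact+
      then show ?thesis by eventually_elim simp
    qed
    then show ?thesis by (simp add: AE_all_countable)
  qed
  have Dmono: "AE \<omega> in M. \<forall>m m' n. m \<le> m' \<longrightarrow> D m' n \<omega> \<le> D m n \<omega>"
  proof -
    have "AE \<omega> in M. D m' n \<omega> \<le> D m n \<omega>" if "m \<le> m'" for m m' n
      unfolding D_def by (rule base.cond_expect_mono[OF bh bh]) (use that in \<open>auto simp: h_def\<close>)
    then have "AE \<omega> in M. m \<le> m' \<longrightarrow> D m' n \<omega> \<le> D m n \<omega>" for m m' n
      by (cases "m \<le> m'") auto
    then show ?thesis by (simp add: AE_all_countable)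
  qed
  have D_0_le: "AE \<omega> in M. \<forall>m n. D 0 n \<omega> \<le> real m + D m n \<omega>"
  proof -
    have "AE \<omega> in M. D 0 n \<omega> \<le> real m + D m n \<omega>" for m n
    proof -
      have "AE \<omega> in M. D 0 n \<omega> \<le> EM (\<lambda>\<omega>. real m * 1 + 1 * h m (X n \<omega>)) \<omega>"
        unfolding D_def
        by (intro base.cond_expect_mono bh bounded_rv_add bounded_rv_cmult bounded_rv_const) (auto simp: h_def)
      moreover have "AE \<omega> in M. EM (\<lambda>\<omega>. real m * 1 + 1 * h m (X n \<omega>)) \<omega> = real m * EM (\<lambda>_. 1) \<omega> + 1 * D m n \<omega>"
        unfolding D_def by (rule base.cond_expect_lin[OF bounded_rv_const bh])
      moreover have "AE \<omega> in M. EM (\<lambda>_. 1) \<omega> = 1"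
        using base.cond_expect_base[OF bounded_rv_const, of 1] by simp
      ultimately show ?thesis by eventually_elim simp
    qed
    then show ?thesis by (simp add: AE_all_countable)
  qed
  have ui': "AE \<omega> in M. \<forall>\<eta>>0. \<exists>m. \<forall>n. \<Psi> n \<omega> * D m n \<omega> \<le> \<eta>"
    using ui by (simp add: D_def h_def)

  \<comment> \<open>The bound \<open>c\<close> is quantified inside because the supremum over \<open>n\<close> depends on \<open>\<omega>\<close> and may be infinite.\<close>
  have clos: "AE \<omega> in M. \<forall>m j c. (\<forall>n. \<Psi> n \<omega> * D m n \<omega> \<le> c) \<longrightarrow> E (\<lambda>w. min (h m (X' w)) (real j)) \<omega> \<le> c"
  proof -
    have "AE \<omega> in M. \<forall>c. (\<forall>n. \<Psi> n \<omega> * D m n \<omega> \<le> c) \<longrightarrow> E (\<lambda>w. min (h m (X' w)) (real j)) \<omega> \<le> c" for m j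
    proof -
      define \<phi> where "\<phi> x = min (h m x) (real j)" for x
      have \<phi>c: "continuous_on UNIV \<phi>" unfolding \<phi>_def h_def by (intro continuous_intros)
      have \<phi>01: "0 \<le> \<phi> x" "\<phi> x \<le> real j" "\<phi> x \<le> h m x" for x by (auto simp: \<phi>_def h_def)
      have \<phi>b: "bounded (range \<phi>)" by (rule boundedI[of _ "real j"]) (use \<phi>01 in auto)
      have [measurable]: "\<phi> \<in> borel_measurable borel" unfolding \<phi>_def[abs_def] by measurable
      have b\<phi>: "bounded_rv M (\<lambda>\<omega>. \<phi> (X n \<omega>))" for n
        by (rule bounded_rvI[of _ _ "real j"]) (use \<phi>01 in auto)
      have b\<phi>': "bounded_rv N (\<lambda>w. \<phi> (X' w))"
        by (rule bounded_rvI[of _ _ "real j"]) (use \<phi>01 in auto)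
      define e where "e n = EM (\<lambda>\<omega>. \<phi> (X n \<omega>))" for n
      define e' where "e' = E (\<lambda>w. \<phi> (X' w))"
      have em: "e n \<in> borel_measurable M" "e' \<in> borel_measurable M" for n
        unfolding e_def e'_def
        by (rule base.cond_expect_measurable_M cond_expect_measurable_M, rule bounded_rv_measurable, rule b\<phi> b\<phi>')+
      have "tendsto_in_prob M e e' sequentially"
        using conv[OF \<phi>c \<phi>b] bounded_rv_const[of G 1] unfolding cond_conv_def e_def[abs_def] e'_def by fastforce
      from M.tendsto_in_prob_AE_subseq[OF em(1) em(2) this] obtain r :: "nat \<Rightarrow> nat"
        where r: "strict_mono r" "AE \<omega> in M. (\<lambda>k. e (r k) \<omega>) \<longlonglongrightarrow> e' \<omega>" by blast
      have "tendsto_in_prob M (\<lambda>k. \<Psi> (r k)) (\<lambda>_. 1) sequentially"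
        by (rule tendsto_in_prob_compose[OF \<Psi>1 filterlim_subseq[OF r(1)]])
      from M.tendsto_in_prob_AE_subseq[OF _ _ this] obtain s :: "nat \<Rightarrow> nat"
        where s: "strict_mono s" "AE \<omega> in M. (\<lambda>k. \<Psi> (r (s k)) \<omega>) \<longlonglongrightarrow> 1" by auto
      have "AE \<omega> in M. \<forall>n. e n \<omega> \<le> D m n \<omega>"
        by (subst AE_all_countable, intro allI, unfold e_def D_def, rule base.cond_expect_mono[OF b\<phi> bh])
           (use \<phi>01 in auto)
      then show ?thesis using r(2) s(2) AE_space
      proof eventually_elim
        fix \<omega> assume le: "\<forall>n. e n \<omega> \<le> D m n \<omega>" and l1: "(\<lambda>k. e (r k) \<omega>) \<longlonglongrightarrow> e' \<omega>"
          and l2: "(\<lambda>k. \<Psi> (r (s k)) \<omega>) \<longlonglongrightarrow> 1" and \<omega>: "\<omega> \<in> space M"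
        have "(\<lambda>k. \<Psi> (r (s k)) \<omega> * e (r (s k)) \<omega>) \<longlonglongrightarrow> 1 * e' \<omega>"
          by (rule tendsto_mult[OF l2 filterlim_compose[OF l1 filterlim_subseq[OF s(1)]]])
        moreover have "\<Psi> n \<omega> * e n \<omega> \<le> \<Psi> n \<omega> * D m n \<omega>" for n
          by (rule mult_left_mono) (use le \<Psi>01[OF \<omega>, of n] in auto)
        ultimately have "e' \<omega> \<le> c" if "\<forall>n. \<Psi> n \<omega> * D m n \<omega> \<le> c" for c
          using that by (intro LIMSEQ_le_const2[of _ "e' \<omega>" c]) (auto intro: order_trans)
        then show "\<forall>c. (\<forall>n. \<Psi> n \<omega> * D m n \<omega> \<le> c) \<longrightarrow> E (\<lambda>w. min (h m (X' w)) (real j)) \<omega> \<le> c"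
          by (simp add: e'_def \<phi>_def)
      qed
    qed
    then show ?thesis by (simp add: AE_all_countable)
  qed

  define W where "W w = X' w * Y (\<pi> w)" for w
  have [measurable]: "(\<lambda>w. Y (\<pi> w)) \<in> borel_measurable N" by (rule bounded_rv_measurable[OF YN])
  have Wm[measurable]: "W \<in> borel_measurable N" unfolding W_def[abs_def] by measurable
  define Q where "Q m = (\<lambda>w. trunc (real m) (X' w) * Y (\<pi> w))" for m :: nat
  have bQ: "bounded_rv N (Q m)" for m
    unfolding Q_def by (intro bounded_rv_mult[OF _ YN] bounded_rvI[of _ _ "real m"]) (auto simp: trunc_abs_le)
  have bT: "bounded_rv N (\<lambda>w. trunc (real j) (W w))" for j
    by (intro bounded_rvI[of _ _ "real j"]) (auto simp: trunc_abs_le)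
  have bmin: "bounded_rv N (\<lambda>w. min (h m (X' w)) (real j))" for m j
    by (intro bounded_rvI[of _ _ "real j"]) (auto simp: h_def)
  have minW: "AE \<omega> in M. \<forall>j. E (\<lambda>w. min \<bar>W w\<bar> (real j)) \<omega> \<le> B * E (\<lambda>w. min (h 0 (X' w)) (real j)) \<omega>"
  proof -
    have "AE \<omega> in M. E (\<lambda>w. min \<bar>W w\<bar> (real j)) \<omega> \<le> B * E (\<lambda>w. min (h 0 (X' w)) (real j)) \<omega>" for j
    proof -
      have "AE \<omega> in M. E (\<lambda>w. min \<bar>W w\<bar> (real j)) \<omega> \<le> E (\<lambda>w. B * min (h 0 (X' w)) (real j) + 0 * 0) \<omega>"
      proof (rule cond_expect_mono)
        show "bounded_rv N (\<lambda>w. min \<bar>W w\<bar> (real j))"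
          by (intro bounded_rvI[of _ _ "real j"]) auto
        show "bounded_rv N (\<lambda>w. B * min (h 0 (X' w)) (real j) + 0 * 0)"
          by (intro bounded_rv_add bounded_rv_const bounded_rv_cmult bmin)
        have "min \<bar>W w\<bar> (real j) \<le> B * min (h 0 (X' w)) (real j) + 0 * 0" if "w \<in> space N" for w
        proof -
          have "\<bar>W w\<bar> \<le> B * \<bar>X' w\<bar>" unfolding W_def abs_mult
            using mult_right_mono[OF BN[OF that], of "\<bar>X' w\<bar>"] by (simp add: mult.commute)
          moreover have "1 * real j \<le> B * real j" by (rule mult_right_mono[OF B1]) simp
          ultimately show ?thesis by (auto simp: min_def h_def)
        qed
        then show "AE w in N. min \<bar>W w\<bar> (real j) \<le> B * min (h 0 (X' w)) (real j) + 0 * 0" by simp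
      qed
      moreover have "AE \<omega> in M. E (\<lambda>w. B * min (h 0 (X' w)) (real j) + 0 * 0) \<omega>
          = B * E (\<lambda>w. min (h 0 (X' w)) (real j)) \<omega> + 0 * E (\<lambda>_. 0) \<omega>"
        by (rule cond_expect_lin[OF bmin bounded_rv_const])
      ultimately show ?thesis by eventually_elim simp
    qed
    then show ?thesis by (simp add: AE_all_countable)
  qed
  \<comment> \<open>\<open>E W\<close> is the limit of truncations of the product, but the hypothesis concerns truncations of the factor.\<close>
  have TQ: "AE \<omega> in M. \<forall>m j. real m * B \<le> real j \<longrightarrow>
      \<bar>E (\<lambda>w. trunc (real j) (W w)) \<omega> - E (Q m) \<omega>\<bar> \<le> B * E (\<lambda>w. min (h m (X' w)) (real j)) \<omega>"
  proof -
    have "AE \<omega> in M. \<bar>E (\<lambda>w. trunc (real j) (W w)) \<omega> - E (Q m) \<omega>\<bar> \<le> B * E (\<lambda>w. min (h m (X' w)) (real j)) \<omega>"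
      if mj: "real m * B \<le> real j" for m j
    proof -
      let ?T = "\<lambda>w. trunc (real j) (W w)" and ?m = "\<lambda>w. min (h m (X' w)) (real j)"
      have pw: "\<bar>?T w - Q m w\<bar> \<le> B * ?m w" if "w \<in> space N" for w
        using trunc_mult_diff[OF BN[OF that] B1 _ mj, of "X' w"] by (simp add: W_def Q_def h_def)
      have le: "?T w \<le> 1 * Q m w + B * ?m w" "Q m w \<le> 1 * ?T w + B * ?m w" if "w \<in> space N" for w
        using pw[OF that] by (auto simp: abs_le_iff)
      have "AE \<omega> in M. E ?T \<omega> \<le> E (\<lambda>w. 1 * Q m w + B * ?m w) \<omega>"
        by (rule cond_expect_mono[OF bT bounded_rv_add[OF bounded_rv_cmult[OF bQ] bounded_rv_cmult[OF bmin]]])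
           (use le(1) in auto)
      moreover have "AE \<omega> in M. E (\<lambda>w. 1 * Q m w + B * ?m w) \<omega> = 1 * E (Q m) \<omega> + B * E ?m \<omega>"
        by (rule cond_expect_lin[OF bQ bmin])
      moreover have "AE \<omega> in M. E (Q m) \<omega> \<le> E (\<lambda>w. 1 * ?T w + B * ?m w) \<omega>"
        by (rule cond_expect_mono[OF bQ bounded_rv_add[OF bounded_rv_cmult[OF bT] bounded_rv_cmult[OF bmin]]])
           (use le(2) in auto)
      moreover have "AE \<omega> in M. E (\<lambda>w. 1 * ?T w + B * ?m w) \<omega> = 1 * E ?T \<omega> + B * E ?m \<omega>"
        by (rule cond_expect_lin[OF bT bmin])
      ultimately show ?thesis by eventually_elim (auto simp: abs_le_iff)
    qed
    then have "AE \<omega> in M. real m * B \<le> real j \<longrightarrow>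
      \<bar>E (\<lambda>w. trunc (real j) (W w)) \<omega> - E (Q m) \<omega>\<bar> \<le> B * E (\<lambda>w. min (h m (X' w)) (real j)) \<omega>" for m j
      by (cases "real m * B \<le> real j") auto
    then show ?thesis by (simp add: AE_all_countable)
  qed
  have main: "AE \<omega> in M. cond_integrable N \<pi> C W \<omega> \<and> (\<lambda>m. E (Q m) \<omega>) \<longlonglongrightarrow> E W \<omega>"
    using cond_expect_truncation[OF Wm] minW TQ clos ui' D_0_le Dmono AE_space
  proof eventually_elim
    fix \<omega>
    assume tr: "\<forall>c. (\<forall>j. E (\<lambda>w. min \<bar>W w\<bar> (real j)) \<omega> \<le> c) \<longrightarrow>
        cond_integrable N \<pi> C W \<omega> \<and> (\<lambda>j. E (\<lambda>w. trunc (real j) (W w)) \<omega>) \<longlonglongrightarrow> E W \<omega>"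
      and mw: "\<forall>j. E (\<lambda>w. min \<bar>W w\<bar> (real j)) \<omega> \<le> B * E (\<lambda>w. min (h 0 (X' w)) (real j)) \<omega>"
      and tq: "\<forall>m j. real m * B \<le> real j \<longrightarrow>
        \<bar>E (\<lambda>w. trunc (real j) (W w)) \<omega> - E (Q m) \<omega>\<bar> \<le> B * E (\<lambda>w. min (h m (X' w)) (real j)) \<omega>"
      and cl: "\<forall>m j c. (\<forall>n. \<Psi> n \<omega> * D m n \<omega> \<le> c) \<longrightarrow> E (\<lambda>w. min (h m (X' w)) (real j)) \<omega> \<le> c"
      and u: "\<forall>\<eta>>0. \<exists>m. \<forall>n. \<Psi> n \<omega> * D m n \<omega> \<le> \<eta>"
      and d0: "\<forall>m n. D 0 n \<omega> \<le> real m + D m n \<omega>"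
      and dm: "\<forall>m m' n. m \<le> m' \<longrightarrow> D m' n \<omega> \<le> D m n \<omega>" and \<omega>: "\<omega> \<in> space M"
    have P: "0 \<le> \<Psi> n \<omega>" "\<Psi> n \<omega> \<le> 1" for n using \<Psi>01[OF \<omega>, of n] by auto
    from u obtain m1 where m1: "\<forall>n. \<Psi> n \<omega> * D m1 n \<omega> \<le> 1" using zero_less_one by blast
    have "\<Psi> n \<omega> * D 0 n \<omega> \<le> real m1 + 1" for n
    proof -
      have "\<Psi> n \<omega> * D 0 n \<omega> \<le> \<Psi> n \<omega> * (real m1 + D m1 n \<omega>)" by (rule mult_left_mono) (use d0 P in auto)
      also have "\<dots> = \<Psi> n \<omega> * real m1 + \<Psi> n \<omega> * D m1 n \<omega>" by (simp add: algebra_simps)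
      also have "\<dots> \<le> 1 * real m1 + 1" by (intro add_mono mult_right_mono) (use m1 P in auto)
      finally show ?thesis by simp
    qed
    then have "E (\<lambda>w. min (h 0 (X' w)) (real j)) \<omega> \<le> real m1 + 1" for j using cl by blast
    then have "E (\<lambda>w. min \<bar>W w\<bar> (real j)) \<omega> \<le> B * (real m1 + 1)" for j
      using mw B1 by (meson mult_left_mono order_trans zero_le_one)
    then have ci: "cond_integrable N \<pi> C W \<omega>" and lim: "(\<lambda>j. E (\<lambda>w. trunc (real j) (W w)) \<omega>) \<longlonglongrightarrow> E W \<omega>"
      using tr by blast+
    have bd: "\<bar>E W \<omega> - E (Q m) \<omega>\<bar> \<le> B * c" if c: "\<forall>n. \<Psi> n \<omega> * D m n \<omega> \<le> c" for m c
    proof (rule LIMSEQ_le_const2)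
      show "(\<lambda>j. \<bar>E (\<lambda>w. trunc (real j) (W w)) \<omega> - E (Q m) \<omega>\<bar>) \<longlonglongrightarrow> \<bar>E W \<omega> - E (Q m) \<omega>\<bar>"
        by (intro tendsto_intros lim)
      obtain j0 :: nat where j0: "real m * B \<le> real j0" using real_arch_simple by blast
      have "\<bar>E (\<lambda>w. trunc (real j) (W w)) \<omega> - E (Q m) \<omega>\<bar> \<le> B * c" if "j0 \<le> j" for j
      proof -
        have "real m * B \<le> real j" using j0 that by linarith
        then have "\<bar>E (\<lambda>w. trunc (real j) (W w)) \<omega> - E (Q m) \<omega>\<bar> \<le> B * E (\<lambda>w. min (h m (X' w)) (real j)) \<omega>"
          using tq by blast
        also have "\<dots> \<le> B * c" using cl c B1 by (intro mult_left_mono) auto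
        finally show ?thesis .
      qed
      then show "\<exists>N. \<forall>n\<ge>N. \<bar>E (\<lambda>w. trunc (real n) (W w)) \<omega> - E (Q m) \<omega>\<bar> \<le> B * c" by blast
    qed
    have "(\<lambda>m. E (Q m) \<omega>) \<longlonglongrightarrow> E W \<omega>"
    proof (rule LIMSEQ_I)
      fix e :: real assume e: "0 < e"
      then have "0 < e / (2 * B)" using B1 by simp
      then obtain m where m: "\<forall>n. \<Psi> n \<omega> * D m n \<omega> \<le> e / (2 * B)" using u by blast
      have "norm (E (Q m') \<omega> - E W \<omega>) < e" if "m \<le> m'" for m'
      proof -
        have "\<Psi> n \<omega> * D m' n \<omega> \<le> e / (2 * B)" for n
          using mult_left_mono[of "D m' n \<omega>" "D m n \<omega>" "\<Psi> n \<omega>"] dm that P(1)[of n] m by (meson order_trans)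
        then have "\<bar>E W \<omega> - E (Q m') \<omega>\<bar> \<le> B * (e / (2 * B))" using bd by blast
        also have "\<dots> < e" using e B1 by simp
        finally show ?thesis by (simp add: abs_minus_commute)
      qed
      then show "\<exists>no. \<forall>n\<ge>no. norm (E (Q n) \<omega> - E W \<omega>) < e" by blast
    qed
    with ci show "cond_integrable N \<pi> C W \<omega> \<and> (\<lambda>m. E (Q m) \<omega>) \<longlonglongrightarrow> E W \<omega>" by blast
  qed
  from main show "AE \<omega> in M. cond_integrable N \<pi> C (\<lambda>w. X' w * Y (\<pi> w)) \<omega>"
    unfolding W_def[abs_def] by eventually_elim blast

  define QM where "QM m n = (\<lambda>\<omega>. trunc (real m) (X n \<omega>) * Y \<omega>)" for m n :: nat
  have [measurable]: "Y \<in> borel_measurable M" by (rule bounded_rv_measurable[OF YM])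
  have bQM: "bounded_rv M (QM m n)" for m n
    unfolding QM_def by (intro bounded_rv_mult[OF _ YM] bounded_rvI[of _ _ "real m"]) (auto simp: trunc_abs_le)
  have bXY: "bounded_rv M (\<lambda>\<omega>. X n \<omega> * Y \<omega>)" for n by (intro bounded_rv_mult X YM)
  define e where "e n = EM (\<lambda>\<omega>. X n \<omega> * Y \<omega>)" for n
  define eQ where "eQ m n = EM (QM m n)" for m n
  define eQ' where "eQ' m = E (Q m)" for m
  define eW where "eW = E W"
  have mm[measurable]: "e n \<in> borel_measurable M" "eQ m n \<in> borel_measurable M" "eQ' m \<in> borel_measurable M" "eW \<in> borel_measurable M" for n m
    unfolding e_def eQ_def eQ'_def eW_def
    by (intro base.cond_expect_measurable_M cond_expect_measurable_M bounded_rv_measurable[OF bXY]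
        bounded_rv_measurable[OF bQM] bounded_rv_measurable[OF bQ] Wm)+
  have eQ_lim: "(\<lambda>n. \<integral>\<omega>. min 1 \<bar>eQ m n \<omega> - eQ' m \<omega>\<bar> \<partial>M) \<longlonglongrightarrow> 0" for m
  proof -
    have "cond_conv (\<lambda>n \<omega>. trunc (real m) (X n \<omega>)) (\<lambda>w. trunc (real m) (X' w))"
      by (rule conv) (auto intro!: continuous_intros boundedI[of _ "real m"] simp: trunc_abs_le)
    then have "tendsto_in_prob M (eQ m) (eQ' m) sequentially"
      using Y unfolding cond_conv_def eQ_def[abs_def] eQ'_def QM_def Q_def by blast
    then show ?thesis by (simp add: M.tendsto_in_prob_iff_integral)
  qed
  have eQ'_lim: "(\<lambda>m. \<integral>\<omega>. min 1 \<bar>eQ' m \<omega> - eW \<omega>\<bar> \<partial>M) \<longlonglongrightarrow> (\<integral>\<omega>. 0 \<partial>M)"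
  proof (rule integral_dominated_convergence[where w="\<lambda>_. 1"])
    show "AE \<omega> in M. (\<lambda>m. min 1 \<bar>eQ' m \<omega> - eW \<omega>\<bar>) \<longlonglongrightarrow> 0"
      using main
    proof eventually_elim
      fix \<omega> assume "cond_integrable N \<pi> C W \<omega> \<and> (\<lambda>m. E (Q m) \<omega>) \<longlonglongrightarrow> E W \<omega>"
      then have "(\<lambda>m. eQ' m \<omega>) \<longlonglongrightarrow> eW \<omega>" by (simp add: eQ'_def eW_def)
      then have "(\<lambda>m. min 1 \<bar>eQ' m \<omega> - eW \<omega>\<bar>) \<longlonglongrightarrow> min 1 \<bar>eW \<omega> - eW \<omega>\<bar>"
        by (intro tendsto_intros)
      then show "(\<lambda>m. min 1 \<bar>eQ' m \<omega> - eW \<omega>\<bar>) \<longlonglongrightarrow> 0" by simp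
    qed
  qed auto
  \<comment> \<open>\<open>R m\<close> dominates the excess over level \<open>m\<close> for all \<open>n\<close> at once; the factor \<open>2\<close> compensates for \<open>\<Psi> \<ge> 1/2\<close>.\<close>
  define R where "R m \<omega> = (SUP n. min 1 \<bar>2 * B * (\<Psi> n \<omega> * D m n \<omega>)\<bar>)" for m \<omega>
  have bddR: "bdd_above (range (\<lambda>n. min 1 \<bar>2 * B * (\<Psi> n \<omega> * D m n \<omega>)\<bar>))" for m \<omega>
    by (rule bdd_aboveI[of _ 1]) auto
  have R_ge: "min 1 \<bar>2 * B * (\<Psi> n \<omega> * D m n \<omega>)\<bar> \<le> R m \<omega>" for m n \<omega>
    unfolding R_def by (rule cSUP_upper[OF UNIV_I bddR])
  have R_le: "R m \<omega> \<le> c" if "\<And>n. min 1 \<bar>2 * B * (\<Psi> n \<omega> * D m n \<omega>)\<bar> \<le> c" for m \<omega> c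
    unfolding R_def by (rule cSUP_least) (use that in auto)
  have Rm[measurable]: "R m \<in> borel_measurable M" for m
    unfolding R_def[abs_def] by (rule borel_measurable_cSUP) (use bddR in auto)
  have R0: "0 \<le> R m \<omega>" for m \<omega> by (rule order_trans[OF _ R_ge[of 0]]) auto
  have R1: "R m \<omega> \<le> 1" for m \<omega> by (rule R_le) auto
  have R_lim: "(\<lambda>m. \<integral>\<omega>. R m \<omega> \<partial>M) \<longlonglongrightarrow> (\<integral>\<omega>. 0 \<partial>M)"
  proof (rule integral_dominated_convergence[where w="\<lambda>_. 1"])
    show "AE \<omega> in M. (\<lambda>m. R m \<omega>) \<longlonglongrightarrow> 0"
      using ui' Dmono D0 AE_space
    proof eventually_elim
      fix \<omega> assume u: "\<forall>\<eta>>0. \<exists>m. \<forall>n. \<Psi> n \<omega> * D m n \<omega> \<le> \<eta>"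
        and dm: "\<forall>m m' n. m \<le> m' \<longrightarrow> D m' n \<omega> \<le> D m n \<omega>" and d0: "\<forall>m n. 0 \<le> D m n \<omega>" and \<omega>: "\<omega> \<in> space M"
      have P: "0 \<le> \<Psi> n \<omega>" "\<Psi> n \<omega> \<le> 1" for n using \<Psi>01[OF \<omega>, of n] by auto
      show "(\<lambda>m. R m \<omega>) \<longlonglongrightarrow> 0"
      proof (rule LIMSEQ_I)
        fix e :: real assume e: "0 < e"
        then have "0 < e / (4 * B)" using B1 by simp
        then obtain m where m: "\<forall>n. \<Psi> n \<omega> * D m n \<omega> \<le> e / (4 * B)" using u by blast
        have "norm (R m' \<omega> - 0) < e" if "m \<le> m'" for m'
        proof -
          have "R m' \<omega> \<le> e / 2"
          proof (rule R_le)
            fix n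
            have "\<Psi> n \<omega> * D m' n \<omega> \<le> \<Psi> n \<omega> * D m n \<omega>" by (rule mult_left_mono) (use dm that P in auto)
            then have "\<Psi> n \<omega> * D m' n \<omega> \<le> e / (4 * B)" using m order_trans by blast
            moreover have "0 \<le> \<Psi> n \<omega> * D m' n \<omega>" using P d0 by simp
            ultimately have "2 * B * (\<Psi> n \<omega> * D m' n \<omega>) \<le> e / 2" "0 \<le> 2 * B * (\<Psi> n \<omega> * D m' n \<omega>)"
              using B1 by (simp_all add: field_simps)
            then have "\<bar>2 * B * (\<Psi> n \<omega> * D m' n \<omega>)\<bar> \<le> e / 2" by linarith
            then show "min 1 \<bar>2 * B * (\<Psi> n \<omega> * D m' n \<omega>)\<bar> \<le> e / 2" by simp
          qed
          then show ?thesis using R0[of m' \<omega>] e by simp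
        qed
        then show "\<exists>no. \<forall>n\<ge>no. norm (R n \<omega> - 0) < e" by blast
      qed
    qed
  qed (use R0 R1 in auto)
  have eQ_diff: "(\<integral>\<omega>. min 1 \<bar>e n \<omega> - eQ m n \<omega>\<bar> \<partial>M) \<le> (\<integral>\<omega>. R m \<omega> \<partial>M) + 2 * (\<integral>\<omega>. min 1 \<bar>\<Psi> n \<omega> - 1\<bar> \<partial>M)" for n m
  proof -
    have pw: "\<bar>X n \<omega> * Y \<omega> - QM m n \<omega>\<bar> \<le> B * h m (X n \<omega>)" if "\<omega> \<in> space M" for \<omega>
    proof -
      have "\<bar>X n \<omega> * Y \<omega> - QM m n \<omega>\<bar> = \<bar>Y \<omega>\<bar> * \<bar>X n \<omega> - trunc (real m) (X n \<omega>)\<bar>"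
        unfolding QM_def abs_mult[symmetric] by (simp add: algebra_simps)
      also have "\<dots> \<le> B * h m (X n \<omega>)"
        unfolding abs_diff_trunc[OF of_nat_0_le_iff] h_def by (intro mult_right_mono B that) auto
      finally show ?thesis .
    qed
    have le: "X n \<omega> * Y \<omega> \<le> 1 * QM m n \<omega> + B * h m (X n \<omega>)" "QM m n \<omega> \<le> 1 * (X n \<omega> * Y \<omega>) + B * h m (X n \<omega>)"
      if "\<omega> \<in> space M" for \<omega> using pw[OF that] by (auto simp: abs_le_iff)
    have "AE \<omega> in M. e n \<omega> \<le> EM (\<lambda>\<omega>. 1 * QM m n \<omega> + B * h m (X n \<omega>)) \<omega>"
      unfolding e_def
      by (rule base.cond_expect_mono[OF bXY bounded_rv_add[OF bounded_rv_cmult[OF bQM] bounded_rv_cmult[OF bh]]])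
         (use le(1) in auto)
    moreover have "AE \<omega> in M. EM (\<lambda>\<omega>. 1 * QM m n \<omega> + B * h m (X n \<omega>)) \<omega> = 1 * eQ m n \<omega> + B * D m n \<omega>"
      unfolding eQ_def D_def by (rule base.cond_expect_lin[OF bQM bh])
    moreover have "AE \<omega> in M. eQ m n \<omega> \<le> EM (\<lambda>\<omega>. 1 * (X n \<omega> * Y \<omega>) + B * h m (X n \<omega>)) \<omega>"
      unfolding eQ_def
      by (rule base.cond_expect_mono[OF bQM bounded_rv_add[OF bounded_rv_cmult[OF bXY] bounded_rv_cmult[OF bh]]])
         (use le(2) in auto)
    moreover have "AE \<omega> in M. EM (\<lambda>\<omega>. 1 * (X n \<omega> * Y \<omega>) + B * h m (X n \<omega>)) \<omega> = 1 * e n \<omega> + B * D m n \<omega>"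
      unfolding e_def D_def by (rule base.cond_expect_lin[OF bXY bh])
    ultimately have "AE \<omega> in M. \<bar>e n \<omega> - eQ m n \<omega>\<bar> \<le> B * D m n \<omega>"
      by eventually_elim (auto simp: abs_le_iff)
    then have "AE \<omega> in M. min 1 \<bar>e n \<omega> - eQ m n \<omega>\<bar> \<le> R m \<omega> + 2 * min 1 \<bar>\<Psi> n \<omega> - 1\<bar>"
      using D0 AE_space
    proof eventually_elim
      fix \<omega> assume a: "\<bar>e n \<omega> - eQ m n \<omega>\<bar> \<le> B * D m n \<omega>" and d: "\<forall>m n. 0 \<le> D m n \<omega>" and \<omega>: "\<omega> \<in> space M"
      have P: "0 \<le> \<Psi> n \<omega>" "\<Psi> n \<omega> \<le> 1" using \<Psi>01[OF \<omega>, of n] by auto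
      show "min 1 \<bar>e n \<omega> - eQ m n \<omega>\<bar> \<le> R m \<omega> + 2 * min 1 \<bar>\<Psi> n \<omega> - 1\<bar>"
      proof (cases "1 / 2 \<le> \<Psi> n \<omega>")
        case True
        have "1 * (B * D m n \<omega>) \<le> (2 * \<Psi> n \<omega>) * (B * D m n \<omega>)"
          by (rule mult_right_mono) (use True B1 d in auto)
        then have "\<bar>e n \<omega> - eQ m n \<omega>\<bar> \<le> \<bar>2 * B * (\<Psi> n \<omega> * D m n \<omega>)\<bar>" using a by (simp add: algebra_simps)
        then have "min 1 \<bar>e n \<omega> - eQ m n \<omega>\<bar> \<le> R m \<omega>" using R_ge[of n \<omega> m] by linarith
        then show ?thesis by (simp add: add_increasing2)
      next
        case False
        then have "1 \<le> 2 * min 1 \<bar>\<Psi> n \<omega> - 1\<bar>" using P by (simp add: min_def)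
        then show ?thesis using R0[of m \<omega>] by linarith
      qed
    qed
    then have "(\<integral>\<omega>. min 1 \<bar>e n \<omega> - eQ m n \<omega>\<bar> \<partial>M) \<le> (\<integral>\<omega>. R m \<omega> + 2 * min 1 \<bar>\<Psi> n \<omega> - 1\<bar> \<partial>M)"
      by (intro integral_mono_AE M.bounded_rv_integrable M.bounded_rv_min1 bounded_rv_add bounded_rv_cmult
          bounded_rvI[of "R m" M 1]) (use R0 R1 in auto)
    also have "\<dots> = (\<integral>\<omega>. R m \<omega> \<partial>M) + 2 * (\<integral>\<omega>. min 1 \<bar>\<Psi> n \<omega> - 1\<bar> \<partial>M)"
      by (subst Bochner_Integration.integral_add)
         (auto intro!: M.bounded_rv_integrable M.bounded_rv_min1 bounded_rv_cmult
          bounded_rvI[of "R m" M 1] simp: R0 R1)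
    finally show ?thesis .
  qed
  have "(\<lambda>n. \<integral>\<omega>. min 1 \<bar>e n \<omega> - eW \<omega>\<bar> \<partial>M) \<longlonglongrightarrow> 0"
  proof (rule LIMSEQ_I)
    fix \<eta> :: real assume \<eta>: "0 < \<eta>"
    have "\<forall>\<^sub>F m in sequentially. (\<integral>\<omega>. R m \<omega> \<partial>M) < \<eta> / 4"
      by (rule order_tendstoD(2)[OF R_lim]) (use \<eta> in auto)
    moreover have "\<forall>\<^sub>F m in sequentially. (\<integral>\<omega>. min 1 \<bar>eQ' m \<omega> - eW \<omega>\<bar> \<partial>M) < \<eta> / 4"
      by (rule order_tendstoD(2)[OF eQ'_lim]) (use \<eta> in auto)
    ultimately have "\<forall>\<^sub>F m in sequentially. (\<integral>\<omega>. R m \<omega> \<partial>M) < \<eta> / 4 \<and> (\<integral>\<omega>. min 1 \<bar>eQ' m \<omega> - eW \<omega>\<bar> \<partial>M) < \<eta> / 4"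
      by (rule eventually_conj)
    then obtain m where m: "(\<integral>\<omega>. R m \<omega> \<partial>M) < \<eta> / 4" "(\<integral>\<omega>. min 1 \<bar>eQ' m \<omega> - eW \<omega>\<bar> \<partial>M) < \<eta> / 4"
      by (auto simp: eventually_sequentially)
    have "(\<lambda>n. \<integral>\<omega>. min 1 \<bar>\<Psi> n \<omega> - 1\<bar> \<partial>M) \<longlonglongrightarrow> 0"
      using \<Psi>1 by (simp add: M.tendsto_in_prob_iff_integral)
    then have "\<forall>\<^sub>F n in sequentially. (\<integral>\<omega>. min 1 \<bar>\<Psi> n \<omega> - 1\<bar> \<partial>M) < \<eta> / 8"
      by (rule order_tendstoD(2)) (use \<eta> in auto)
    moreover have "\<forall>\<^sub>F n in sequentially. (\<integral>\<omega>. min 1 \<bar>eQ m n \<omega> - eQ' m \<omega>\<bar> \<partial>M) < \<eta> / 4"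
      by (rule order_tendstoD(2)[OF eQ_lim]) (use \<eta> in auto)
    ultimately have "\<forall>\<^sub>F n in sequentially. norm ((\<integral>\<omega>. min 1 \<bar>e n \<omega> - eW \<omega>\<bar> \<partial>M) - 0) < \<eta>"
    proof eventually_elim
      fix n assume n: "(\<integral>\<omega>. min 1 \<bar>\<Psi> n \<omega> - 1\<bar> \<partial>M) < \<eta> / 8" "(\<integral>\<omega>. min 1 \<bar>eQ m n \<omega> - eQ' m \<omega>\<bar> \<partial>M) < \<eta> / 4"
      have "(\<integral>\<omega>. min 1 \<bar>e n \<omega> - eW \<omega>\<bar> \<partial>M) < \<eta>"
        using M.integral_min1_triangle[OF mm(1)[of n] mm(2)[of m n] mm(4)]
          M.integral_min1_triangle[OF mm(2)[of m n] mm(3)[of m] mm(4)] eQ_diff[of n m] n m by linarith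
      then show "norm ((\<integral>\<omega>. min 1 \<bar>e n \<omega> - eW \<omega>\<bar> \<partial>M) - 0) < \<eta>" by (simp add: abs_of_nonneg)
    qed
    then show "\<exists>no. \<forall>n\<ge>no. norm ((\<integral>\<omega>. min 1 \<bar>e n \<omega> - eW \<omega>\<bar> \<partial>M) - 0) < \<eta>"
      by (auto simp: eventually_sequentially)
  qed
  then have "tendsto_in_prob M e eW sequentially" by (simp add: M.tendsto_in_prob_iff_integral)
  then show "tendsto_in_prob M (\<lambda>n. EM (\<lambda>\<omega>. X n \<omega> * Y \<omega>)) (E (\<lambda>w. X' w * Y (\<pi> w))) sequentially"
    unfolding e_def[abs_def] eW_def W_def[abs_def] .
qed

end

section \<open>Interpolation of functions vanishing at infinity\<close>

text \<open>The functions \<open>\<phi> i\<close> are meant to be a partition of unity from which the part near infinity has been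
  left out. The error estimate holds for all paths \<open>z\<close> simultaneously, so that the interpolation can
  be applied to random paths.\<close>

definition interpolation_system ::
  "real \<Rightarrow> real \<Rightarrow> nat \<Rightarrow> (nat \<Rightarrow> 'n) \<Rightarrow> (nat \<Rightarrow> ('n::euclidean_space \<Rightarrow>\<^sub>C real)) \<Rightarrow> bool" where
  "interpolation_system R \<delta> k U \<phi> \<longleftrightarrow> (\<forall>(z :: 'n \<Rightarrow>\<^sub>C real) a b. 0 \<le> a \<longrightarrow> 0 \<le> b \<longrightarrow>
    (\<forall>u v. norm u < R + \<delta> \<longrightarrow> norm v < R + \<delta> \<longrightarrow> dist u v < \<delta> \<longrightarrow> \<bar>apply_bcontfun z u - apply_bcontfun z v\<bar> \<le> a) \<longrightarrow>
    (\<forall>u. R \<le> norm u \<longrightarrow> \<bar>apply_bcontfun z u\<bar> \<le> b) \<longrightarrow>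
    norm ((\<Sum>i<k. apply_bcontfun z (U i) *\<^sub>R \<phi> i) - z) \<le> max a b)"

text \<open>Finitely many balls of radius \<open>\<delta>\<close> with centres \<open>U i\<close> cover the ball of radius \<open>R\<close>. The tent functions
  \<open>\<psi> i\<close> on these balls together with \<open>out\<close>, which lives outside the large ball, have a positive sum \<open>s\<close>;
  dividing by it gives a partition of unity. Where \<open>\<psi> i\<close> is positive, \<open>z\<close> differs little from \<open>z (U i)\<close>,
  and where \<open>out\<close> is positive, \<open>z\<close> is small.\<close>

lemma interpolation_exists:
  fixes R \<delta> :: real
  assumes \<delta>: "0 < \<delta>" and R: "0 \<le> R"
  shows "\<exists>k U (\<phi> :: nat \<Rightarrow> ('n::euclidean_space \<Rightarrow>\<^sub>C real)). interpolation_system R \<delta> k U \<phi>"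
proof -
  obtain S where S: "S \<subseteq> cball (0::'n) R" "finite S" "cball 0 R \<subseteq> (\<Union>c\<in>S. ball c \<delta>)"
    by (rule compactE_image[of "cball (0::'n) R" "cball 0 R" "\<lambda>c. ball c \<delta>"]) (use \<delta> in auto)
  obtain U where U: "bij_betw U {0..<card S} S" using ex_bij_betw_nat_finite[OF S(2)] by blast
  define k where "k = card S"
  have US: "U ` {..<k} = S" using bij_betw_imp_surj_on[OF U] by (simp add: k_def atLeast0LessThan)
  have cov: "\<exists>i<k. dist u (U i) < \<delta>" if "norm u \<le> R" for u
  proof -
    have "u \<in> cball 0 R" using that by simp
    then obtain c where "c \<in> S" "u \<in> ball c \<delta>" using S(3) by blast
    then show ?thesis using US by (auto simp: dist_commute)
  qed
  have UR: "norm (U i) \<le> R" if "i < k" for i using that US S(1) by fastforce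
  define \<psi> where "\<psi> i u = max 0 (\<delta> - dist u (U i))" for i u
  define out :: "'n \<Rightarrow> real" where "out u = max 0 (norm u - R)" for u
  define s where "s u = (\<Sum>i<k. \<psi> i u) + out u" for u
  have \<psi>0: "0 \<le> \<psi> i u" "0 \<le> out u" for i u by (auto simp: \<psi>_def out_def)
  have s0: "0 < s u" for u
  proof (cases "norm u \<le> R")
    case True
    then obtain i where i: "i < k" "dist u (U i) < \<delta>" using cov by blast
    have "0 < \<psi> i u" using i by (simp add: \<psi>_def)
    also have "\<psi> i u \<le> (\<Sum>i<k. \<psi> i u)" by (rule member_le_sum) (use i \<psi>0 in auto)
    finally show ?thesis using \<psi>0(2)[of u] by (simp add: s_def)
  next
    case False
    then have "0 < out u" by (simp add: out_def)
    moreover have "0 \<le> (\<Sum>i<k. \<psi> i u)" by (intro sum_nonneg \<psi>0)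
    ultimately show ?thesis by (simp add: s_def)
  qed
  have \<psi>s: "\<psi> i u \<le> s u" if "i < k" for i u
    using member_le_sum[of i "{..<k}" "\<lambda>i. \<psi> i u"] that \<psi>0 by (simp add: s_def add_increasing2)
  have c\<psi>: "continuous_on UNIV (\<psi> i)" for i unfolding \<psi>_def by (intro continuous_intros)
  have cs: "continuous_on UNIV s" unfolding s_def out_def by (intro continuous_intros c\<psi>)
  define f where "f i u = (if i < k then \<psi> i u / s u else 0)" for i u
  have fb: "f i \<in> bcontfun" for i
  proof (rule bcontfun_normI[where b=1])
    show "continuous_on UNIV (f i)"
      using s0 unfolding f_def by (cases "i < k") (auto intro!: continuous_intros c\<psi> cs simp: less_imp_neq[THEN not_sym])
    show "norm (f i u) \<le> 1" for u
      using \<psi>s[of i u] s0[of u] \<psi>0 by (simp add: f_def)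
  qed
  define \<phi> where "\<phi> i = Bcontfun (f i)" for i
  have \<phi>: "apply_bcontfun (\<phi> i) u = \<psi> i u / s u" if "i < k" for i u
    using that by (simp add: \<phi>_def Bcontfun_inverse[OF fb] f_def)
  show ?thesis
    unfolding interpolation_system_def
  proof (intro exI allI impI)
    fix z :: "'n \<Rightarrow>\<^sub>C real" and a b :: real
    assume a: "0 \<le> a" and b: "0 \<le> b"
      and md: "\<forall>u v. norm u < R + \<delta> \<longrightarrow> norm v < R + \<delta> \<longrightarrow> dist u v < \<delta> \<longrightarrow> \<bar>apply_bcontfun z u - apply_bcontfun z v\<bar> \<le> a"
      and tl: "\<forall>u. R \<le> norm u \<longrightarrow> \<bar>apply_bcontfun z u\<bar> \<le> b"
    let ?P = "\<Sum>i<k. apply_bcontfun z (U i) *\<^sub>R \<phi> i"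
    show "norm (?P - z) \<le> max a b"
    proof (rule norm_bound)
      fix u
      have ap: "apply_bcontfun (\<Sum>i\<in>I. g i) u = (\<Sum>i\<in>I. apply_bcontfun (g i) u)"
        for I :: "nat set" and g :: "nat \<Rightarrow> ('n \<Rightarrow>\<^sub>C real)"
        by (induction I rule: infinite_finite_induct) auto
      have "apply_bcontfun (?P - z) u = (\<Sum>i<k. apply_bcontfun z (U i) * (\<psi> i u / s u)) - apply_bcontfun z u"
        by (simp add: ap \<phi>)
      also have "\<dots> = ((\<Sum>i<k. apply_bcontfun z (U i) * \<psi> i u) - s u * apply_bcontfun z u) / s u"
        using s0[of u] by (simp add: sum_divide_distrib field_simps)
      also have "(\<Sum>i<k. apply_bcontfun z (U i) * \<psi> i u) - s u * apply_bcontfun z u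
          = (\<Sum>i<k. (apply_bcontfun z (U i) - apply_bcontfun z u) * \<psi> i u) - out u * apply_bcontfun z u"
        by (simp add: s_def algebra_simps sum_subtractf sum_distrib_left)
      finally have eq: "apply_bcontfun (?P - z) u
          = ((\<Sum>i<k. (apply_bcontfun z (U i) - apply_bcontfun z u) * \<psi> i u) - out u * apply_bcontfun z u) / s u" .
      have t: "\<bar>(apply_bcontfun z (U i) - apply_bcontfun z u) * \<psi> i u\<bar> \<le> max a b * \<psi> i u" if i: "i < k" for i
      proof (cases "dist u (U i) < \<delta>")
        case True
        have "norm u \<le> norm (U i) + dist u (U i)" by (metis add.commute dist_norm norm_triangle_sub)
        then have "norm u < R + \<delta>" using UR[OF i] True by linarith
        moreover have "norm (U i) < R + \<delta>" using UR[OF i] \<delta> by linarith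
        ultimately have "\<bar>apply_bcontfun z (U i) - apply_bcontfun z u\<bar> \<le> a" using md True by (auto simp: dist_commute)
        then have "\<bar>apply_bcontfun z (U i) - apply_bcontfun z u\<bar> \<le> max a b" by simp
        then show ?thesis using mult_right_mono[OF _ \<psi>0(1)[of i u]] by (simp add: abs_mult \<psi>0)
      next
        case False
        then have "\<psi> i u = 0" by (simp add: \<psi>_def)
        then show ?thesis by simp
      qed
      have t2: "\<bar>out u * apply_bcontfun z u\<bar> \<le> max a b * out u"
      proof (cases "R \<le> norm u")
        case True
        then have "\<bar>apply_bcontfun z u\<bar> \<le> max a b" using tl by (simp add: le_max_iff_disj)
        then show ?thesis using mult_right_mono[of "\<bar>apply_bcontfun z u\<bar>" "max a b" "out u"] \<psi>0(2)[of u]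
          by (simp only: abs_mult abs_of_nonneg mult.commute[of "out u"])
      next
        case False
        then have "out u = 0" by (simp add: out_def)
        then show ?thesis by simp
      qed
      have "\<bar>(\<Sum>i<k. (apply_bcontfun z (U i) - apply_bcontfun z u) * \<psi> i u) - out u * apply_bcontfun z u\<bar>
          \<le> (\<Sum>i<k. max a b * \<psi> i u) + max a b * out u"
        by (rule order_trans[OF abs_triangle_ineq4], intro add_mono t2 order_trans[OF sum_abs] sum_mono t) auto
      also have "\<dots> = max a b * s u" by (simp add: s_def algebra_simps sum_distrib_left)
      finally show "norm (apply_bcontfun (?P - z) u) \<le> max a b"
        unfolding eq using s0[of u] by (simp add: field_simps)
    qed
  qed
qed

definition interpolation :: "real \<Rightarrow> real \<Rightarrow> nat \<times> (nat \<Rightarrow> 'n) \<times> (nat \<Rightarrow> ('n::euclidean_space \<Rightarrow>\<^sub>C real))" where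
  "interpolation R \<delta> = (SOME (k, U, \<phi>). interpolation_system R \<delta> k U \<phi>)"

definition interpolate :: "real \<Rightarrow> real \<Rightarrow> ('n::euclidean_space \<Rightarrow>\<^sub>C real) \<Rightarrow> ('n \<Rightarrow>\<^sub>C real)" where
  "interpolate R \<delta> z = (case interpolation R \<delta> of (k, U, \<phi>) \<Rightarrow> \<Sum>i<k. apply_bcontfun z (U i) *\<^sub>R \<phi> i)"

lemma interpolate_error:
  fixes z :: "'n::euclidean_space \<Rightarrow>\<^sub>C real"
  assumes "0 < \<delta>" "0 \<le> R" "0 \<le> a" "0 \<le> b"
    and "\<And>u v. norm u < R + \<delta> \<Longrightarrow> norm v < R + \<delta> \<Longrightarrow> dist u v < \<delta> \<Longrightarrow> \<bar>apply_bcontfun z u - apply_bcontfun z v\<bar> \<le> a"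
    and "\<And>u. R \<le> norm u \<Longrightarrow> \<bar>apply_bcontfun z u\<bar> \<le> b"
  shows "norm (interpolate R \<delta> z - z) \<le> max a b"
proof -
  obtain k U and \<phi> :: "nat \<Rightarrow> ('n \<Rightarrow>\<^sub>C real)" where eq: "interpolation R \<delta> = (k, U, \<phi>)"
    by (metis prod_cases3)
  have "\<exists>x :: nat \<times> (nat \<Rightarrow> 'n) \<times> (nat \<Rightarrow> ('n \<Rightarrow>\<^sub>C real)). case x of (k, U, \<phi>) \<Rightarrow> interpolation_system R \<delta> k U \<phi>"
    using interpolation_exists[OF assms(1,2), where ?'n='n] by (simp add: split_paired_Ex)
  from someI_ex[OF this] have "interpolation_system R \<delta> k U \<phi>"
    unfolding interpolation_def[symmetric] eq by simp
  then show ?thesis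
    using assms(3-6) unfolding interpolation_system_def interpolate_def eq by simp
qed

lemma C_hat_tail:
  assumes "z \<in> C_hat" "0 < e"
  shows "\<exists>R>0. \<forall>u. R \<le> norm u \<longrightarrow> \<bar>apply_bcontfun z u\<bar> \<le> e"
proof -
  have "eventually (\<lambda>u. dist (apply_bcontfun z u) 0 < e) at_infinity"
    using assms by (auto simp: C_hat_def dest: tendstoD)
  then obtain b where "\<forall>u. b \<le> norm u \<longrightarrow> dist (apply_bcontfun z u) 0 < e" by (auto simp: eventually_at_infinity)
  then show ?thesis by (intro exI[of _ "max b 1"]) (auto intro: less_imp_le)
qed

text \<open>Points closer than \<open>1\<close> lie both in a large ball, where uniform continuity applies, or both far out,
  where \<open>z\<close> is small.\<close>

lemma C_hat_modulus:
  assumes z: "z \<in> C_hat" and e: "0 < e"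
  shows "\<exists>\<delta>>0. \<forall>u v. dist u v < \<delta> \<longrightarrow> \<bar>apply_bcontfun z u - apply_bcontfun z v\<bar> \<le> e"
proof -
  obtain R where R: "\<forall>u. R \<le> norm u \<longrightarrow> \<bar>apply_bcontfun z u\<bar> \<le> e / 2" using C_hat_tail[OF z, of "e/2"] e by auto
  have "uniformly_continuous_on (cball 0 (R + 1)) (apply_bcontfun z)"
    by (rule compact_uniformly_continuous) auto
  then obtain d where d: "0 < d" "\<And>u v. u \<in> cball 0 (R + 1) \<Longrightarrow> v \<in> cball 0 (R + 1) \<Longrightarrow> dist v u < d \<Longrightarrow>
      dist (apply_bcontfun z v) (apply_bcontfun z u) < e"
    using e unfolding uniformly_continuous_on_def by metis
  show ?thesis
  proof (intro exI conjI allI impI)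
    show "0 < min d 1" using d by simp
    fix u v :: 'a assume uv: "dist u v < min d 1"
    have n: "norm u \<le> norm v + dist u v" "norm v \<le> norm u + dist u v"
      by (metis add.commute dist_norm norm_triangle_sub) (metis add.commute dist_commute dist_norm norm_triangle_sub)
    show "\<bar>apply_bcontfun z u - apply_bcontfun z v\<bar> \<le> e"
    proof (cases "R \<le> norm u \<and> R \<le> norm v")
      case True
      then have "\<bar>apply_bcontfun z u\<bar> \<le> e / 2" "\<bar>apply_bcontfun z v\<bar> \<le> e / 2" using R by auto
      then show ?thesis by linarith
    next
      case False
      then have "norm u \<le> R + 1" "norm v \<le> R + 1" using n uv by auto
      then have "dist (apply_bcontfun z u) (apply_bcontfun z v) < e" using d(2)[of v u] uv by simp
      then show ?thesis by (simp add: dist_real_def)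
    qed
  qed
qed

lemma interpolate_tendsto:
  fixes z :: "'n::euclidean_space \<Rightarrow>\<^sub>C real"
  assumes z: "z \<in> C_hat" and R: "filterlim R at_top sequentially" and \<delta>: "\<delta> \<longlonglongrightarrow> 0"
    and R0: "\<And>k. 0 \<le> R k" and \<delta>0: "\<And>k. 0 < \<delta> k"
  shows "(\<lambda>k. interpolate (R k) (\<delta> k) z) \<longlonglongrightarrow> z"
proof (rule tendstoI)
  fix e :: real assume e: "0 < e"
  obtain r where r: "\<forall>u. r \<le> norm u \<longrightarrow> \<bar>apply_bcontfun z u\<bar> \<le> e / 2" using C_hat_tail[OF z, of "e/2"] e by auto
  obtain d where d: "0 < d" "\<forall>u v. dist u v < d \<longrightarrow> \<bar>apply_bcontfun z u - apply_bcontfun z v\<bar> \<le> e / 2"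
    using C_hat_modulus[OF z, of "e/2"] e by auto
  have "eventually (\<lambda>k. r \<le> R k) sequentially" using R by (auto simp: filterlim_at_top)
  moreover have "eventually (\<lambda>k. \<delta> k < d) sequentially" by (rule order_tendstoD(2)[OF \<delta> d(1)])
  ultimately show "eventually (\<lambda>k. dist (interpolate (R k) (\<delta> k) z) z < e) sequentially"
  proof eventually_elim
    fix k assume k: "r \<le> R k" "\<delta> k < d"
    have "norm (interpolate (R k) (\<delta> k) z - z) \<le> max (e/2) (e/2)"
      by (rule interpolate_error[OF \<delta>0 R0]) (use e r d k in auto)
    then show "dist (interpolate (R k) (\<delta> k) z) z < e" using e by (simp add: dist_norm)
  qed
qed

section \<open>Lipschitz majorants of functionals of a path\<close>

lemma SUP_diff_le:
  fixes f g :: "'x \<Rightarrow> real"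
  assumes S: "S \<noteq> {}" and bg: "bdd_above (g ` S)"
    and le: "\<And>x. x \<in> S \<Longrightarrow> f x \<le> g x + d"
  shows "(SUP x\<in>S. f x) \<le> (SUP x\<in>S. g x) + d"
  by (rule cSUP_least[OF S]) (use le cSUP_upper[OF _ bg] in \<open>force intro: order_trans\<close>)

lemma bdd_above_bcontfun: "bdd_above (apply_bcontfun (z :: 'n::euclidean_space \<Rightarrow>\<^sub>C real) ` S)"
  by (rule bdd_aboveI[of _ "norm z"]) (auto intro: order_trans[OF abs_ge_self] norm_bounded[of z, simplified])

text \<open>The sup-convolution \<open>sup_y (F y - k d(z, y))\<close> over \<open>S\<close> is \<open>k\<close>-Lipschitz, dominates \<open>F\<close> on \<open>S\<close>, and
  tends to \<open>F z\<close> at points of continuity, because only \<open>y\<close> with \<open>k d(z, y) \<le> 2 K\<close> matter. Far from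
  \<open>S\<close> it can be very negative, hence the truncation.\<close>

lemma lipschitz_sup_convolution:
  fixes F :: "'m::metric_space \<Rightarrow> real"
  assumes S: "S \<noteq> {}" and K: "\<forall>y\<in>S. \<bar>F y\<bar> \<le> K"
  shows "\<exists>A :: nat \<Rightarrow> 'm \<Rightarrow> real. (\<forall>k z z'. \<bar>A k z - A k z'\<bar> \<le> real k * dist z z') \<and> (\<forall>k z. \<bar>A k z\<bar> \<le> K) \<and>
    (\<forall>k. \<forall>z\<in>S. F z \<le> A k z) \<and>
    (\<forall>z\<in>S. continuous (at z within S) F \<longrightarrow> (\<lambda>k. A k z) \<longlonglongrightarrow> F z)"
proof -
  note bF = K[rule_format]
  obtain y0 where y0: "y0 \<in> S" using S by blast
  have K0: "0 \<le> K" using bF[OF y0] by linarith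
  define B where "B k z = (SUP y\<in>S. F y - real k * dist z y)" for k z
  define A where "A k z = trunc K (B k z)" for k z
  have bd: "bdd_above ((\<lambda>y. F y - real k * dist z y) ` S)" for k z
  proof (rule bdd_aboveI2)
    fix y assume "y \<in> S"
    then have "F y \<le> K" using bF[of y] by (simp add: abs_le_iff)
    moreover have "0 \<le> real k * dist z y" by simp
    ultimately show "F y - real k * dist z y \<le> K" by linarith
  qed
  have B1: "B k z \<le> B k z' + real k * dist z z'" for k z z'
    unfolding B_def
  proof (rule SUP_diff_le[OF S bd])
    fix y assume "y \<in> S"
    have "real k * dist z' y \<le> real k * (dist z z' + dist z y)"
      by (rule mult_left_mono) (use dist_triangle3[of z' y z] in \<open>auto simp: dist_commute\<close>)
    then show "F y - real k * dist z y \<le> F y - real k * dist z' y + real k * dist z z'" by (simp add: algebra_simps)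
  qed
  have A1: "\<bar>A k z - A k z'\<bar> \<le> real k * dist z z'" for k z z'
  proof -
    have "\<bar>trunc K a - trunc K b\<bar> \<le> \<bar>a - b\<bar>" for a b :: real by (auto simp: trunc_def)
    moreover have "\<bar>B k z - B k z'\<bar> \<le> real k * dist z z'"
      using B1[of k z z'] B1[of k z' z] by (auto simp: abs_le_iff dist_commute)
    ultimately show ?thesis unfolding A_def using order_trans by blast
  qed
  have Bge: "F z \<le> B k z" if "z \<in> S" for k z
    unfolding B_def using cSUP_upper[OF that bd, of k z] by simp
  have A3: "F z \<le> A k z" if "z \<in> S" for k z
    using Bge[OF that, of k] bF[OF that] by (auto simp: A_def trunc_def)
  have A4: "(\<lambda>k. A k z) \<longlonglongrightarrow> F z" if z: "z \<in> S" and c: "continuous (at z within S) F" for z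
  proof (rule LIMSEQ_I)
    fix e :: real assume e: "0 < e"
    then obtain d where d: "0 < d" "\<And>y. y \<in> S \<Longrightarrow> dist y z < d \<Longrightarrow> dist (F y) (F z) < e / 2"
      using c unfolding continuous_within_eps_delta by (meson half_gt_zero)
    obtain k0 :: nat where k0: "2 * K / d \<le> real k0" using real_arch_simple by blast
    have "norm (A k z - F z) < e" if k: "k0 \<le> k" for k
    proof -
      have "B k z \<le> F z + e / 2" unfolding B_def
      proof (rule cSUP_least[OF S])
        fix y assume y: "y \<in> S"
        show "F y - real k * dist z y \<le> F z + e / 2"
        proof (cases "dist y z < d")
          case True
          then have "\<bar>F y - F z\<bar> < e / 2" using d(2)[OF y True] by (simp only: dist_real_def)
          moreover have "0 \<le> real k * dist z y" by simp
          ultimately show ?thesis by linarith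
        next
          case False
          have "2 * K / d * d \<le> real k * dist z y"
            by (rule mult_mono) (use k0 k False d in \<open>auto simp: dist_commute\<close>)
          then have "2 * K \<le> real k * dist z y" using d(1) by simp
          then show ?thesis using bF[OF y] bF[OF z] e by (simp add: abs_le_iff)
        qed
      qed
      moreover have "A k z \<le> max (F z) (B k z)" using bF[OF z] by (auto simp: A_def trunc_def abs_le_iff)
      ultimately show ?thesis using A3[OF z, of k] e by (auto simp: abs_less_iff)
    qed
    then show "\<exists>no. \<forall>k\<ge>no. norm (A k z - F z) < e" by blast
  qed
  show ?thesis
    by (intro exI[of _ A] conjI allI ballI impI A1 A3 A4) (auto simp: A_def trunc_abs_le K0)
qed

text \<open>The functional is \<open>sup_u (f u + k z u) - k sup z\<close>. A unique maximizer of a path vanishing at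
  infinity with positive maximum is well separated: outside each of its neighbourhoods \<open>z\<close> stays
  below the maximum by a gap \<open>\<gamma>\<close>, and such points are irrelevant as soon as \<open>k \<gamma> \<ge> 2 K\<close>.\<close>

lemma argmax_penalization:
  fixes f :: "'n::euclidean_space \<Rightarrow> real"
  assumes f: "continuous_on UNIV f" and bf: "\<And>u. \<bar>f u\<bar> \<le> K"
  shows "\<exists>A :: nat \<Rightarrow> ('n \<Rightarrow>\<^sub>C real) \<Rightarrow> real.
    (\<forall>k z z'. \<bar>A k z - A k z'\<bar> \<le> real (2 * k) * dist z z') \<and> (\<forall>k z. \<bar>A k z\<bar> \<le> K) \<and>
    (\<forall>k z u. maximizes (apply_bcontfun z) u \<longrightarrow> f u \<le> A k z) \<and>
    (\<forall>z\<in>C_hat. \<forall>u. 0 < apply_bcontfun z u \<longrightarrow> maximizes (apply_bcontfun z) u \<longrightarrow>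
      (\<forall>v. maximizes (apply_bcontfun z) v \<longrightarrow> v = u) \<longrightarrow> (\<lambda>k. A k z) \<longlonglongrightarrow> f u)"
proof -
  define s where "s z = (SUP u. apply_bcontfun z u)" for z :: "'n \<Rightarrow>\<^sub>C real"
  define B where "B k z = (SUP u. f u + real k * apply_bcontfun z u)" for k and z :: "'n \<Rightarrow>\<^sub>C real"
  define A where "A k z = B k z - real k * s z" for k z
  have df: "apply_bcontfun z u \<le> apply_bcontfun z' u + dist z z'" for z z' :: "'n \<Rightarrow>\<^sub>C real" and u
    using dist_bounded[of z u z'] by (auto simp: dist_real_def)
  have bz: "apply_bcontfun z u \<le> s z" for z u
    unfolding s_def by (rule cSUP_upper[OF UNIV_I bdd_above_bcontfun])
  have bdB: "bdd_above (range (\<lambda>u. f u + real k * apply_bcontfun z u))" for k z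
  proof (rule bdd_aboveI2)
    show "f u + real k * apply_bcontfun z u \<le> K + real k * s z" for u
      using bf[of u] by (intro add_mono mult_left_mono bz) auto
  qed
  have s1: "s z \<le> s z' + dist z z'" for z z'
    unfolding s_def by (rule SUP_diff_le[OF _ bdd_above_bcontfun df]) simp
  have B1: "B k z \<le> B k z' + real k * dist z z'" for k z z'
    unfolding B_def
  proof (rule SUP_diff_le[OF _ bdB])
    show "f u + real k * apply_bcontfun z u \<le> f u + real k * apply_bcontfun z' u + real k * dist z z'" for u
      using mult_left_mono[OF df[of z u z'], of "real k"] by (simp add: algebra_simps)
  qed simp
  have A1: "\<bar>A k z - A k z'\<bar> \<le> real (2 * k) * dist z z'" for k z z'
  proof -
    have "\<bar>B k z - B k z'\<bar> \<le> real k * dist z z'"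
      using B1[of k z z'] B1[of k z' z] by (auto simp: abs_le_iff dist_commute)
    moreover have "\<bar>real k * s z - real k * s z'\<bar> \<le> real k * dist z z'"
    proof -
      have "\<bar>s z - s z'\<bar> \<le> dist z z'" using s1[of z z'] s1[of z' z] by (auto simp: abs_le_iff dist_commute)
      then show ?thesis unfolding right_diff_distrib[symmetric] abs_mult by (auto intro: mult_left_mono)
    qed
    ultimately show ?thesis unfolding A_def by (simp add: algebra_simps)
  qed
  have B_le: "B k z \<le> c" if "\<And>u. f u + real k * apply_bcontfun z u \<le> c" for k z c
    unfolding B_def by (rule cSUP_least) (use that in auto)
  have B_ge: "f u + real k * apply_bcontfun z u \<le> B k z" for k z u
    unfolding B_def by (rule cSUP_upper[OF UNIV_I bdB])
  have A2: "\<bar>A k z\<bar> \<le> K" for k z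
  proof -
    have "B k z \<le> K + real k * s z"
      by (rule B_le, rule add_mono[OF _ mult_left_mono[OF bz]]) (use bf in \<open>auto simp: abs_le_iff\<close>)
    moreover have "- K + real k * s z \<le> B k z"
    proof (cases "k = 0")
      case True
      then show ?thesis using B_ge[of 0 k z] bf[of 0] by (simp add: abs_le_iff)
    next
      case False
      have "s z \<le> (B k z + K) / real k" unfolding s_def
      proof (rule cSUP_least)
        fix u
        have "real k * apply_bcontfun z u \<le> B k z + K" using B_ge[of u k z] bf[of u] by (auto simp: abs_le_iff)
        then show "apply_bcontfun z u \<le> (B k z + K) / real k" using False by (simp add: field_simps)
      qed simp
      then show ?thesis using False by (simp add: field_simps)
    qed
    ultimately show ?thesis by (auto simp: A_def abs_le_iff)
  qed
  have smax: "s z = apply_bcontfun z u" if "maximizes (apply_bcontfun z) u" for z u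
    using that bz[of z u] unfolding s_def maximizes_def by (intro antisym cSUP_least) auto
  have A3: "f u \<le> A k z" if "maximizes (apply_bcontfun z) u" for k z u
    using B_ge[of u k z] smax[OF that] by (simp add: A_def)
  have A4: "(\<lambda>k. A k z) \<longlonglongrightarrow> f u"
    if z: "z \<in> C_hat" and pos: "0 < apply_bcontfun z u" and mx: "maximizes (apply_bcontfun z) u"
      and un: "\<forall>v. maximizes (apply_bcontfun z) v \<longrightarrow> v = u" for z u
  proof (rule LIMSEQ_I)
    fix e :: real assume e: "0 < e"
    have "isCont f u" using f by (simp add: continuous_on_eq_continuous_at)
    then obtain d where d: "0 < d" "\<And>v. dist v u < d \<Longrightarrow> dist (f v) (f u) < e / 2"
      using e unfolding continuous_at_eps_delta by (meson half_gt_zero)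
    obtain R where R: "0 < R" "\<forall>v. R \<le> norm v \<longrightarrow> \<bar>apply_bcontfun z v\<bar> \<le> apply_bcontfun z u / 2"
      using C_hat_tail[OF z, of "apply_bcontfun z u / 2"] pos by auto
    \<comment> \<open>The gap comes from compactness on \<open>T\<close>, and from the decay of \<open>z\<close> outside the ball of radius \<open>R\<close>.\<close>
    define T where "T = cball 0 R - ball u d"
    have T: "compact T" unfolding T_def by (intro compact_diff) auto
    have "\<exists>\<gamma>>0. \<forall>v. d \<le> dist v u \<longrightarrow> apply_bcontfun z v \<le> apply_bcontfun z u - \<gamma>"
    proof (cases "T = {}")
      case True
      have "apply_bcontfun z v \<le> apply_bcontfun z u - apply_bcontfun z u / 2" if "d \<le> dist v u" for v
      proof -
        have "v \<notin> cball 0 R" using True that by (auto simp: T_def dist_commute)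
        then have "\<bar>apply_bcontfun z v\<bar> \<le> apply_bcontfun z u / 2" using R(2) by auto
        then show ?thesis by (simp add: abs_le_iff)
      qed
      then show ?thesis using pos by (intro exI[of _ "apply_bcontfun z u / 2"]) auto
    next
      case False
      obtain t where t: "t \<in> T" "\<And>v. v \<in> T \<Longrightarrow> apply_bcontfun z v \<le> apply_bcontfun z t"
        using continuous_attains_sup[OF T False, of "apply_bcontfun z"] by auto
      have "t \<noteq> u" using t(1) d(1) by (auto simp: T_def)
      then have "\<not> maximizes (apply_bcontfun z) t" using un by blast
      then obtain v0 where "apply_bcontfun z t < apply_bcontfun z v0" by (auto simp: maximizes_def not_le)
      also have "\<dots> \<le> apply_bcontfun z u" using mx by (simp add: maximizes_def)
      finally have tu: "apply_bcontfun z t < apply_bcontfun z u" .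
      define \<gamma> where "\<gamma> = min (apply_bcontfun z u - apply_bcontfun z t) (apply_bcontfun z u / 2)"
      have "apply_bcontfun z v \<le> apply_bcontfun z u - \<gamma>" if "d \<le> dist v u" for v
      proof (cases "R \<le> norm v")
        case True
        then have "\<bar>apply_bcontfun z v\<bar> \<le> apply_bcontfun z u / 2" using R(2) by auto
        then show ?thesis by (auto simp: \<gamma>_def min_def abs_le_iff)
      next
        case False
        then have "v \<in> T" using that by (auto simp: T_def dist_commute)
        then have "apply_bcontfun z v \<le> apply_bcontfun z t" by (rule t(2))
        then show ?thesis by (auto simp: \<gamma>_def min_def)
      qed
      then show ?thesis using tu pos by (intro exI[of _ \<gamma>]) (auto simp: \<gamma>_def)
    qed
    then obtain \<gamma> where \<gamma>: "0 < \<gamma>" "\<And>v. d \<le> dist v u \<Longrightarrow> apply_bcontfun z v \<le> apply_bcontfun z u - \<gamma>" by blast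
    obtain k0 :: nat where k0: "2 * K / \<gamma> \<le> real k0" using real_arch_simple by blast
    have "norm (A k z - f u) < e" if k: "k0 \<le> k" for k
    proof -
      have "B k z \<le> f u + e / 2 + real k * s z"
      proof (rule B_le)
        fix v
        show "f v + real k * apply_bcontfun z v \<le> f u + e / 2 + real k * s z"
        proof (cases "dist v u < d")
          case True
          then have "\<bar>f v - f u\<bar> < e / 2" using d(2)[OF True] by (simp only: dist_real_def)
          moreover have "real k * apply_bcontfun z v \<le> real k * s z" by (rule mult_left_mono[OF bz]) simp
          ultimately show ?thesis by linarith
        next
          case False
          have "2 * K / \<gamma> * \<gamma> \<le> real k * \<gamma>"
            by (rule mult_right_mono) (use k0 k \<gamma> in auto)
          then have "2 * K \<le> real k * \<gamma>" using \<gamma>(1) by simp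
          moreover have "real k * apply_bcontfun z v \<le> real k * (apply_bcontfun z u - \<gamma>)"
            by (rule mult_left_mono) (use \<gamma>(2) False in auto)
          moreover have "real k * apply_bcontfun z u = real k * s z" using smax[OF mx] by simp
          ultimately show ?thesis using bf[of v] bf[of u] e by (simp add: algebra_simps abs_le_iff)
        qed
      qed
      then show ?thesis using A3[OF mx, of k] e by (auto simp: A_def abs_less_iff)
    qed
    then show "\<exists>no. \<forall>k\<ge>no. norm (A k z - f u) < e" by blast
  qed
  show ?thesis
  proof (intro exI[of _ A] conjI)
    show "\<forall>z\<in>C_hat. \<forall>u. 0 < apply_bcontfun z u \<longrightarrow> maximizes (apply_bcontfun z) u \<longrightarrow>
      (\<forall>v. maximizes (apply_bcontfun z) v \<longrightarrow> v = u) \<longrightarrow> (\<lambda>k. A k z) \<longlonglongrightarrow> f u"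
      using A4 by blast
  qed (use A1 A2 A3 in blast)+
qed

section \<open>From finite-dimensional to functional convergence\<close>

text \<open>The abstract situation for weak convergence in \<open>C_hat\<close>: convergence of the finite-dimensional
  distributions in the conditional sense, with weights \<open>\<Psi>\<close>, and unconditional tightness of tails
  and moduli. In the tightness assumptions the event \<open>A\<close> stands for an outer probability.\<close>

locale field_convergence = stable_conditioning M N \<pi> C G
  for M :: "'a measure" and N :: "'b measure" and \<pi> and C and G +
  fixes Zn :: "nat \<Rightarrow> 'a \<Rightarrow> ('n::euclidean_space \<Rightarrow>\<^sub>C real)" and Z :: "'b \<Rightarrow> ('n \<Rightarrow>\<^sub>C real)"
    and \<Psi> :: "nat \<Rightarrow> 'a \<Rightarrow> real"
  assumes Z_C_hat: "Z \<in> measurable N (restrict_space borel C_hat)"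
    and Zn_coord: "\<And>n u. (\<lambda>\<omega>. apply_bcontfun (Zn n \<omega>) u) \<in> borel_measurable M"
    and Zn_C_hat: "\<And>n \<omega>. \<omega> \<in> space M \<Longrightarrow> Zn n \<omega> \<in> C_hat"
    and \<Psi>_meas: "\<And>n. \<Psi> n \<in> borel_measurable M"
    and \<Psi>_01: "\<And>n \<omega>. \<omega> \<in> space M \<Longrightarrow> \<Psi> n \<omega> \<in> {0..1}"
    and \<Psi>_1: "tendsto_in_prob M \<Psi> (\<lambda>_. 1) sequentially"
    and fidi: "\<And>(k::nat) (u :: nat \<Rightarrow> 'n) (f :: (nat \<Rightarrow> real) \<Rightarrow> real) Y.
      continuous_map (powertop_real {..<k}) euclideanreal f \<Longrightarrow>
      bounded (f ` topspace (powertop_real {..<k})) \<Longrightarrow> bounded_rv G Y \<Longrightarrow>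
      tendsto_in_prob M
        (\<lambda>n. EM (\<lambda>\<omega>. f (\<lambda>i\<in>{..<k}. apply_bcontfun (Zn n \<omega>) (u i)) * \<Psi> n \<omega> * Y \<omega>))
        (E (\<lambda>w. f (\<lambda>i\<in>{..<k}. apply_bcontfun (Z w) (u i)) * Y (\<pi> w))) sequentially"
    and tight_tail: "\<And>e. 0 < e \<Longrightarrow> \<exists>R>0. \<forall>\<^sub>F n in sequentially. \<exists>A\<in>sets M. measure M A \<le> e \<and>
      (\<forall>\<omega>\<in>space M - A. \<forall>u. R \<le> norm u \<longrightarrow> \<bar>apply_bcontfun (Zn n \<omega>) u\<bar> \<le> e)"
    and tight_modulus: "\<And>e c. 0 < e \<Longrightarrow> 0 < c \<Longrightarrow> \<exists>\<delta>>0. \<forall>\<^sub>F n in sequentially. \<exists>A\<in>sets M. measure M A \<le> e \<and>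
      (\<forall>\<omega>\<in>space M - A. \<forall>u v. norm u < c \<longrightarrow> norm v < c \<longrightarrow> dist u v < \<delta> \<longrightarrow>
         \<bar>apply_bcontfun (Zn n \<omega>) u - apply_bcontfun (Zn n \<omega>) v\<bar> \<le> e)"
begin

lemma Z_measurable[measurable]: "Z \<in> borel_measurable N" and Z_in_C_hat: "w \<in> space N \<Longrightarrow> Z w \<in> C_hat"
  using Z_C_hat by (auto simp: measurable_restrict_space2_iff)

lemma tight_interpolation:
  assumes e: "0 < e" "e \<le> 1"
  shows "\<exists>R \<delta>. 1 / e \<le> R \<and> 0 < \<delta> \<and> \<delta> \<le> e \<and> (\<forall>\<^sub>F n in sequentially. \<exists>A\<in>sets M. measure M A \<le> 2 * e \<and>
      (\<forall>\<omega>\<in>space M - A. norm (interpolate R \<delta> (Zn n \<omega>) - Zn n \<omega>) \<le> e))"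
proof -
  obtain R0 where R0: "0 < R0" and ev1: "\<forall>\<^sub>F n in sequentially. \<exists>A\<in>sets M. measure M A \<le> e \<and>
      (\<forall>\<omega>\<in>space M - A. \<forall>u. R0 \<le> norm u \<longrightarrow> \<bar>apply_bcontfun (Zn n \<omega>) u\<bar> \<le> e)"
    using tight_tail[OF e(1)] by blast
  define R where "R = max R0 (1 / e)"
  have R: "0 < R + 1" "0 \<le> R" "R0 \<le> R" "1 / e \<le> R" using R0 by (auto simp: R_def)
  obtain \<delta>0 where \<delta>0: "0 < \<delta>0" and ev2: "\<forall>\<^sub>F n in sequentially. \<exists>A\<in>sets M. measure M A \<le> e \<and>
      (\<forall>\<omega>\<in>space M - A. \<forall>u v. norm u < R + 1 \<longrightarrow> norm v < R + 1 \<longrightarrow> dist u v < \<delta>0 \<longrightarrow>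
         \<bar>apply_bcontfun (Zn n \<omega>) u - apply_bcontfun (Zn n \<omega>) v\<bar> \<le> e)"
    using tight_modulus[OF e(1) R(1)] by blast
  define \<delta> where "\<delta> = min \<delta>0 e"
  have \<delta>: "0 < \<delta>" "\<delta> \<le> e" "\<delta> \<le> \<delta>0" "\<delta> \<le> 1" using \<delta>0 e by (auto simp: \<delta>_def)
  from ev1 ev2 have "\<forall>\<^sub>F n in sequentially. \<exists>A\<in>sets M. measure M A \<le> 2 * e \<and>
      (\<forall>\<omega>\<in>space M - A. norm (interpolate R \<delta> (Zn n \<omega>) - Zn n \<omega>) \<le> e)"
  proof eventually_elim
    fix n
    assume "\<exists>A\<in>sets M. measure M A \<le> e \<and>
      (\<forall>\<omega>\<in>space M - A. \<forall>u. R0 \<le> norm u \<longrightarrow> \<bar>apply_bcontfun (Zn n \<omega>) u\<bar> \<le> e)"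
    then obtain A where A: "A \<in> sets M" "measure M A \<le> e" "\<And>\<omega> u. \<omega> \<in> space M - A \<Longrightarrow> R0 \<le> norm u \<Longrightarrow> \<bar>apply_bcontfun (Zn n \<omega>) u\<bar> \<le> e"
      by blast
    assume "\<exists>A\<in>sets M. measure M A \<le> e \<and>
      (\<forall>\<omega>\<in>space M - A. \<forall>u v. norm u < R + 1 \<longrightarrow> norm v < R + 1 \<longrightarrow> dist u v < \<delta>0 \<longrightarrow>
         \<bar>apply_bcontfun (Zn n \<omega>) u - apply_bcontfun (Zn n \<omega>) v\<bar> \<le> e)"
    then obtain A' where A': "A' \<in> sets M" "measure M A' \<le> e"
      "\<And>\<omega> u v. \<omega> \<in> space M - A' \<Longrightarrow> norm u < R + 1 \<Longrightarrow> norm v < R + 1 \<Longrightarrow> dist u v < \<delta>0 \<Longrightarrow>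
         \<bar>apply_bcontfun (Zn n \<omega>) u - apply_bcontfun (Zn n \<omega>) v\<bar> \<le> e"
      by blast
    show "\<exists>A\<in>sets M. measure M A \<le> 2 * e \<and>
      (\<forall>\<omega>\<in>space M - A. norm (interpolate R \<delta> (Zn n \<omega>) - Zn n \<omega>) \<le> e)"
    proof (rule bexI[of _ "A \<union> A'"], intro conjI ballI)
      show "measure M (A \<union> A') \<le> 2 * e"
        using measure_Un_le[OF A(1) A'(1)] A(2) A'(2) by linarith
      fix \<omega> assume \<omega>: "\<omega> \<in> space M - (A \<union> A')"
      have "norm (interpolate R \<delta> (Zn n \<omega>) - Zn n \<omega>) \<le> max e e"
      proof (rule interpolate_error[OF \<delta>(1) R(2)])
        fix u v :: 'n assume "norm u < R + \<delta>" "norm v < R + \<delta>" "dist u v < \<delta>"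
        then show "\<bar>apply_bcontfun (Zn n \<omega>) u - apply_bcontfun (Zn n \<omega>) v\<bar> \<le> e"
          using \<omega> \<delta> by (intro A'(3)) auto
      next
        fix u :: 'n assume "R \<le> norm u"
        then show "\<bar>apply_bcontfun (Zn n \<omega>) u\<bar> \<le> e" using \<omega> R by (intro A(3)) auto
      qed (use e in auto)
      then show "norm (interpolate R \<delta> (Zn n \<omega>) - Zn n \<omega>) \<le> e" by simp
    qed (use A A' in auto)
  qed
  then show ?thesis using R \<delta> by blast
qed

text \<open>A functional of an interpolated path is a continuous function of finitely many coordinates, so it is
  measurable and the finite-dimensional hypothesis applies to it. With Lipschitz constant \<open>L\<close> and
  bound \<open>bd\<close>, an interpolation error of at most \<open>e\<close> outside an event of probability \<open>2 e\<close> costs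
  \<open>L e + 4 bd e\<close>, and the weight \<open>\<Psi>\<close> another \<open>bd e\<close>. Tightness chooses the parameters of the
  interpolation, which are forced to their limits so that it converges on every path in \<open>C_hat\<close>.
  Measurability of \<open>F\<close> of the field itself follows from the same convergence; it is not automatic,
  since bounded continuous functions do not form a separable space.\<close>

lemma lipschitz_functional:
  fixes F :: "('n \<Rightarrow>\<^sub>C real) \<Rightarrow> real"
  assumes L: "\<And>z z'. \<bar>F z - F z'\<bar> \<le> L * dist z z'" and bd: "\<And>z. \<bar>F z\<bar> \<le> bd"
  shows lipschitz_functional_measurable: "\<And>n. bounded_rv M (\<lambda>\<omega>. F (Zn n \<omega>))" "bounded_rv N (\<lambda>w. F (Z w))"
    and lipschitz_functional_conv: "cond_conv (\<lambda>n \<omega>. F (Zn n \<omega>)) (\<lambda>w. F (Z w))"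
proof -
  have L0: "0 \<le> L"
  proof (rule ccontr)
    assume "\<not> 0 \<le> L"
    moreover have "1 \<le> dist (0 :: 'n \<Rightarrow>\<^sub>C real) (const_bcontfun 1)"
      using dist_bounded[of 0 0 "const_bcontfun 1 :: 'n \<Rightarrow>\<^sub>C real"] by (simp add: dist_real_def)
    then have "0 < dist (0 :: 'n \<Rightarrow>\<^sub>C real) (const_bcontfun 1)" by linarith
    ultimately have "L * dist (0 :: 'n \<Rightarrow>\<^sub>C real) (const_bcontfun 1) < 0" by (simp add: mult_neg_pos)
    then show False using L[of 0 "const_bcontfun 1"] by linarith
  qed
  have K0: "0 \<le> bd" using bd[of 0] by linarith
  have Fc: "continuous_on UNIV F"
  proof (rule continuous_on_iff[THEN iffD2], intro ballI allI impI)
    fix z :: "'n \<Rightarrow>\<^sub>C real" and e :: real assume e: "0 < e"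
    have "dist (F z') (F z) < e" if "dist z' z < e / (L + 1)" for z'
    proof -
      have "dist (F z') (F z) \<le> L * dist z' z" using L[of z' z] by (simp add: dist_real_def)
      also have "\<dots> \<le> (L + 1) * dist z' z" by (rule mult_right_mono) auto
      also have "\<dots> < e" using that L0 by (simp add: field_simps)
      finally show ?thesis .
    qed
    moreover have "0 < e / (L + 1)" using e L0 by simp
    ultimately show "\<exists>d>0. \<forall>z'\<in>UNIV. dist z' z < d \<longrightarrow> dist (F z') (F z) < e" by blast
  qed
  have [measurable]: "F \<in> borel_measurable borel" by (rule borel_measurable_continuous_onI[OF Fc])
  show bZ: "bounded_rv N (\<lambda>w. F (Z w))" by (rule bounded_rvI[of _ _ bd]) (use bd in auto)
  define T where "T k R \<delta> \<longleftrightarrow> 1 / (1 / real (Suc k)) \<le> R \<and> 0 < \<delta> \<and> \<delta> \<le> 1 / real (Suc k) \<and>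
      (\<forall>\<^sub>F n in sequentially. \<exists>A\<in>sets M. measure M A \<le> 2 * (1 / real (Suc k)) \<and>
        (\<forall>\<omega>\<in>space M - A. norm (interpolate R \<delta> (Zn n \<omega>) - Zn n \<omega>) \<le> 1 / real (Suc k)))" for k R \<delta>
  have "\<exists>R \<delta>. T k R \<delta>" for k
    unfolding T_def by (rule tight_interpolation) auto
  then obtain R \<delta> where T: "\<And>k. T k (R k) (\<delta> k)" by metis
  have R: "\<And>k. 1 / (1 / real (Suc k)) \<le> R k" and \<delta>: "\<And>k. 0 < \<delta> k" "\<And>k. \<delta> k \<le> 1 / real (Suc k)"
    and ev: "\<And>k. \<forall>\<^sub>F n in sequentially. \<exists>A\<in>sets M. measure M A \<le> 2 * (1 / real (Suc k)) \<and>
      (\<forall>\<omega>\<in>space M - A. norm (interpolate (R k) (\<delta> k) (Zn n \<omega>) - Zn n \<omega>) \<le> 1 / real (Suc k))"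
    using T unfolding T_def by blast+
  define P where "P k = (interpolate (R k) (\<delta> k) :: ('n \<Rightarrow>\<^sub>C real) \<Rightarrow> _)" for k
  have R0: "0 \<le> R k" "real k \<le> R k" for k using R[of k] by auto
  have "filterlim R at_top sequentially"
    by (rule filterlim_at_top_mono[OF filterlim_real_sequentially]) (use R0 in auto)
  moreover have "\<delta> \<longlonglongrightarrow> 0"
    by (rule Lim_null_comparison[OF _ LIMSEQ_Suc[OF lim_1_over_n]]) (use \<delta> in \<open>auto intro!: always_eventually simp: less_imp_le\<close>)
  ultimately have P_lim: "(\<lambda>k. P k z) \<longlonglongrightarrow> z" if "z \<in> C_hat" for z
    unfolding P_def by (rule interpolate_tendsto[OF that _ _ R0(1) \<delta>(1)])
  have FP_lim: "(\<lambda>k. F (P k z)) \<longlonglongrightarrow> F z" if "z \<in> C_hat" for z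
    using continuous_on_tendsto_compose[OF Fc P_lim[OF that]] by simp
  define m where "m j = fst (interpolation (R j) (\<delta> j) :: nat \<times> (nat \<Rightarrow> 'n) \<times> (nat \<Rightarrow> ('n \<Rightarrow>\<^sub>C real)))" for j
  define U where "U j = fst (snd (interpolation (R j) (\<delta> j) :: nat \<times> (nat \<Rightarrow> 'n) \<times> (nat \<Rightarrow> ('n \<Rightarrow>\<^sub>C real))))" for j
  define \<phi> where "\<phi> j = snd (snd (interpolation (R j) (\<delta> j) :: nat \<times> (nat \<Rightarrow> 'n) \<times> (nat \<Rightarrow> ('n \<Rightarrow>\<^sub>C real))))" for j
  have P: "P j z = (\<Sum>i<m j. apply_bcontfun z (U j i) *\<^sub>R (\<phi> j i))" for j z
    by (simp add: P_def interpolate_def m_def U_def \<phi>_def case_prod_beta)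
  define g where "g j x = F (\<Sum>i<m j. x i *\<^sub>R \<phi> j i)" for j and x :: "nat \<Rightarrow> real"
  have Pg: "F (P j z) = g j (\<lambda>i\<in>{..<m j}. apply_bcontfun z (U j i))" for j z
    unfolding g_def P by (intro arg_cong[where f=F] sum.cong) auto
  have Pg': "F (P j z) = g j (\<lambda>i. apply_bcontfun z (U j i))" for j z
    unfolding g_def P ..
  have [measurable]: "g j \<in> borel_measurable borel" for j
    by (rule borel_measurable_continuous_onI, unfold g_def)
       (intro continuous_on_compose2[OF Fc] continuous_on_sum continuous_on_scaleR continuous_on_const continuous_on_product_coordinates subset_UNIV)
  have mP[measurable]: "(\<lambda>\<omega>. F (P k (Zn n \<omega>))) \<in> borel_measurable M" for k n
  proof -
    have "(\<lambda>\<omega> i. apply_bcontfun (Zn n \<omega>) (U k i)) \<in> borel_measurable M"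
      by (rule measurable_coordinatewise_then_product) (rule Zn_coord)
    then show ?thesis unfolding Pg' by measurable
  qed
  have mZ[measurable]: "(\<lambda>\<omega>. F (Zn n \<omega>)) \<in> borel_measurable M" for n
    by (rule borel_measurable_LIMSEQ_metric[of "\<lambda>k \<omega>. F (P k (Zn n \<omega>))"]) (use mP FP_lim Zn_C_hat in auto)
  show bZn: "bounded_rv M (\<lambda>\<omega>. F (Zn n \<omega>))" for n by (rule bounded_rvI[of _ _ bd]) (use bd in auto)
  have [measurable]: "\<Psi> n \<in> borel_measurable M" for n by (rule \<Psi>_meas)
  have b\<Psi>: "bounded_rv M (\<Psi> n)" for n by (rule bounded_rvI[of _ _ 1]) (use \<Psi>_01 in force)+
  have bP: "bounded_rv M (\<lambda>\<omega>. F (P k (Zn n \<omega>)))" for k n by (rule bounded_rvI[of _ _ bd]) (use bd in auto)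
  have mPZ: "(\<lambda>w. F (P k (Z w))) \<in> borel_measurable N" for k
  proof -
    have c: "continuous_on UNIV (\<lambda>z :: 'n \<Rightarrow>\<^sub>C real. apply_bcontfun z u)" for u
      by (rule continuous_on_iff[THEN iffD2]) (use dist_fun_lt_imp_dist_val_lt in blast)
    have "(\<lambda>w i. apply_bcontfun (Z w) (U k i)) \<in> borel_measurable N"
      by (rule measurable_coordinatewise_then_product)
         (rule measurable_compose[OF Z_measurable borel_measurable_continuous_onI[OF c]])
    then show ?thesis unfolding Pg' by measurable
  qed
  show "cond_conv (\<lambda>n \<omega>. F (Zn n \<omega>)) (\<lambda>w. F (Z w))"
  proof (rule cond_conv_approx[where xk="\<lambda>k n \<omega>. F (P k (Zn n \<omega>)) * \<Psi> n \<omega>" and xk'="\<lambda>k w. F (P k (Z w))"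
        and e="\<lambda>k. (L + 5 * bd) * (1 / real (Suc k))"])
    show "bounded_rv M (\<lambda>\<omega>. F (P k (Zn n \<omega>)) * \<Psi> n \<omega>)" for k n by (rule bounded_rv_mult[OF bP b\<Psi>])
    show "bounded_rv N (\<lambda>w. F (P k (Z w)))" for k by (rule bounded_rvI[OF mPZ, of _ bd]) (use bd in auto)
    show "cond_conv (\<lambda>n \<omega>. F (P k (Zn n \<omega>)) * \<Psi> n \<omega>) (\<lambda>w. F (P k (Z w)))" for k
      unfolding cond_conv_def Pg
    proof (intro allI impI fidi)
      have "continuous_map (powertop_real {..<m k}) euclidean (\<lambda>x. \<Sum>i<m k. x i *\<^sub>R \<phi> k i)"
      proof (rule continuous_map_sum)
        fix i assume i: "i \<in> {..<m k}"
        have "continuous_map euclideanreal euclidean (\<lambda>t. t *\<^sub>R \<phi> k i)"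
          by (auto simp: continuous_map_iff_continuous2 intro!: continuous_intros)
        from continuous_map_compose[OF continuous_map_product_projection[OF i] this]
        show "continuous_map (powertop_real {..<m k}) euclidean (\<lambda>x. x i *\<^sub>R \<phi> k i)" by (simp add: o_def)
      qed simp
      moreover have "continuous_map euclidean euclideanreal F" using Fc by (simp add: continuous_map_iff_continuous2)
      ultimately have "continuous_map (powertop_real {..<m k}) euclideanreal (F \<circ> (\<lambda>x. \<Sum>i<m k. x i *\<^sub>R \<phi> k i))"
        by (rule continuous_map_compose)
      then show "continuous_map (powertop_real {..<m k}) euclideanreal (g k)"
        by (simp add: g_def[abs_def] o_def)
      show "bounded (g k ` topspace (powertop_real {..<m k}))"
        by (rule boundedI[of _ bd]) (use bd in \<open>auto simp: g_def\<close>)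
    qed
    show "(\<lambda>k. (L + 5 * bd) * (1 / real (Suc k))) \<longlonglongrightarrow> 0"
      using tendsto_mult[OF tendsto_const LIMSEQ_Suc[OF lim_1_over_n], of "L + 5 * bd"] by simp
    have "(\<lambda>k. \<integral>w. \<bar>F (Z w) - F (P k (Z w))\<bar> \<partial>N) \<longlonglongrightarrow> (\<integral>w. 0 \<partial>N)"
    proof (rule integral_dominated_convergence[where w="\<lambda>_. 2 * bd"])
      show "AE w in N. (\<lambda>k. \<bar>F (Z w) - F (P k (Z w))\<bar>) \<longlonglongrightarrow> 0"
      proof (rule AE_I2)
        fix w assume "w \<in> space N"
        then have "(\<lambda>k. \<bar>F (Z w) - F (P k (Z w))\<bar>) \<longlonglongrightarrow> \<bar>F (Z w) - F (Z w)\<bar>"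
          by (intro tendsto_intros FP_lim Z_in_C_hat)
        then show "(\<lambda>k. \<bar>F (Z w) - F (P k (Z w))\<bar>) \<longlonglongrightarrow> 0" by simp
      qed
      show "AE w in N. norm \<bar>F (Z w) - F (P k (Z w))\<bar> \<le> 2 * bd" for k
        using bd by (auto intro!: AE_I2 order_trans[OF abs_triangle_ineq4] add_mono[of _ bd _ bd, simplified])
    qed (use mPZ in auto)
    then show "(\<lambda>k. \<integral>w. \<bar>F (Z w) - F (P k (Z w))\<bar> \<partial>N) \<longlonglongrightarrow> 0" by simp
  next
    fix k
    define e where "e = 1 / real (Suc k)"
    have e: "0 < e" "e \<le> 1" by (auto simp: e_def)
    have "\<forall>\<^sub>F n in sequentially. (\<integral>\<omega>. min 1 \<bar>\<Psi> n \<omega> - 1\<bar> \<partial>M) < e"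
      by (rule order_tendstoD(2)[OF M.tendsto_in_prob_iff_integral[THEN iffD1, OF _ _ \<Psi>_1]]) (use e in auto)
    with ev[of k] show "\<forall>\<^sub>F n in sequentially. (\<integral>\<omega>. \<bar>F (Zn n \<omega>) - F (P k (Zn n \<omega>)) * \<Psi> n \<omega>\<bar> \<partial>M) \<le> (L + 5 * bd) * (1 / real (Suc k))"
    proof eventually_elim
      fix n assume "\<exists>A\<in>sets M. measure M A \<le> 2 * (1 / real (Suc k)) \<and>
          (\<forall>\<omega>\<in>space M - A. norm (interpolate (R k) (\<delta> k) (Zn n \<omega>) - Zn n \<omega>) \<le> 1 / real (Suc k))"
        and ps: "(\<integral>\<omega>. min 1 \<bar>\<Psi> n \<omega> - 1\<bar> \<partial>M) < e"
      then obtain A where A[measurable]: "A \<in> sets M" and mA: "measure M A \<le> 2 * e"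
        and Ae: "\<And>\<omega>. \<omega> \<in> space M - A \<Longrightarrow> norm (P k (Zn n \<omega>) - Zn n \<omega>) \<le> e"
        by (auto simp: e_def P_def)
      have pw: "\<bar>F (Zn n \<omega>) - F (P k (Zn n \<omega>)) * \<Psi> n \<omega>\<bar> \<le> L * e + (2 * bd * indicator A \<omega> + bd * min 1 \<bar>\<Psi> n \<omega> - 1\<bar>)"
        if \<omega>: "\<omega> \<in> space M" for \<omega>
      proof -
        have P01: "0 \<le> \<Psi> n \<omega>" "\<Psi> n \<omega> \<le> 1" using \<Psi>_01[OF \<omega>, of n] by auto
        have 1: "\<bar>F (Zn n \<omega>) - F (P k (Zn n \<omega>))\<bar> \<le> L * e + 2 * bd * indicator A \<omega>"
        proof (cases "\<omega> \<in> A")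
          case True
          have "\<bar>F (Zn n \<omega>) - F (P k (Zn n \<omega>))\<bar> \<le> 2 * bd" using bd[of "Zn n \<omega>"] bd[of "P k (Zn n \<omega>)"] by linarith
          then show ?thesis using True L0 e by (simp add: add_increasing)
        next
          case False
          have "\<bar>F (Zn n \<omega>) - F (P k (Zn n \<omega>))\<bar> \<le> L * dist (Zn n \<omega>) (P k (Zn n \<omega>))" by (rule L)
          also have "\<dots> \<le> L * e"
            by (rule mult_left_mono[OF _ L0]) (use Ae[of \<omega>] False \<omega> in \<open>simp add: dist_norm norm_minus_commute\<close>)
          finally show ?thesis using False by simp
        qed
        have a: "\<bar>F (P k (Zn n \<omega>)) * (1 - \<Psi> n \<omega>)\<bar> \<le> bd * (1 - \<Psi> n \<omega>)"
          unfolding abs_mult using P01 bd by (simp add: mult_right_mono)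
        have b: "1 - \<Psi> n \<omega> = min 1 \<bar>\<Psi> n \<omega> - 1\<bar>" using P01 by auto
        have c: "F (P k (Zn n \<omega>)) - F (P k (Zn n \<omega>)) * \<Psi> n \<omega> = F (P k (Zn n \<omega>)) * (1 - \<Psi> n \<omega>)"
          by (simp add: algebra_simps)
        have 2: "\<bar>F (P k (Zn n \<omega>)) - F (P k (Zn n \<omega>)) * \<Psi> n \<omega>\<bar> \<le> bd * min 1 \<bar>\<Psi> n \<omega> - 1\<bar>"
          using a unfolding c b[symmetric] .
        show ?thesis using 1 2 by linarith
      qed
      note bI = bounded_rv_indicator[OF A] and bm = M.bounded_rv_min1[of "\<lambda>\<omega>. \<Psi> n \<omega> - 1"]
      have bA: "bounded_rv M (\<lambda>\<omega>. 2 * bd * indicator A \<omega>)" "bounded_rv M (\<lambda>\<omega>. bd * min 1 \<bar>\<Psi> n \<omega> - 1\<bar>)"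
        by (intro bounded_rv_cmult bI bm, measurable)+
      have "(\<integral>\<omega>. \<bar>F (Zn n \<omega>) - F (P k (Zn n \<omega>)) * \<Psi> n \<omega>\<bar> \<partial>M)
          \<le> (\<integral>\<omega>. L * e + (2 * bd * indicator A \<omega> + bd * min 1 \<bar>\<Psi> n \<omega> - 1\<bar>) \<partial>M)"
      proof (rule integral_mono)
        show "integrable M (\<lambda>\<omega>. \<bar>F (Zn n \<omega>) - F (P k (Zn n \<omega>)) * \<Psi> n \<omega>\<bar>)"
          by (rule M.bounded_rv_integrable[OF bounded_rv_abs[OF bounded_rv_diff[OF bZn bounded_rv_mult[OF bP b\<Psi>]]]])
        show "integrable M (\<lambda>\<omega>. L * e + (2 * bd * indicator A \<omega> + bd * min 1 \<bar>\<Psi> n \<omega> - 1\<bar>))"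
          by (rule M.bounded_rv_integrable[OF bounded_rv_add[OF bounded_rv_const bounded_rv_add[OF bA]]])
      qed (rule pw)
      also have "\<dots> = L * e + (2 * bd * measure M A + bd * (\<integral>\<omega>. min 1 \<bar>\<Psi> n \<omega> - 1\<bar> \<partial>M))"
        using M.bounded_rv_integrable[OF bA(1)] M.bounded_rv_integrable[OF bA(2)] M.bounded_rv_integrable[OF bounded_rv_add[OF bA]]
        by (simp add: M.prob_space)
      also have "\<dots> \<le> L * e + (2 * bd * (2 * e) + bd * e)"
        using mA ps K0 by (intro add_mono mult_left_mono order_refl) auto
      also have "\<dots> = (L + 5 * bd) * e" by (simp add: algebra_simps)
      finally show "(\<integral>\<omega>. \<bar>F (Zn n \<omega>) - F (P k (Zn n \<omega>)) * \<Psi> n \<omega>\<bar> \<partial>M) \<le> (L + 5 * bd) * (1 / real (Suc k))"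
        by (simp only: e_def)
    qed
  qed (use bZ bZn in auto)
qed

text \<open>The mean distance of \<open>x n\<close> to its majorant is at most the mean gap between majorant and minorant.
  This gap is again a Lipschitz functional, so its mean converges to the gap for the limit field,
  which vanishes as \<open>k \<rightarrow> \<infinity>\<close>.\<close>

lemma sandwich_conv:
  fixes Fu Fl :: "nat \<Rightarrow> ('n \<Rightarrow>\<^sub>C real) \<Rightarrow> real"
  assumes Lu: "\<And>k z z'. \<bar>Fu k z - Fu k z'\<bar> \<le> Lu k * dist z z'" and Ku: "\<And>k z. \<bar>Fu k z\<bar> \<le> bd"
    and Ll: "\<And>k z z'. \<bar>Fl k z - Fl k z'\<bar> \<le> Ll k * dist z z'" and Kl: "\<And>k z. \<bar>Fl k z\<bar> \<le> bd"
    and x: "\<And>n. bounded_rv M (x n)" and x': "bounded_rv N x'"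
    and le: "\<And>k n \<omega>. \<omega> \<in> space M \<Longrightarrow> Fl k (Zn n \<omega>) \<le> x n \<omega> \<and> x n \<omega> \<le> Fu k (Zn n \<omega>)"
    and limu: "AE w in N. (\<lambda>k. Fu k (Z w)) \<longlonglongrightarrow> x' w" and liml: "AE w in N. (\<lambda>k. Fl k (Z w)) \<longlonglongrightarrow> x' w"
  shows "cond_conv x x'"
proof -
  note bu = lipschitz_functional_measurable[OF Lu Ku] and bl = lipschitz_functional_measurable[OF Ll Kl]
  define d where "d k = (\<integral>w. Fu k (Z w) - Fl k (Z w) \<partial>N)" for k
  have Ld: "\<bar>(Fu k z - Fl k z) - (Fu k z' - Fl k z')\<bar> \<le> (Lu k + Ll k) * dist z z'" for k z z'
    using Lu[of k z z'] Ll[of k z z'] by (simp add: algebra_simps)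
  have Kd: "\<bar>Fu k z - Fl k z\<bar> \<le> bd + bd" for k z using Ku[of k z] Kl[of k z] by linarith
  obtain D where D: "\<And>w. w \<in> space N \<Longrightarrow> \<bar>x' w\<bar> \<le> D" using x' by (rule bounded_rvE) blast
  have "d \<longlonglongrightarrow> (\<integral>w. x' w - x' w \<partial>N)"
    unfolding d_def
  proof (rule integral_dominated_convergence[where w="\<lambda>_. bd + bd"])
    show "AE w in N. (\<lambda>k. Fu k (Z w) - Fl k (Z w)) \<longlonglongrightarrow> x' w - x' w"
      using limu liml by eventually_elim (rule tendsto_diff)
  qed (use x' bu bl Kd in \<open>auto intro!: bounded_rv_measurable bounded_rv_diff\<close>)
  then have d0: "d \<longlonglongrightarrow> 0" by simp
  show ?thesis
  proof (rule cond_conv_approx[where xk="\<lambda>k n \<omega>. Fu k (Zn n \<omega>)" and xk'="\<lambda>k w. Fu k (Z w)" and e="\<lambda>k. d k + 1 / real (Suc k)"])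
    show "cond_conv (\<lambda>n \<omega>. Fu k (Zn n \<omega>)) (\<lambda>w. Fu k (Z w))" for k
      by (rule lipschitz_functional_conv[OF Lu Ku])
    show "(\<lambda>k. d k + 1 / real (Suc k)) \<longlonglongrightarrow> 0"
      using tendsto_add[OF d0 LIMSEQ_Suc[OF lim_1_over_n]] by simp
    have "(\<lambda>k. \<integral>w. \<bar>x' w - Fu k (Z w)\<bar> \<partial>N) \<longlonglongrightarrow> (\<integral>w. 0 \<partial>N)"
    proof (rule integral_dominated_convergence[where w="\<lambda>_. D + bd"])
      show "AE w in N. (\<lambda>k. \<bar>x' w - Fu k (Z w)\<bar>) \<longlonglongrightarrow> 0"
        using limu
      proof eventually_elim
        fix w assume "(\<lambda>k. Fu k (Z w)) \<longlonglongrightarrow> x' w"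
        then have "(\<lambda>k. \<bar>x' w - Fu k (Z w)\<bar>) \<longlonglongrightarrow> \<bar>x' w - x' w\<bar>" by (intro tendsto_intros)
        then show "(\<lambda>k. \<bar>x' w - Fu k (Z w)\<bar>) \<longlonglongrightarrow> 0" by simp
      qed
      show "AE w in N. norm \<bar>x' w - Fu k (Z w)\<bar> \<le> D + bd" for k
        by (rule AE_I2) (use D Ku in \<open>auto intro!: order_trans[OF abs_triangle_ineq4] add_mono\<close>)
    qed (use x' bu in \<open>auto intro!: bounded_rv_measurable bounded_rv_abs bounded_rv_diff\<close>)
    then show "(\<lambda>k. \<integral>w. \<bar>x' w - Fu k (Z w)\<bar> \<partial>N) \<longlonglongrightarrow> 0" by simp
  next
    fix k
    have "(\<lambda>n. \<integral>\<omega>. (Fu k (Zn n \<omega>) - Fl k (Zn n \<omega>)) * 1 \<partial>M) \<longlonglongrightarrow> (\<integral>w. (Fu k (Z w) - Fl k (Z w)) * 1 \<partial>N)"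
      by (rule cond_conv_integral[where c="bd + bd" and Y="\<lambda>_. 1"])
         (use bu bl Kd lipschitz_functional_conv[OF Ld Kd] in \<open>auto intro!: bounded_rv_diff bounded_rv_const\<close>)
    then have "(\<lambda>n. \<integral>\<omega>. Fu k (Zn n \<omega>) - Fl k (Zn n \<omega>) \<partial>M) \<longlonglongrightarrow> d k" by (simp add: d_def)
    then have "\<forall>\<^sub>F n in sequentially. (\<integral>\<omega>. Fu k (Zn n \<omega>) - Fl k (Zn n \<omega>) \<partial>M) < d k + 1 / real (Suc k)"
      by (rule order_tendstoD(2)) simp
    then show "\<forall>\<^sub>F n in sequentially. (\<integral>\<omega>. \<bar>x n \<omega> - Fu k (Zn n \<omega>)\<bar> \<partial>M) \<le> d k + 1 / real (Suc k)"
    proof eventually_elim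
      fix n assume "(\<integral>\<omega>. Fu k (Zn n \<omega>) - Fl k (Zn n \<omega>) \<partial>M) < d k + 1 / real (Suc k)"
      moreover have "(\<integral>\<omega>. \<bar>x n \<omega> - Fu k (Zn n \<omega>)\<bar> \<partial>M) \<le> (\<integral>\<omega>. Fu k (Zn n \<omega>) - Fl k (Zn n \<omega>) \<partial>M)"
      proof (rule integral_mono)
        show "\<bar>x n \<omega> - Fu k (Zn n \<omega>)\<bar> \<le> Fu k (Zn n \<omega>) - Fl k (Zn n \<omega>)" if "\<omega> \<in> space M" for \<omega>
          using le[OF that, of k n] by linarith
      qed (intro M.bounded_rv_integrable bounded_rv_abs bounded_rv_diff x bu bl)+
      ultimately show "(\<integral>\<omega>. \<bar>x n \<omega> - Fu k (Zn n \<omega>)\<bar> \<partial>M) \<le> d k + 1 / real (Suc k)" by linarith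
    qed
  qed (use x x' bu in auto)
qed

lemma continuous_functional_conv:
  assumes F: "continuous_on C_hat F" and b: "bounded (F ` C_hat)"
  shows "cond_conv (\<lambda>n \<omega>. F (Zn n \<omega>)) (\<lambda>w. F (Z w))"
proof -
  obtain bd where bd: "\<forall>z\<in>C_hat. \<bar>F z\<bar> \<le> bd" using b by (auto simp: bounded_iff)
  have ne: "C_hat \<noteq> ({} :: ('n \<Rightarrow>\<^sub>C real) set)" using N.not_empty Z_in_C_hat by blast
  have bd': "\<forall>z\<in>C_hat. \<bar>- F z\<bar> \<le> bd" using bd by simp
  have cw: "continuous (at z within C_hat) F" if "z \<in> C_hat" for z
    using F that by (simp add: continuous_on_eq_continuous_within)
  from lipschitz_sup_convolution[OF ne bd] obtain A :: "nat \<Rightarrow> ('n \<Rightarrow>\<^sub>C real) \<Rightarrow> real" where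
    A: "\<forall>k z z'. \<bar>A k z - A k z'\<bar> \<le> real k * dist z z'" "\<forall>k z. \<bar>A k z\<bar> \<le> bd"
    "\<forall>k. \<forall>z\<in>C_hat. F z \<le> A k z"
    "\<forall>z\<in>C_hat. continuous (at z within C_hat) F \<longrightarrow> (\<lambda>k. A k z) \<longlonglongrightarrow> F z" by blast
  note A = A[rule_format]
  from lipschitz_sup_convolution[OF ne bd'] obtain A' :: "nat \<Rightarrow> ('n \<Rightarrow>\<^sub>C real) \<Rightarrow> real" where
    A': "\<forall>k z z'. \<bar>A' k z - A' k z'\<bar> \<le> real k * dist z z'" "\<forall>k z. \<bar>A' k z\<bar> \<le> bd"
    "\<forall>k. \<forall>z\<in>C_hat. - F z \<le> A' k z"
    "\<forall>z\<in>C_hat. continuous (at z within C_hat) (\<lambda>z. - F z) \<longrightarrow> (\<lambda>k. A' k z) \<longlonglongrightarrow> - F z" by blast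
  note A' = A'[rule_format]
  have limA: "(\<lambda>k. A k z) \<longlonglongrightarrow> F z" "(\<lambda>k. - A' k z) \<longlonglongrightarrow> F z" if "z \<in> C_hat" for z
    using A(4)[OF that cw[OF that]] tendsto_minus[OF A'(4)[OF that continuous_minus[OF cw[OF that]]]] by simp_all
  note bA = lipschitz_functional_measurable[OF A(1,2)]
  have "(\<lambda>\<omega>. F (Zn n \<omega>)) \<in> borel_measurable M" for n
    by (rule borel_measurable_LIMSEQ_metric[of "\<lambda>k \<omega>. A k (Zn n \<omega>)"])
       (use bA(1) limA Zn_C_hat in \<open>auto intro: bounded_rv_measurable\<close>)
  then have bM: "bounded_rv M (\<lambda>\<omega>. F (Zn n \<omega>))" for n
    by (rule bounded_rvI[of _ _ bd]) (use bd Zn_C_hat in auto)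
  have "(\<lambda>w. F (Z w)) \<in> borel_measurable N"
    by (rule borel_measurable_LIMSEQ_metric[of "\<lambda>k w. A k (Z w)"])
       (use bA(2) limA Z_in_C_hat in \<open>auto intro: bounded_rv_measurable\<close>)
  then have bN: "bounded_rv N (\<lambda>w. F (Z w))"
    by (rule bounded_rvI[of _ _ bd]) (use bd Z_in_C_hat in auto)
  show "cond_conv (\<lambda>n \<omega>. F (Zn n \<omega>)) (\<lambda>w. F (Z w))"
  proof (rule sandwich_conv[where Fu=A and Fl="\<lambda>k z. - A' k z" and Lu=real and Ll=real and bd=bd])
    show "\<bar>- A' k z - - A' k z'\<bar> \<le> real k * dist z z'" for k z z'
      using A'(1)[of k z z'] by (simp add: abs_minus_commute)
    show "- A' k (Zn n \<omega>) \<le> F (Zn n \<omega>) \<and> F (Zn n \<omega>) \<le> A k (Zn n \<omega>)" if "\<omega> \<in> space M" for k n \<omega>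
      using A(3)[OF Zn_C_hat[OF that], of n k] A'(3)[OF Zn_C_hat[OF that], of n k] by linarith
  qed (use A(1,2) A'(2) bM bN limA Z_in_C_hat in \<open>auto intro!: AE_I2\<close>)
qed

text \<open>The limit inherits the value \<open>1\<close> at \<open>0\<close> because the functional \<open>min 1 \<bar>z 0 - 1\<bar>\<close> is Lipschitz and
  vanishes on the fields; the maximum of the limit is therefore positive.\<close>

lemma argmax_conv:
  assumes u: "\<And>n. un n \<in> borel_measurable M" and u': "u' \<in> borel_measurable N"
    and max: "\<And>n \<omega>. \<omega> \<in> space M \<Longrightarrow> maximizes (apply_bcontfun (Zn n \<omega>)) (un n \<omega>)"
    and max': "AE w in N. maximizes (apply_bcontfun (Z w)) (u' w) \<and>
      (\<forall>u. maximizes (apply_bcontfun (Z w)) u \<longrightarrow> u = u' w)"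
    and one: "\<And>n \<omega>. \<omega> \<in> space M \<Longrightarrow> apply_bcontfun (Zn n \<omega>) 0 = 1"
    and f: "continuous_on UNIV f" and bf: "bounded (range f)"
  shows "cond_conv (\<lambda>n \<omega>. f (un n \<omega>)) (\<lambda>w. f (u' w))"
proof -
  have one': "AE w in N. apply_bcontfun (Z w) 0 = 1"
  proof -
    define F where "F z = min 1 \<bar>apply_bcontfun z 0 - 1\<bar>" for z :: "'n \<Rightarrow>\<^sub>C real"
    have L: "\<bar>F z - F z'\<bar> \<le> 1 * dist z z'" for z z'
      using dist_bounded[of z 0 z'] by (auto simp: F_def dist_real_def min_def)
    have bd: "\<bar>F z\<bar> \<le> 1" for z by (auto simp: F_def)
    note bF = lipschitz_functional_measurable[OF L bd]
    have "(\<lambda>n. \<integral>\<omega>. F (Zn n \<omega>) * 1 \<partial>M) \<longlonglongrightarrow> (\<integral>w. F (Z w) * 1 \<partial>N)"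
      by (rule cond_conv_integral[where c=1 and Y="\<lambda>_. 1"])
         (use bF bd lipschitz_functional_conv[OF L bd] in \<open>auto intro!: bounded_rv_const\<close>)
    moreover have "(\<integral>\<omega>. F (Zn n \<omega>) * 1 \<partial>M) = (\<integral>\<omega>. 0 \<partial>M)" for n
      by (rule Bochner_Integration.integral_cong) (auto simp: F_def one)
    ultimately have "(\<integral>w. F (Z w) \<partial>N) = 0" by (simp add: LIMSEQ_const_iff)
    moreover have "integrable N (\<lambda>w. F (Z w))" by (rule N.bounded_rv_integrable[OF bF(2)])
    ultimately have "AE w in N. F (Z w) = 0"
      by (subst (asm) integral_nonneg_eq_0_iff_AE) (auto simp: F_def)
    then show ?thesis by eventually_elim (auto simp: F_def min_def split: if_splits)
  qed
  obtain bd where bd: "\<And>u. \<bar>f u\<bar> \<le> bd" using bf by (auto simp: bounded_iff)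
  have bd': "\<And>u. \<bar>- f u\<bar> \<le> bd" using bd by simp
  have f': "continuous_on UNIV (\<lambda>u. - f u)" by (intro continuous_intros f)
  have fm: "f \<in> borel_measurable borel" by (rule borel_measurable_continuous_onI[OF f])
  from argmax_penalization[OF f bd] obtain A :: "nat \<Rightarrow> ('n \<Rightarrow>\<^sub>C real) \<Rightarrow> real" where
    A: "\<forall>k z z'. \<bar>A k z - A k z'\<bar> \<le> real (2 * k) * dist z z'" "\<forall>k z. \<bar>A k z\<bar> \<le> bd"
    "\<forall>k z u. maximizes (apply_bcontfun z) u \<longrightarrow> f u \<le> A k z"
    "\<forall>z\<in>C_hat. \<forall>u. 0 < apply_bcontfun z u \<longrightarrow> maximizes (apply_bcontfun z) u \<longrightarrow>
      (\<forall>v. maximizes (apply_bcontfun z) v \<longrightarrow> v = u) \<longrightarrow> (\<lambda>k. A k z) \<longlonglongrightarrow> f u" by blast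
  note A = A[rule_format]
  from argmax_penalization[OF f' bd'] obtain A' :: "nat \<Rightarrow> ('n \<Rightarrow>\<^sub>C real) \<Rightarrow> real" where
    A': "\<forall>k z z'. \<bar>A' k z - A' k z'\<bar> \<le> real (2 * k) * dist z z'" "\<forall>k z. \<bar>A' k z\<bar> \<le> bd"
    "\<forall>k z u. maximizes (apply_bcontfun z) u \<longrightarrow> - f u \<le> A' k z"
    "\<forall>z\<in>C_hat. \<forall>u. 0 < apply_bcontfun z u \<longrightarrow> maximizes (apply_bcontfun z) u \<longrightarrow>
      (\<forall>v. maximizes (apply_bcontfun z) v \<longrightarrow> v = u) \<longrightarrow> (\<lambda>k. A' k z) \<longlonglongrightarrow> - f u" by blast
  note A' = A'[rule_format]
  have lim: "AE w in N. (\<lambda>k. A k (Z w)) \<longlonglongrightarrow> f (u' w) \<and> (\<lambda>k. - A' k (Z w)) \<longlonglongrightarrow> f (u' w)"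
    using max' one' AE_space
  proof eventually_elim
    fix w assume m: "maximizes (apply_bcontfun (Z w)) (u' w) \<and> (\<forall>u. maximizes (apply_bcontfun (Z w)) u \<longrightarrow> u = u' w)"
      and 1: "apply_bcontfun (Z w) 0 = 1" and w: "w \<in> space N"
    have "1 \<le> apply_bcontfun (Z w) (u' w)" using m 1 unfolding maximizes_def by metis
    then have p: "0 < apply_bcontfun (Z w) (u' w)" by linarith
    show "(\<lambda>k. A k (Z w)) \<longlonglongrightarrow> f (u' w) \<and> (\<lambda>k. - A' k (Z w)) \<longlonglongrightarrow> f (u' w)"
      using A(4)[OF Z_in_C_hat[OF w] p] tendsto_minus[OF A'(4)[OF Z_in_C_hat[OF w] p]] m by simp
  qed
  show ?thesis
  proof (rule sandwich_conv[where Fu=A and Fl="\<lambda>k z. - A' k z" and Lu="\<lambda>k. real (2 * k)" and Ll="\<lambda>k. real (2 * k)" and bd=bd])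
    show "\<bar>- A' k z - - A' k z'\<bar> \<le> real (2 * k) * dist z z'" for k z z'
      using A'(1)[of k z z'] by (simp add: abs_minus_commute)
    show "- A' k (Zn n \<omega>) \<le> f (un n \<omega>) \<and> f (un n \<omega>) \<le> A k (Zn n \<omega>)" if "\<omega> \<in> space M" for k n \<omega>
      using A(3)[OF max[OF that], of n k] A'(3)[OF max[OF that], of n k] by linarith
    show "bounded_rv M (\<lambda>\<omega>. f (un n \<omega>))" for n
      by (rule bounded_rvI[OF measurable_compose[OF u fm], where c=bd]) (use bd in auto)
    show "bounded_rv N (\<lambda>w. f (u' w))"
      by (rule bounded_rvI[OF measurable_compose[OF u' fm], where c=bd]) (use bd in auto)
    show "AE w in N. (\<lambda>k. A k (Z w)) \<longlonglongrightarrow> f (u' w)" "AE w in N. (\<lambda>k. - A' k (Z w)) \<longlonglongrightarrow> f (u' w)"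
      using lim by (eventually_elim, blast)+
  qed (use A(1,2) A'(2) in auto)
qed

end

section \<open>The likelihood ratio field at a fixed time\<close>

lemma continuous_le_on_closure_bcontfun:
  fixes z :: "'n::euclidean_space \<Rightarrow>\<^sub>C real"
  assumes "\<And>u. u \<in> D \<Longrightarrow> apply_bcontfun z u \<le> c" "v \<in> closure D"
  shows "apply_bcontfun z v \<le> c"
proof -
  have "closed {u. apply_bcontfun z u \<le> c}"
    by (intro closed_Collect_le continuous_intros) auto
  then have "closure D \<subseteq> {u. apply_bcontfun z u \<le> c}"
    by (intro closure_minimal) (use assms in auto)
  then show ?thesis using assms(2) by blast
qed

lemma norm_matrix_vector_mult_le:
  fixes A :: "real^'p^'p"
  shows "norm (A *v x) \<le> real CARD('p) * (norm A * norm x)"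
proof -
  have "norm (A *v x) \<le> (\<Sum>i\<in>UNIV. \<bar>(A *v x) $ i\<bar>)" by (rule norm_le_l1_cart)
  also have "\<dots> \<le> (\<Sum>i\<in>(UNIV::'p set). norm A * norm x)"
  proof (rule sum_mono)
    fix i
    have "\<bar>(A *v x) $ i\<bar> = \<bar>A $ i \<bullet> x\<bar>" by (simp add: matrix_vector_mul_component)
    also have "\<dots> \<le> norm (A $ i) * norm x" by (rule Cauchy_Schwarz_ineq2)
    also have "\<dots> \<le> norm A * norm x" by (intro mult_right_mono Finite_Cartesian_Product.norm_nth_le) auto
    finally show "\<bar>(A *v x) $ i\<bar> \<le> norm A * norm x" .
  qed
  finally show ?thesis by simp
qed

lemma abs_exp_diff_le:
  fixes a b c :: real
  assumes "a \<le> c" "b \<le> c"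
  shows "\<bar>exp a - exp b\<bar> \<le> exp c * \<bar>a - b\<bar>"
proof -
  have *: "exp y - exp x \<le> exp c * (y - x)" if "x \<le> y" "y \<le> c" for x y :: real
  proof -
    have "exp y - exp x = exp y * (1 - exp (x - y))" by (simp add: algebra_simps exp_add[symmetric])
    also have "\<dots> \<le> exp y * (y - x)"
    proof (rule mult_left_mono)
      show "1 - exp (x - y) \<le> y - x" using exp_ge_add_one_self[of "x - y"] by linarith
    qed simp
    also have "\<dots> \<le> exp c * (y - x)" by (rule mult_right_mono) (use that in auto)
    finally show ?thesis .
  qed
  show ?thesis
  proof (cases "a \<le> b")
    case True
    then show ?thesis using *[OF True assms(2)] by (simp add: abs_if)
  next
    case False
    then show ?thesis using *[of b a] assms(1) by (simp add: abs_if)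
  qed
qed

text \<open>The segment from \<open>0\<close> to \<open>u\<close> is divided into \<open>m\<close> steps of length at most \<open>\<delta>\<close>.\<close>

lemma chain_bound:
  fixes f :: "'n::real_normed_vector \<Rightarrow> real"
  assumes m: "c \<le> real m * \<delta>" and f0: "f 0 = 0" and u: "norm u < c"
    and step: "\<And>u v. norm u < c \<Longrightarrow> norm v < c \<Longrightarrow> norm (v - u) \<le> \<delta> \<Longrightarrow> \<bar>f v - f u\<bar> \<le> 1"
  shows "\<bar>f u\<bar> \<le> real m"
proof -
  have c: "0 < c" using u norm_ge_zero[of u] by linarith
  have m0: "0 < m" using m c by (cases m) auto
  have "\<bar>f ((real j / real m) *\<^sub>R u)\<bar> \<le> real j" if "j \<le> m" for j
    using that
  proof (induction j)
    case 0
    then show ?case by (simp add: f0)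
  next
    case (Suc j)
    have lt: "norm ((real i / real m) *\<^sub>R u) < c" if "i \<le> m" for i
    proof -
      have "norm ((real i / real m) *\<^sub>R u) = real i / real m * norm u" using m0 by simp
      also have "\<dots> \<le> 1 * norm u" by (rule mult_right_mono) (use that m0 in auto)
      finally show ?thesis using u by simp
    qed
    have "(real (Suc j) / real m) *\<^sub>R u - (real j / real m) *\<^sub>R u = (1 / real m) *\<^sub>R u"
      by (simp add: scaleR_diff_left[symmetric] diff_divide_distrib[symmetric])
    then have "norm ((real (Suc j) / real m) *\<^sub>R u - (real j / real m) *\<^sub>R u) = norm u / real m"
      using m0 by simp
    also have "\<dots> \<le> \<delta>" using u m m0 by (simp add: field_simps)
    finally have le: "norm ((real (Suc j) / real m) *\<^sub>R u - (real j / real m) *\<^sub>R u) \<le> \<delta>" .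
    have "\<bar>f ((real (Suc j) / real m) *\<^sub>R u) - f ((real j / real m) *\<^sub>R u)\<bar> \<le> 1"
      by (rule step[OF lt lt le]) (use Suc.prems in auto)
    moreover have "\<bar>f ((real j / real m) *\<^sub>R u)\<bar> \<le> real j" using Suc by simp
    ultimately show ?case by simp
  qed
  from this[of m] show ?thesis using m0 by simp
qed

text \<open>The random field \<open>H\<close>, the extended likelihood ratio \<open>Zf\<close> and a maximum likelihood estimator \<open>\<theta>h\<close> at
  one fixed time.\<close>

locale qle_field = prob_space M for M :: "'a measure" +
  fixes \<Theta> :: "(real^'p) set" and \<theta>s :: "real^'p" and H :: "'a \<Rightarrow> real^'p \<Rightarrow> real"
    and A :: "real^'p^'p" and Zf :: "'a \<Rightarrow> (real^'p) \<Rightarrow>\<^sub>C real" and \<theta>h :: "'a \<Rightarrow> real^'p"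
  assumes open_\<Theta>: "open \<Theta>" and bounded_\<Theta>: "bounded \<Theta>" and \<theta>s_in: "\<theta>s \<in> \<Theta>"
    and H_cont: "\<And>\<omega>. \<omega> \<in> space M \<Longrightarrow> continuous_on (closure \<Theta>) (H \<omega>)"
    and A_inv: "invertible A"
    and Zf_U: "\<And>\<omega> u. \<omega> \<in> space M \<Longrightarrow> u \<in> U_dom \<Theta> \<theta>s A \<Longrightarrow>
      apply_bcontfun (Zf \<omega>) u = exp (H \<omega> (theta_dag \<theta>s A u) - H \<omega> \<theta>s)"
    and Zf_meas: "(\<lambda>(\<omega>, u). apply_bcontfun (Zf \<omega>) u) \<in> borel_measurable (M \<Otimes>\<^sub>M borel)"
    and Zf_nonneg: "\<And>\<omega> u. \<omega> \<in> space M \<Longrightarrow> 0 \<le> apply_bcontfun (Zf \<omega>) u"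
    and Zf_supp: "\<And>\<omega>. \<omega> \<in> space M \<Longrightarrow> compact (closure {u. apply_bcontfun (Zf \<omega>) u \<noteq> 0})"
    and Zf_bd: "\<And>\<omega>. \<omega> \<in> space M \<Longrightarrow>
      (SUP u\<in>- U_dom \<Theta> \<theta>s A. apply_bcontfun (Zf \<omega>) u)
        \<le> (SUP u\<in>frontier (U_dom \<Theta> \<theta>s A). apply_bcontfun (Zf \<omega>) u)"
    and \<theta>h_meas: "\<theta>h \<in> measurable M (restrict_space borel (closure \<Theta>))"
    and \<theta>h_max: "\<And>\<omega> \<theta>. \<omega> \<in> space M \<Longrightarrow> \<theta> \<in> closure \<Theta> \<Longrightarrow> H \<omega> \<theta> \<le> H \<omega> (\<theta>h \<omega>)"
begin

abbreviation U where "U \<equiv> U_dom \<Theta> \<theta>s A"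
abbreviation V where "V \<equiv> V_dom \<Theta> \<theta>s A"
abbreviation z where "z \<omega> \<equiv> apply_bcontfun (Zf \<omega>)"

definition rescale :: "real^'p \<Rightarrow> real^'p" where "rescale \<theta> = matrix_inv A *v (\<theta> - \<theta>s)"
definition uh :: "'a \<Rightarrow> real^'p" where "uh \<omega> = rescale (\<theta>h \<omega>)"

lemma rescale_theta: "rescale (theta_dag \<theta>s A u) = u" and theta_rescale: "theta_dag \<theta>s A (rescale \<theta>) = \<theta>"
proof -
  have "A ** matrix_inv A = mat 1" "matrix_inv A ** A = mat 1"
    using someI_ex[OF A_inv[unfolded invertible_def]] by (simp_all add: matrix_inv_def)
  then show "rescale (theta_dag \<theta>s A u) = u" "theta_dag \<theta>s A (rescale \<theta>) = \<theta>"
    by (simp_all add: rescale_def theta_dag_def matrix_vector_mul_assoc)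
qed

lemma continuous_theta: "continuous_on S (theta_dag \<theta>s A)"
  unfolding theta_dag_def[abs_def] by (intro continuous_intros)

lemma continuous_rescale: "continuous_on S rescale"
  unfolding rescale_def[abs_def]
  by (rule continuous_on_compose2[OF matrix_vector_mult_linear_continuous_on[of UNIV]]) (auto intro: continuous_intros)

lemma open_U: "open U"
  using open_vimage[OF open_\<Theta> continuous_theta] by (simp add: U_dom_def vimage_def)

lemma U_eq: "U = rescale ` \<Theta>"
  unfolding U_dom_def using rescale_theta theta_rescale by (auto simp: image_iff) metis

lemma bounded_rescale_closure: "bounded (rescale ` closure \<Theta>)"
  by (rule compact_imp_bounded, rule compact_continuous_image[OF continuous_rescale])
     (use bounded_\<Theta> compact_closure in blast)

lemma bounded_U: "bounded U"
  using bounded_rescale_closure by (rule bounded_subset) (use U_eq closure_subset in auto)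

lemma zero_in_U: "0 \<in> U"
  by (simp add: U_dom_def theta_dag_def \<theta>s_in)

lemma U_not_UNIV: "U \<noteq> UNIV"
  using bounded_U not_bounded_UNIV by metis

lemma z_zero: "\<omega> \<in> space M \<Longrightarrow> z \<omega> 0 = 1"
  using Zf_U[OF _ zero_in_U] by (simp add: theta_dag_def)

lemma z_pos: "\<omega> \<in> space M \<Longrightarrow> u \<in> U \<Longrightarrow> 0 < z \<omega> u"
  by (simp add: Zf_U)

lemma rescale_in_closure_U: "\<theta> \<in> closure \<Theta> \<Longrightarrow> rescale \<theta> \<in> closure U"
  using image_closure_subset[OF continuous_rescale closed_closure, of \<Theta> U] closure_subset[of U] U_eq by blast

text \<open>The formula for the likelihood ratio extends by continuity from the domain to its closure, which is
  where the estimator lives.\<close>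

lemma z_rescale:
  assumes \<omega>: "\<omega> \<in> space M" and \<theta>: "\<theta> \<in> closure \<Theta>"
  shows "z \<omega> (rescale \<theta>) = exp (H \<omega> \<theta> - H \<omega> \<theta>s)"
proof -
  obtain x where x: "\<And>n. x n \<in> \<Theta>" "x \<longlonglongrightarrow> \<theta>" using \<theta> closure_sequential by blast
  have xc: "x n \<in> closure \<Theta>" for n using x(1) closure_subset by blast
  have "(\<lambda>n. z \<omega> (rescale (x n))) \<longlonglongrightarrow> z \<omega> (rescale \<theta>)"
  proof (rule continuous_on_tendsto_compose[of UNIV "z \<omega>"])
    show "(\<lambda>n. rescale (x n)) \<longlonglongrightarrow> rescale \<theta>"
      by (rule continuous_on_tendsto_compose[OF continuous_rescale[of UNIV] x(2)]) auto
  qed auto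
  moreover have "(\<lambda>n. exp (H \<omega> (x n) - H \<omega> \<theta>s)) \<longlonglongrightarrow> exp (H \<omega> \<theta> - H \<omega> \<theta>s)"
    by (intro tendsto_intros continuous_on_tendsto_compose[OF H_cont[OF \<omega>] x(2) \<theta>]) (use xc in auto)
  moreover have "z \<omega> (rescale (x n)) = exp (H \<omega> (x n) - H \<omega> \<theta>s)" for n
    using Zf_U[OF \<omega>, of "rescale (x n)"] x(1)[of n] by (simp add: U_eq theta_rescale)
  ultimately show ?thesis using LIMSEQ_unique by simp
qed

lemma \<theta>h_in: "\<omega> \<in> space M \<Longrightarrow> \<theta>h \<omega> \<in> closure \<Theta>"
  using measurable_space[OF \<theta>h_meas] by (auto simp: space_restrict_space)

lemma uh_in_closure: "\<omega> \<in> space M \<Longrightarrow> uh \<omega> \<in> closure U"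
  unfolding uh_def by (rule rescale_in_closure_U[OF \<theta>h_in])

text \<open>On the closure of the domain this is the maximum property of the estimator. Outside the domain the
  path is dominated by its values on the frontier, which belongs to that closure.\<close>

lemma uh_maximizes:
  assumes \<omega>: "\<omega> \<in> space M" shows "maximizes (z \<omega>) (uh \<omega>)"
  unfolding maximizes_def
proof
  fix v
  have inU: "z \<omega> u \<le> z \<omega> (uh \<omega>)" if "u \<in> U" for u
  proof -
    have "theta_dag \<theta>s A u \<in> closure \<Theta>" using that closure_subset by (auto simp: U_dom_def)
    then show ?thesis
      using \<theta>h_max[OF \<omega>] by (simp add: Zf_U[OF \<omega> that] uh_def z_rescale[OF \<omega> \<theta>h_in[OF \<omega>]])
  qed
  have clU: "z \<omega> u \<le> z \<omega> (uh \<omega>)" if "u \<in> closure U" for u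
    by (rule continuous_le_on_closure_bcontfun[OF inU that])
  show "z \<omega> v \<le> z \<omega> (uh \<omega>)"
  proof (cases "v \<in> U")
    case False
    then have "z \<omega> v \<le> (SUP u\<in>- U. z \<omega> u)" by (intro cSUP_upper bdd_above_bcontfun) auto
    also have "\<dots> \<le> (SUP u\<in>frontier U. z \<omega> u)" by (rule Zf_bd[OF \<omega>])
    also have "\<dots> \<le> z \<omega> (uh \<omega>)"
    proof (rule cSUP_least)
      show "frontier U \<noteq> {}" using zero_in_U U_not_UNIV by (auto simp: frontier_eq_empty)
    qed (use clU in \<open>auto simp: frontier_def\<close>)
    finally show ?thesis .
  qed (rule inU)
qed

lemma uh_measurable: "uh \<in> borel_measurable M"
proof -
  have "\<theta>h \<in> borel_measurable M" using \<theta>h_meas by (simp add: measurable_restrict_space2_iff)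
  then show ?thesis unfolding uh_def[abs_def]
    by (rule measurable_compose[OF _ borel_measurable_continuous_onI[OF continuous_rescale]])
qed

lemma uh_bounded: obtains B where "\<And>\<omega>. \<omega> \<in> space M \<Longrightarrow> norm (uh \<omega>) \<le> B"
proof -
  obtain B where "\<forall>x\<in>rescale ` closure \<Theta>. norm x \<le> B" using bounded_rescale_closure by (auto simp: bounded_iff)
  then show ?thesis using \<theta>h_in by (intro that[of B]) (auto simp: uh_def)
qed

lemma Zf_C_hat:
  assumes "\<omega> \<in> space M" shows "Zf \<omega> \<in> C_hat"
proof -
  obtain B where B: "\<forall>u\<in>closure {u. z \<omega> u \<noteq> 0}. norm u \<le> B"
    using compact_imp_bounded[OF Zf_supp[OF assms]] by (auto simp: bounded_iff)
  have "z \<omega> u = 0" if "B + 1 \<le> norm u" for u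
    using B that closure_subset[of "{u. z \<omega> u \<noteq> 0}"] by force
  then have "\<forall>\<^sub>F u in at_infinity. z \<omega> u = 0" by (auto simp: eventually_at_infinity)
  then show ?thesis by (simp add: C_hat_def tendsto_eventually)
qed

lemma z_coord[measurable]: "(\<lambda>\<omega>. z \<omega> u) \<in> borel_measurable M"
  using measurable_compose[OF measurable_Pair2'[of u borel M] Zf_meas] by simp

lemma near_V:
  assumes v: "v \<in> closure U" and r: "r < norm v"
  shows "v \<in> closure (V r)"
proof -
  have "open {u :: real^'p. r < norm u}" by (intro open_Collect_less continuous_intros)
  then have "{u. r < norm u} \<inter> closure U \<subseteq> closure ({u. r < norm u} \<inter> U)"
    by (rule open_Int_closure_subset)
  moreover have "{u. r < norm u} \<inter> U \<subseteq> V r" by (auto simp: V_dom_def)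
  ultimately show ?thesis using v r closure_mono by blast
qed

lemma z_le_sup_V:
  assumes "v \<in> closure (V r)"
  shows "z \<omega> v \<le> sup_or_zero (z \<omega>) (V r)"
proof -
  have "V r \<noteq> {}" using assms by auto
  then have "z \<omega> u \<le> sup_or_zero (z \<omega>) (V r)" if "u \<in> V r" for u
    using that by (auto simp: sup_or_zero_def intro!: cSUP_upper bdd_above_bcontfun)
  then show ?thesis by (rule continuous_le_on_closure_bcontfun[OF _ assms])
qed

text \<open>If the ball of radius \<open>r\<close> lies in the domain, then all frontier points are farther out than \<open>r\<close> and
  are limits of points of \<open>V r\<close>, so they are covered by the supremum over \<open>V r\<close>.\<close>

lemma tail_le_sup_V:
  assumes \<omega>: "\<omega> \<in> space M" and r: "\<And>u. norm u \<le> r \<Longrightarrow> u \<in> U" and u: "r \<le> norm u"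
  shows "z \<omega> u \<le> sup_or_zero (z \<omega>) (V r)"
proof (cases "u \<in> U")
  case True
  then have "u \<in> V r" using u by (auto simp: V_dom_def)
  then show ?thesis using closure_subset by (intro z_le_sup_V) auto
next
  case False
  then have "z \<omega> u \<le> (SUP u\<in>- U. z \<omega> u)" by (intro cSUP_upper bdd_above_bcontfun) auto
  also have "\<dots> \<le> (SUP u\<in>frontier U. z \<omega> u)" by (rule Zf_bd[OF \<omega>])
  also have "\<dots> \<le> sup_or_zero (z \<omega>) (V r)"
  proof (rule cSUP_least)
    show "frontier U \<noteq> {}" using zero_in_U U_not_UNIV by (auto simp: frontier_eq_empty)
    fix v assume v: "v \<in> frontier U"
    then have "v \<notin> U" using frontier_disjoint_eq[of U] open_U by auto
    then have "r < norm v" using r by (meson not_le)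
    then show "z \<omega> v \<le> sup_or_zero (z \<omega>) (V r)"
      using v by (intro z_le_sup_V near_V) (auto simp: frontier_def)
  qed
  finally show ?thesis .
qed

text \<open>The path has the value \<open>1\<close> at \<open>0\<close>, hence at least this value at its maximizer.\<close>

lemma uh_large:
  assumes \<omega>: "\<omega> \<in> space M" and r: "r < norm (uh \<omega>)"
  shows "1 \<le> sup_or_zero (z \<omega>) (V r)"
proof -
  have "1 = z \<omega> 0" by (simp add: z_zero[OF \<omega>])
  also have "\<dots> \<le> z \<omega> (uh \<omega>)" using uh_maximizes[OF \<omega>] by (simp add: maximizes_def)
  also have "\<dots> \<le> sup_or_zero (z \<omega>) (V r)" by (intro z_le_sup_V near_V uh_in_closure \<omega> r)
  finally show ?thesis .
qed

text \<open>By continuity the supremum may be taken over a countable dense subset.\<close>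

lemma sup_or_zero_measurable[measurable]: "(\<lambda>\<omega>. sup_or_zero (z \<omega>) S) \<in> borel_measurable M"
proof (cases "S = {}")
  case False
  obtain D where D: "countable D" "D \<subseteq> S" "S \<subseteq> closure D" using separable by blast
  have ne: "D \<noteq> {}" using D False by auto
  have "(SUP u\<in>S. z \<omega> u) = (SUP u\<in>D. z \<omega> u)" for \<omega>
  proof (rule antisym)
    show "(SUP u\<in>S. z \<omega> u) \<le> (SUP u\<in>D. z \<omega> u)"
    proof (rule cSUP_least[OF False])
      fix u assume "u \<in> S"
      then have "u \<in> closure D" using D by auto
      then show "z \<omega> u \<le> (SUP u\<in>D. z \<omega> u)"
        by (rule continuous_le_on_closure_bcontfun[rotated]) (intro cSUP_upper bdd_above_bcontfun)
    qed
    show "(SUP u\<in>D. z \<omega> u) \<le> (SUP u\<in>S. z \<omega> u)"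
      by (rule cSUP_subset_mono[OF ne bdd_above_bcontfun D(2)]) auto
  qed
  moreover have "(\<lambda>\<omega>. SUP u\<in>D. z \<omega> u) \<in> borel_measurable M"
    by (rule borel_measurable_cSUP[OF D(1)]) (use bdd_above_bcontfun in auto)
  ultimately show ?thesis using False by (simp add: sup_or_zero_def)
qed (simp add: sup_or_zero_def)

lemma S_event_measurable:
  "e \<in> borel_measurable M \<Longrightarrow> S_event M z S e \<in> sets M"
  unfolding S_event_def by measurable

abbreviation B where "B \<equiv> B_dom \<Theta> \<theta>s A"

lemma log_z_bounded:
  assumes \<omega>: "\<omega> \<in> space M"
  obtains K where "\<And>u. u \<in> U \<Longrightarrow> \<bar>ln (z \<omega> u)\<bar> \<le> K"
proof -
  have "compact (H \<omega> ` closure \<Theta>)"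
    by (rule compact_continuous_image[OF H_cont[OF \<omega>]]) (use bounded_\<Theta> compact_closure in blast)
  then obtain K where K: "\<forall>x\<in>H \<omega> ` closure \<Theta>. norm x \<le> K"
    using compact_imp_bounded by (metis bounded_iff)
  show ?thesis
  proof (rule that[of "K + K"])
    fix u assume u: "u \<in> U"
    then have "theta_dag \<theta>s A u \<in> closure \<Theta>" "\<theta>s \<in> closure \<Theta>"
      using closure_subset \<theta>s_in by (auto simp: U_dom_def)
    then have "\<bar>H \<omega> (theta_dag \<theta>s A u)\<bar> \<le> K" "\<bar>H \<omega> \<theta>s\<bar> \<le> K" using K by auto
    then show "\<bar>ln (z \<omega> u)\<bar> \<le> K + K" by (simp add: Zf_U[OF \<omega> u])
  qed
qed

text \<open>The supremum in \<open>log_modulus\<close> is a genuine one: the set is nonempty, and bounded because \<open>H\<close> is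
  bounded on the compact closure of the parameter set.\<close>

lemma W_event_iff:
  assumes \<omega>: "\<omega> \<in> space M" and c: "0 < c" and \<delta>: "0 < \<delta>"
  shows "\<omega> \<in> W_event M z (B c) \<delta> \<epsilon> \<longleftrightarrow>
    (\<exists>u1\<in>B c. \<exists>u2\<in>B c. norm (u2 - u1) \<le> \<delta> \<and> \<epsilon> < \<bar>ln (z \<omega> u2) - ln (z \<omega> u1)\<bar>)"
proof -
  let ?X = "{\<bar>ln (z \<omega> u2) - ln (z \<omega> u1)\<bar> |u1 u2. u1 \<in> B c \<and> u2 \<in> B c \<and> norm (u2 - u1) \<le> \<delta>}"
  obtain K where K: "\<And>u. u \<in> U \<Longrightarrow> \<bar>ln (z \<omega> u)\<bar> \<le> K" using log_z_bounded[OF \<omega>] by blast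
  have BU: "B c \<subseteq> U" by (auto simp: B_dom_def U_dom_def)
  have "0 \<in> B c" using c zero_in_U by (auto simp: B_dom_def U_dom_def)
  then have ne: "?X \<noteq> {}" using \<delta> by (auto intro!: exI[of _ 0])
  have bd: "bdd_above ?X"
  proof (rule bdd_aboveI[of _ "K + K"])
    fix x assume "x \<in> ?X"
    then obtain u1 u2 where x: "x = \<bar>ln (z \<omega> u2) - ln (z \<omega> u1)\<bar>" "u1 \<in> B c" "u2 \<in> B c" by blast
    then have "\<bar>ln (z \<omega> u1)\<bar> \<le> K" "\<bar>ln (z \<omega> u2)\<bar> \<le> K" using BU K by auto
    then show "x \<le> K + K" unfolding x(1) by linarith
  qed
  have "\<omega> \<in> W_event M z (B c) \<delta> \<epsilon> \<longleftrightarrow> \<epsilon> < Sup ?X" using \<omega> by (simp add: W_event_def log_modulus_def)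
  also have "\<dots> \<longleftrightarrow> (\<exists>x\<in>?X. \<epsilon> < x)" by (rule less_cSup_iff[OF ne bd])
  finally show ?thesis by blast
qed

text \<open>The pairs of points at distance at most \<open>\<delta>\<close> form a separable space, and the strict inequality is an
  open condition on them, so countably many pairs suffice.\<close>

lemma W_event_measurable:
  assumes c: "0 < c" and \<delta>: "0 < \<delta>"
  shows "W_event M z (B c) \<delta> \<epsilon> \<in> sets M"
proof -
  define S where "S = {(u1, u2). u1 \<in> B c \<and> u2 \<in> B c \<and> norm (u2 - u1) \<le> \<delta>}"
  obtain D where D: "countable D" "D \<subseteq> S" "S \<subseteq> closure D" using separable by blast
  have BU: "B c \<subseteq> U" by (auto simp: B_dom_def U_dom_def)
  have "W_event M z (B c) \<delta> \<epsilon> = (\<Union>(u1, u2)\<in>D. {\<omega> \<in> space M. \<epsilon> < \<bar>ln (z \<omega> u2) - ln (z \<omega> u1)\<bar>})"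
  proof (intro set_eqI iffI)
    fix \<omega> assume W: "\<omega> \<in> W_event M z (B c) \<delta> \<epsilon>"
    then have \<omega>: "\<omega> \<in> space M" by (simp add: W_event_def)
    obtain u1 u2 where u: "u1 \<in> B c" "u2 \<in> B c" "norm (u2 - u1) \<le> \<delta>" "\<epsilon> < \<bar>ln (z \<omega> u2) - ln (z \<omega> u1)\<bar>"
      using W W_event_iff[OF \<omega> c \<delta>] by blast
    then have "(u1, u2) \<in> closure D" using D(3) by (auto simp: S_def)
    then obtain p where p: "\<And>n. p n \<in> D" "p \<longlonglongrightarrow> (u1, u2)" using closure_sequential by metis
    have pos: "z \<omega> u1 \<noteq> 0" "z \<omega> u2 \<noteq> 0" using u BU z_pos[OF \<omega>] by force+
    have "(\<lambda>n. \<bar>ln (z \<omega> (snd (p n))) - ln (z \<omega> (fst (p n)))\<bar>) \<longlonglongrightarrow> \<bar>ln (z \<omega> u2) - ln (z \<omega> u1)\<bar>"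
      using tendsto_fst[OF p(2)] tendsto_snd[OF p(2)] pos
      by (intro tendsto_intros continuous_on_tendsto_compose[of UNIV "z \<omega>"]) auto
    then have "\<forall>\<^sub>F n in sequentially. \<epsilon> < \<bar>ln (z \<omega> (snd (p n))) - ln (z \<omega> (fst (p n)))\<bar>"
      by (rule order_tendstoD(1)) (rule u(4))
    then obtain n where "\<epsilon> < \<bar>ln (z \<omega> (snd (p n))) - ln (z \<omega> (fst (p n)))\<bar>" by (auto simp: eventually_sequentially)
    then show "\<omega> \<in> (\<Union>(u1, u2)\<in>D. {\<omega> \<in> space M. \<epsilon> < \<bar>ln (z \<omega> u2) - ln (z \<omega> u1)\<bar>})"
      using p(1)[of n] \<omega> by (auto intro!: bexI[of _ "p n"] simp: case_prod_beta)
  next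
    fix \<omega> assume "\<omega> \<in> (\<Union>(u1, u2)\<in>D. {\<omega> \<in> space M. \<epsilon> < \<bar>ln (z \<omega> u2) - ln (z \<omega> u1)\<bar>})"
    then obtain u1 u2 where u: "(u1, u2) \<in> D" and \<omega>: "\<omega> \<in> space M" and e: "\<epsilon> < \<bar>ln (z \<omega> u2) - ln (z \<omega> u1)\<bar>" by auto
    have "u1 \<in> B c" "u2 \<in> B c" "norm (u2 - u1) \<le> \<delta>" using u D(2) by (auto simp: S_def)
    then show "\<omega> \<in> W_event M z (B c) \<delta> \<epsilon>" using e W_event_iff[OF \<omega> c \<delta>] by blast
  qed
  also have "\<dots> \<in> sets M"
    by (rule sets.countable_UN''[OF D(1)]) (auto split: prod.splits)
  finally show ?thesis .
qed

text \<open>Outside the first event the logarithm of the field is bounded by \<open>m\<close> on the ball, by a chain starting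
  at \<open>0\<close>. On such values the exponential function is Lipschitz with constant \<open>exp m\<close>, which the
  threshold of the second event compensates.\<close>

lemma modulus_bound:
  assumes \<omega>: "\<omega> \<in> space M" and c: "0 < c" and U: "\<And>u. norm u < c \<Longrightarrow> u \<in> U"
    and \<delta>: "0 < \<delta>" "0 < \<delta>'" and m: "c \<le> real m * \<delta>"
    and W: "\<omega> \<notin> W_event M z (B c) \<delta> 1" and W': "\<omega> \<notin> W_event M z (B c) \<delta>' (e * exp (- real m))"
    and u: "norm u < c" "norm v < c" "norm (v - u) \<le> \<delta>'"
  shows "\<bar>z \<omega> v - z \<omega> u\<bar> \<le> e"
proof -
  have inB: "u \<in> B c" if "norm u < c" for u using U[OF that] that by (auto simp: B_dom_def U_dom_def)
  have lz: "\<bar>ln (z \<omega> u)\<bar> \<le> real m" if "norm u < c" for u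
  proof (rule chain_bound[where f="\<lambda>u. ln (z \<omega> u)", OF m _ that])
    show "ln (z \<omega> 0) = 0" by (simp add: z_zero[OF \<omega>])
    show "\<bar>ln (z \<omega> v) - ln (z \<omega> u)\<bar> \<le> 1" if "norm u < c" "norm v < c" "norm (v - u) \<le> \<delta>" for u v
      using W inB that W_event_iff[OF \<omega> c \<delta>(1), of 1] by (meson not_le)
  qed
  have d: "\<bar>ln (z \<omega> v) - ln (z \<omega> u)\<bar> \<le> e * exp (- real m)"
    using W' inB u W_event_iff[OF \<omega> c \<delta>(2), of "e * exp (- real m)"] by (meson not_le)
  have ez: "z \<omega> u = exp (ln (z \<omega> u))" if "norm u < c" for u
    using z_pos[OF \<omega> U[OF that]] by simp
  have "\<bar>z \<omega> v - z \<omega> u\<bar> = \<bar>exp (ln (z \<omega> v)) - exp (ln (z \<omega> u))\<bar>" using ez u by metis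
  also have "\<dots> \<le> exp (real m) * \<bar>ln (z \<omega> v) - ln (z \<omega> u)\<bar>"
    by (rule abs_exp_diff_le) (use lz u in \<open>auto simp: abs_le_iff\<close>)
  also have "\<dots> \<le> exp (real m) * (e * exp (- real m))" by (intro mult_left_mono d) auto
  also have "\<dots> = e" by (simp add: exp_minus field_simps)
  finally show ?thesis .
qed

end

section \<open>Tightness and moments along a sequence of times\<close>

lemma geometric_tail_le:
  fixes \<rho> :: real
  assumes "0 \<le> \<rho>" "\<rho> < 1"
  shows "(\<Sum>j=J..<N. \<rho> ^ j) \<le> \<rho> ^ J / (1 - \<rho>)"
proof (cases "J \<le> N")
  case True
  have "(1 - \<rho>) * (\<Sum>j=J..<N. \<rho> ^ j) = \<rho> ^ J - \<rho> ^ N"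
    using True
  proof (induction N rule: dec_induct)
    case (step n)
    have "(1 - \<rho>) * (\<Sum>j=J..<Suc n. \<rho> ^ j) = (1 - \<rho>) * (\<Sum>j=J..<n. \<rho> ^ j) + (1 - \<rho>) * \<rho> ^ n"
      using step.hyps by (simp add: distrib_left)
    then show ?case using step.IH by (simp add: left_diff_distrib)
  qed simp
  then have "(1 - \<rho>) * (\<Sum>j=J..<N. \<rho> ^ j) \<le> \<rho> ^ J" using assms by simp
  then show ?thesis using assms by (simp add: field_simps)
qed (use assms in auto)

context conditioning
begin

lemma cond_expect_const: "AE \<omega> in M. E (\<lambda>_. c) \<omega> = c"
  using cond_expect_base[OF bounded_rv_const, of c] by simp

lemma cond_expect_sum:
  assumes "finite I" "\<And>i. i \<in> I \<Longrightarrow> bounded_rv N (W i)"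
  shows "AE \<omega> in M. E (\<lambda>w. \<Sum>i\<in>I. c i * W i w) \<omega> = (\<Sum>i\<in>I. c i * E (W i) \<omega>)"
  using assms
proof (induction I rule: finite_induct)
  case empty
  show ?case using cond_expect_const[of 0] by simp
next
  case (insert i I)
  have b: "bounded_rv N (W i)" "bounded_rv N (\<lambda>w. \<Sum>i\<in>I. c i * W i w)"
    using insert.prems by (auto intro!: bounded_rv_sum bounded_rv_cmult)
  have "AE \<omega> in M. E (\<lambda>w. \<Sum>i\<in>I. c i * W i w) \<omega> = (\<Sum>i\<in>I. c i * E (W i) \<omega>)"
    using insert by auto
  moreover have "AE \<omega> in M. E (\<lambda>w. c i * W i w + 1 * (\<Sum>i\<in>I. c i * W i w)) \<omega> = c i * E (W i) \<omega> + 1 * E (\<lambda>w. \<Sum>i\<in>I. c i * W i w) \<omega>"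
    by (rule cond_expect_lin[OF b])
  ultimately show ?case by eventually_elim (use insert.hyps in simp)
qed

lemma cond_integrable_bounded:
  assumes W: "bounded_rv N W" shows "AE \<omega> in M. cond_integrable N \<pi> C W \<omega>"
proof -
  obtain c where c: "W \<in> borel_measurable N" "\<And>w. w \<in> space N \<Longrightarrow> \<bar>W w\<bar> \<le> c"
    using W by (rule bounded_rvE) blast
  have m: "(\<lambda>w. min \<bar>W w\<bar> (real j)) \<in> borel_measurable N" for j using c(1) by measurable
  have "AE \<omega> in M. \<bar>E (\<lambda>w. min \<bar>W w\<bar> (real j)) \<omega>\<bar> \<le> c" for j
    by (rule cond_expect_abs_le[OF m]) (use c(2) in \<open>force simp: min_def\<close>)
  then have "AE \<omega> in M. \<forall>j. \<bar>E (\<lambda>w. min \<bar>W w\<bar> (real j)) \<omega>\<bar> \<le> c" by (simp add: AE_all_countable)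
  with cond_expect_truncation[OF c(1)] show ?thesis
    by eventually_elim (auto simp: abs_le_iff)
qed

lemma cond_prob_01:
  assumes "A \<in> sets N" shows "AE \<omega> in M. 0 \<le> E (indicator A) \<omega> \<and> E (indicator A) \<omega> \<le> 1"
proof -
  note b = bounded_rv_indicator[OF assms]
  have "AE \<omega> in M. E (\<lambda>_. 0) \<omega> \<le> E (indicator A) \<omega>"
    by (rule cond_expect_mono[OF bounded_rv_const b]) auto
  moreover have "AE \<omega> in M. E (indicator A) \<omega> \<le> E (\<lambda>_. 1) \<omega>"
    by (rule cond_expect_mono[OF b bounded_rv_const]) (auto simp: indicator_def)
  ultimately show ?thesis using cond_expect_const[of 0] cond_expect_const[of 1]
    by eventually_elim auto
qed

end

text \<open>The situation along one sequence of times. The conditions on \<open>\<epsilon>\<close> and the two families of events are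
  the polynomial estimate and the asymptotic equicontinuity of the logarithm of the field.\<close>

locale qle_sequence = stable_conditioning M N \<pi> C G
  for M :: "'a measure" and N :: "'b measure" and \<pi> and C and G +
  fixes \<Theta> :: "(real^'p) set" and \<theta>s :: "real^'p" and Hn :: "nat \<Rightarrow> 'a \<Rightarrow> real^'p \<Rightarrow> real"
    and An :: "nat \<Rightarrow> real^'p^'p" and Zn :: "nat \<Rightarrow> 'a \<Rightarrow> (real^'p) \<Rightarrow>\<^sub>C real" and \<theta>n :: "nat \<Rightarrow> 'a \<Rightarrow> real^'p"
    and \<Psi> :: "nat \<Rightarrow> 'a \<Rightarrow> real" and \<epsilon> :: "nat \<Rightarrow> 'a \<Rightarrow> real" and L :: real
  assumes field: "\<And>n. qle_field M \<Theta> \<theta>s (Hn n) (An n) (Zn n) (\<theta>n n)"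
    and An_lim: "An \<longlonglongrightarrow> 0"
    and \<Psi>_C: "\<And>n. \<Psi> n \<in> borel_measurable C"
    and \<Psi>_01: "\<And>n \<omega>. \<omega> \<in> space M \<Longrightarrow> \<Psi> n \<omega> \<in> {0..1}"
    and \<Psi>_1: "tendsto_in_prob M \<Psi> (\<lambda>_. 1) sequentially"
    and L_pos: "0 < L"
    and \<epsilon>_C: "\<And>r. \<epsilon> r \<in> borel_measurable C"
    and \<epsilon>_lim: "AE \<omega> in M. (\<lambda>r. \<epsilon> r \<omega>) \<longlonglongrightarrow> 0"
    and polynomial: "AE \<omega> in M. (SUP n. SUP r. ereal (real r powr L *
           condit_prob M id C
             (S_event M (\<lambda>\<omega>. apply_bcontfun (Zn n \<omega>)) (V_dom \<Theta> \<theta>s (An n) (real r)) (\<epsilon> r)) \<omega> *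
           \<Psi> n \<omega>)) < \<infinity>"
    and log_continuity: "\<And>e c. 0 < e \<Longrightarrow> 0 < c \<Longrightarrow> tendsto_in_prob M
        (\<lambda>\<delta> \<omega>. real_of_ereal (limsup (\<lambda>n. ereal (
           condit_prob M id C
             (W_event M (\<lambda>\<omega>. apply_bcontfun (Zn n \<omega>)) (B_dom \<Theta> \<theta>s (An n) c) \<delta> e) \<omega> * \<Psi> n \<omega>))))
        (\<lambda>\<omega>. 0) (at_right 0)"
begin

sublocale F: qle_field M \<Theta> \<theta>s "Hn n" "An n" "Zn n" "\<theta>n n" for n
  by (rule field)

lemma \<Psi>_M[measurable]: "\<Psi> n \<in> borel_measurable M"
  by (rule borel_C_M[OF \<Psi>_C])

lemma \<epsilon>_M[measurable]: "\<epsilon> r \<in> borel_measurable M"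
  by (rule borel_C_M[OF \<epsilon>_C])

text \<open>The point \<open>\<theta>s\<close> is interior and \<open>An\<close> tends to \<open>0\<close>.\<close>

lemma ball_in_U: "\<forall>\<^sub>F n in sequentially. \<forall>u. norm u \<le> r \<longrightarrow> u \<in> U_dom \<Theta> \<theta>s (An n)"
proof -
  obtain d where d: "0 < d" "ball \<theta>s d \<subseteq> \<Theta>"
    using F.open_\<Theta> F.\<theta>s_in by (auto simp: open_contains_ball)
  have "(\<lambda>n. real CARD('p) * (norm (An n) * \<bar>r\<bar>)) \<longlonglongrightarrow> real CARD('p) * (norm (0 :: real^'p^'p) * \<bar>r\<bar>)"
    by (intro tendsto_intros An_lim)
  then have "\<forall>\<^sub>F n in sequentially. real CARD('p) * (norm (An n) * \<bar>r\<bar>) < d"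
    using d(1) by (intro order_tendstoD(2)) auto
  then show ?thesis
  proof eventually_elim
    fix n assume n: "real CARD('p) * (norm (An n) * \<bar>r\<bar>) < d"
    show "\<forall>u. norm u \<le> r \<longrightarrow> u \<in> U_dom \<Theta> \<theta>s (An n)"
    proof (intro allI impI)
      fix u :: "real^'p" assume u: "norm u \<le> r"
      have "norm (An n *v u) \<le> real CARD('p) * (norm (An n) * norm u)" by (rule norm_matrix_vector_mult_le)
      also have "\<dots> \<le> real CARD('p) * (norm (An n) * \<bar>r\<bar>)" by (intro mult_left_mono) (use u in auto)
      also note n
      finally have "\<theta>s + An n *v u \<in> ball \<theta>s d" by (simp add: dist_norm)
      then show "u \<in> U_dom \<Theta> \<theta>s (An n)" using d(2) by (auto simp: U_dom_def theta_dag_def)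
    qed
  qed
qed

text \<open>This passes from conditional to unconditional probabilities at the price of the mean of \<open>1 - \<Psi>\<close>: for
  \<open>x\<close> and \<open>y\<close> in the unit interval, \<open>x \<le> x y + (1 - y)\<close>.\<close>

lemma prob_le_cond_prob:
  assumes A: "A \<in> sets M"
  shows "measure M A \<le> (\<integral>\<omega>. min 1 \<bar>EM (indicator A) \<omega> * \<Psi> n \<omega>\<bar> \<partial>M) + (\<integral>\<omega>. min 1 \<bar>\<Psi> n \<omega> - 1\<bar> \<partial>M)"
proof -
  note b = bounded_rv_indicator[OF A]
  have [measurable]: "EM (indicator A) \<in> borel_measurable M"
    by (rule base.cond_expect_measurable_M[OF bounded_rv_measurable[OF b]])
  have i: "integrable M (\<lambda>\<omega>. min 1 \<bar>EM (indicator A) \<omega> * \<Psi> n \<omega>\<bar>)" "integrable M (\<lambda>\<omega>. min 1 \<bar>\<Psi> n \<omega> - 1\<bar>)"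
    by (intro M.bounded_rv_integrable M.bounded_rv_min1, measurable)+
  have "measure M A = (\<integral>\<omega>. EM (indicator A) \<omega> \<partial>M)"
    using A by (simp add: base.cond_expect_total[OF b])
  also have "\<dots> \<le> (\<integral>\<omega>. min 1 \<bar>EM (indicator A) \<omega> * \<Psi> n \<omega>\<bar> + min 1 \<bar>\<Psi> n \<omega> - 1\<bar> \<partial>M)"
  proof (rule integral_mono_AE)
    show "AE \<omega> in M. EM (indicator A) \<omega> \<le> min 1 \<bar>EM (indicator A) \<omega> * \<Psi> n \<omega>\<bar> + min 1 \<bar>\<Psi> n \<omega> - 1\<bar>"
      using base.cond_prob_01[OF A] AE_space
    proof eventually_elim
      fix \<omega> assume p: "0 \<le> EM (indicator A) \<omega> \<and> EM (indicator A) \<omega> \<le> 1" and \<omega>: "\<omega> \<in> space M"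
      define x where "x = EM (indicator A) \<omega>"
      define y where "y = \<Psi> n \<omega>"
      have xy: "0 \<le> x" "x \<le> 1" "0 \<le> y" "y \<le> 1" using p \<Psi>_01[OF \<omega>, of n] by (auto simp: x_def y_def)
      have "0 \<le> (1 - x) * (1 - y)" "0 \<le> x * y" "x * y \<le> 1 * 1"
        using xy by (simp_all add: mult_le_one)
      then have "x \<le> min 1 \<bar>x * y\<bar> + min 1 \<bar>y - 1\<bar>" using xy by (simp add: algebra_simps min_def abs_if)
      then show "EM (indicator A) \<omega> \<le> min 1 \<bar>EM (indicator A) \<omega> * \<Psi> n \<omega>\<bar> + min 1 \<bar>\<Psi> n \<omega> - 1\<bar>"
        by (simp add: x_def y_def)
    qed
  qed (use i base.cond_expect_integrable[OF b] in auto)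
  also have "\<dots> = (\<integral>\<omega>. min 1 \<bar>EM (indicator A) \<omega> * \<Psi> n \<omega>\<bar> \<partial>M) + (\<integral>\<omega>. min 1 \<bar>\<Psi> n \<omega> - 1\<bar> \<partial>M)"
    using i by simp
  finally show ?thesis .
qed

lemma \<Psi>_integral_small: "0 < e \<Longrightarrow> \<forall>\<^sub>F n in sequentially. (\<integral>\<omega>. min 1 \<bar>\<Psi> n \<omega> - 1\<bar> \<partial>M) < e"
  using \<Psi>_1 by (intro order_tendstoD(2)[of _ 0]) (simp_all add: M.tendsto_in_prob_iff_integral)

definition S where "S n r = S_event M (\<lambda>\<omega>. apply_bcontfun (Zn n \<omega>)) (V_dom \<Theta> \<theta>s (An n) (real r)) (\<epsilon> r)"
definition p where "p n r = EM (indicator (S n r))"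

lemma S_sets[measurable]: "S n r \<in> sets M"
  unfolding S_def by (rule F.S_event_measurable) measurable

lemma p_measurable[measurable]: "p n r \<in> borel_measurable M"
  unfolding p_def by (rule base.cond_expect_measurable_M[OF bounded_rv_measurable[OF bounded_rv_indicator]]) measurable

lemma p_nonneg: "AE \<omega> in M. \<forall>n r. 0 \<le> p n r \<omega>"
proof -
  have "AE \<omega> in M. 0 \<le> p n r \<omega>" for n r
    using base.cond_prob_01[OF S_sets[of n r]] unfolding p_def by eventually_elim simp
  then show ?thesis by (simp add: AE_all_countable)
qed

text \<open>The \<open>\<omega>\<close>-wise finite supremum of the hypothesis, as a random but uniform constant.\<close>

lemma polynomial_bound: "AE \<omega> in M. \<exists>K\<ge>0. \<forall>n r. 0 < r \<longrightarrow> p n r \<omega> * \<Psi> n \<omega> \<le> K * real r powr (- L)"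
  using polynomial
proof eventually_elim
  fix \<omega>
  let ?x = "\<lambda>n r. real r powr L * p n r \<omega> * \<Psi> n \<omega>"
  assume "(SUP n. SUP r. ereal (real r powr L * condit_prob M id C
             (S_event M (\<lambda>\<omega>. apply_bcontfun (Zn n \<omega>)) (V_dom \<Theta> \<theta>s (An n) (real r)) (\<epsilon> r)) \<omega> * \<Psi> n \<omega>)) < \<infinity>"
  then have s: "(SUP n. SUP r. ereal (?x n r)) < \<infinity>" by (simp add: condit_prob_def p_def S_def)
  define s where "s = (SUP n. SUP r. ereal (?x n r))"
  have le: "ereal (?x n r) \<le> s" for n r
  proof -
    have "ereal (?x n r) \<le> (SUP r. ereal (?x n r))" by (rule SUP_upper) simp
    also have "\<dots> \<le> s" unfolding s_def by (rule SUP_upper) simp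
    finally show ?thesis .
  qed
  obtain k where k: "s = ereal k"
    using s le[of 0 0] unfolding s_def[symmetric] by (cases s) auto
  show "\<exists>K\<ge>0. \<forall>n r. 0 < r \<longrightarrow> p n r \<omega> * \<Psi> n \<omega> \<le> K * real r powr (- L)"
  proof (intro exI[of _ "\<bar>k\<bar>"] conjI allI impI)
    fix n r :: nat assume r: "0 < r"
    have "?x n r \<le> \<bar>k\<bar>" using le[of r n] k by simp
    then have "?x n r * real r powr (- L) \<le> \<bar>k\<bar> * real r powr (- L)" by (rule mult_right_mono) simp
    moreover have "?x n r * real r powr (- L) = p n r \<omega> * \<Psi> n \<omega>"
      using r by (simp add: powr_minus field_simps)
    ultimately show "p n r \<omega> * \<Psi> n \<omega> \<le> \<bar>k\<bar> * real r powr (- L)" by simp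
  qed simp
qed

lemma powr_neg_L_lim:
  fixes K :: real
  shows "(\<lambda>r. K * real r powr (- L)) \<longlonglongrightarrow> 0"
  using tendsto_mult[OF tendsto_const tendsto_neg_powr[OF _ filterlim_real_sequentially], of "- L" K] L_pos by simp

text \<open>The polynomial estimate is uniform in \<open>n\<close> with a random constant, so the supremum \<open>q r\<close> over \<open>n\<close> of the
  weighted conditional probabilities tends to \<open>0\<close> almost surely as \<open>r \<rightarrow> \<infinity>\<close>, and dominated convergence
  applies to it.\<close>

lemma tail_event_small:
  assumes e: "0 < e"
  shows "\<forall>\<^sub>F r in sequentially. \<forall>\<^sub>F n in sequentially. measure M (S n r) \<le> e"
proof -
  define q where "q r \<omega> = (SUP n. min 1 \<bar>p n r \<omega> * \<Psi> n \<omega>\<bar>)" for r \<omega>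
  have bdd: "bdd_above (range (\<lambda>n. min 1 \<bar>p n r \<omega> * \<Psi> n \<omega>\<bar>))" for r \<omega>
    by (rule bdd_aboveI[of _ 1]) auto
  have q_ge: "min 1 \<bar>p n r \<omega> * \<Psi> n \<omega>\<bar> \<le> q r \<omega>" for n r \<omega>
    unfolding q_def by (rule cSUP_upper[OF UNIV_I bdd])
  have q_le: "q r \<omega> \<le> c" if "\<And>n. min 1 \<bar>p n r \<omega> * \<Psi> n \<omega>\<bar> \<le> c" for r \<omega> c
    unfolding q_def by (rule cSUP_least) (use that in auto)
  have qm[measurable]: "q r \<in> borel_measurable M" for r
    unfolding q_def[abs_def] by (rule borel_measurable_cSUP) (use bdd in auto)
  have q0: "0 \<le> q r \<omega>" for r \<omega> by (rule order_trans[OF _ q_ge[of 0]]) auto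
  have q1: "q r \<omega> \<le> 1" for r \<omega> by (rule q_le) auto
  have "(\<lambda>r. \<integral>\<omega>. q r \<omega> \<partial>M) \<longlonglongrightarrow> (\<integral>\<omega>. 0 \<partial>M)"
  proof (rule integral_dominated_convergence[where w="\<lambda>_. 1"])
    show "AE \<omega> in M. (\<lambda>r. q r \<omega>) \<longlonglongrightarrow> 0"
      using polynomial_bound p_nonneg AE_space
    proof eventually_elim
      fix \<omega> assume "\<exists>K\<ge>0. \<forall>n r. 0 < r \<longrightarrow> p n r \<omega> * \<Psi> n \<omega> \<le> K * real r powr (- L)"
        and nn: "\<forall>n r. 0 \<le> p n r \<omega>" and \<omega>: "\<omega> \<in> space M"
      then obtain K where K: "0 \<le> K" "\<forall>n r. 0 < r \<longrightarrow> p n r \<omega> * \<Psi> n \<omega> \<le> K * real r powr (- L)" by blast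
      have "norm (q r \<omega>) \<le> K * real r powr (- L)" if r: "0 < r" for r
      proof -
        have "q r \<omega> \<le> K * real r powr (- L)"
        proof (rule q_le)
          fix n
          have "0 \<le> p n r \<omega> * \<Psi> n \<omega>" using nn \<Psi>_01[OF \<omega>, of n] by simp
          moreover have "p n r \<omega> * \<Psi> n \<omega> \<le> K * real r powr (- L)" using K r by blast
          ultimately show "min 1 \<bar>p n r \<omega> * \<Psi> n \<omega>\<bar> \<le> K * real r powr (- L)" by linarith
        qed
        then show ?thesis using q0[of r \<omega>] by simp
      qed
      then have "\<forall>\<^sub>F r in sequentially. norm (q r \<omega>) \<le> K * real r powr (- L)"
        using eventually_gt_at_top[of 0] by (rule eventually_mono[rotated])
      then show "(\<lambda>r. q r \<omega>) \<longlonglongrightarrow> 0" by (rule Lim_null_comparison[OF _ powr_neg_L_lim])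
    qed
  qed (use q0 q1 in auto)
  then have "\<forall>\<^sub>F r in sequentially. (\<integral>\<omega>. q r \<omega> \<partial>M) < e / 2"
    using e by (intro order_tendstoD(2)) auto
  then show ?thesis
  proof eventually_elim
    fix r assume r: "(\<integral>\<omega>. q r \<omega> \<partial>M) < e / 2"
    show "\<forall>\<^sub>F n in sequentially. measure M (S n r) \<le> e"
      using \<Psi>_integral_small[OF half_gt_zero[OF e]]
    proof eventually_elim
      fix n assume n: "(\<integral>\<omega>. min 1 \<bar>\<Psi> n \<omega> - 1\<bar> \<partial>M) < e / 2"
      have "(\<integral>\<omega>. min 1 \<bar>p n r \<omega> * \<Psi> n \<omega>\<bar> \<partial>M) \<le> (\<integral>\<omega>. q r \<omega> \<partial>M)"
        by (rule integral_mono[OF _ _ q_ge])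
           (auto intro!: M.bounded_rv_integrable M.bounded_rv_min1 bounded_rvI[of "q r" M 1] simp: q0 q1)
      then show "measure M (S n r) \<le> e"
        using prob_le_cond_prob[OF S_sets[of n r], of n] n r unfolding p_def by linarith
    qed
  qed
qed

lemma threshold_small:
  assumes c: "0 < c" and e: "0 < e"
  shows "\<forall>\<^sub>F r in sequentially. measure M {\<omega> \<in> space M. c < \<epsilon> r \<omega>} \<le> e"
proof -
  have "(\<lambda>r. \<integral>\<omega>. indicator {\<omega> \<in> space M. c < \<epsilon> r \<omega>} \<omega> \<partial>M) \<longlonglongrightarrow> (\<integral>\<omega>. 0 \<partial>M :: real)"
  proof (rule integral_dominated_convergence[where w="\<lambda>_. 1"])
    show "AE \<omega> in M. (\<lambda>r. indicator {\<omega> \<in> space M. c < \<epsilon> r \<omega>} \<omega> :: real) \<longlonglongrightarrow> 0"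
      using \<epsilon>_lim
    proof eventually_elim
      fix \<omega> assume "(\<lambda>r. \<epsilon> r \<omega>) \<longlonglongrightarrow> 0"
      then have "\<forall>\<^sub>F r in sequentially. \<epsilon> r \<omega> < c" using c by (rule order_tendstoD(2))
      then have "\<forall>\<^sub>F r in sequentially. indicator {\<omega> \<in> space M. c < \<epsilon> r \<omega>} \<omega> = (0::real)"
        by eventually_elim (auto simp: indicator_def)
      then show "(\<lambda>r. indicator {\<omega> \<in> space M. c < \<epsilon> r \<omega>} \<omega> :: real) \<longlonglongrightarrow> 0" by (rule tendsto_eventually)
    qed
  qed auto
  then have "(\<lambda>r. measure M {\<omega> \<in> space M. c < \<epsilon> r \<omega>}) \<longlonglongrightarrow> 0" by simp
  then have "\<forall>\<^sub>F r in sequentially. measure M {\<omega> \<in> space M. c < \<epsilon> r \<omega>} < e" using e by (rule order_tendstoD(2))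
  then show ?thesis by eventually_elim simp
qed

text \<open>Outside the events \<open>S n r\<close> and \<open>\<epsilon> r > e\<close> the supremum over \<open>V r\<close>, hence the tail of the path, is
  smaller than \<open>e\<close>.\<close>

lemma tight_tail:
  assumes e: "0 < e"
  shows "\<exists>R>0. \<forall>\<^sub>F n in sequentially. \<exists>A\<in>sets M. measure M A \<le> e \<and>
      (\<forall>\<omega>\<in>space M - A. \<forall>u. R \<le> norm u \<longrightarrow> \<bar>apply_bcontfun (Zn n \<omega>) u\<bar> \<le> e)"
proof -
  have "\<forall>\<^sub>F r in sequentially. (\<forall>\<^sub>F n in sequentially. measure M (S n r) \<le> e / 2) \<and>
      measure M {\<omega> \<in> space M. e < \<epsilon> r \<omega>} \<le> e / 2 \<and> 0 < r"
    using tail_event_small[OF half_gt_zero[OF e]] threshold_small[OF e half_gt_zero[OF e]] eventually_gt_at_top[of 0]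
    by eventually_elim blast
  then obtain r where r: "\<forall>\<^sub>F n in sequentially. measure M (S n r) \<le> e / 2"
    "measure M {\<omega> \<in> space M. e < \<epsilon> r \<omega>} \<le> e / 2" "0 < r"
    by (metis (mono_tags, lifting) eventually_sequentially order_refl)
  define X where "X = {\<omega> \<in> space M. e < \<epsilon> r \<omega>}"
  have [measurable]: "X \<in> sets M" unfolding X_def by measurable
  have "\<forall>\<^sub>F n in sequentially. \<exists>A\<in>sets M. measure M A \<le> e \<and>
      (\<forall>\<omega>\<in>space M - A. \<forall>u. real r \<le> norm u \<longrightarrow> \<bar>apply_bcontfun (Zn n \<omega>) u\<bar> \<le> e)"
    using r(1) ball_in_U[of "real r"]
  proof eventually_elim
    fix n assume n: "measure M (S n r) \<le> e / 2" and U: "\<forall>u. norm u \<le> real r \<longrightarrow> u \<in> U_dom \<Theta> \<theta>s (An n)"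
    show "\<exists>A\<in>sets M. measure M A \<le> e \<and>
      (\<forall>\<omega>\<in>space M - A. \<forall>u. real r \<le> norm u \<longrightarrow> \<bar>apply_bcontfun (Zn n \<omega>) u\<bar> \<le> e)"
    proof (rule bexI[of _ "S n r \<union> X"], intro conjI ballI allI impI)
      show "measure M (S n r \<union> X) \<le> e"
        using measure_Un_le[of "S n r" M X] n r(2) by (simp add: X_def)
      fix \<omega> and u :: "real^'p" assume \<omega>: "\<omega> \<in> space M - (S n r \<union> X)" and u: "real r \<le> norm u"
      have "apply_bcontfun (Zn n \<omega>) u \<le> sup_or_zero (apply_bcontfun (Zn n \<omega>)) (V_dom \<Theta> \<theta>s (An n) (real r))"
        by (rule F.tail_le_sup_V) (use \<omega> U u in auto)
      also have "\<dots> \<le> \<epsilon> r \<omega>" using \<omega> by (auto simp: S_def S_event_def)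
      also have "\<dots> \<le> e" using \<omega> by (auto simp: X_def)
      finally show "\<bar>apply_bcontfun (Zn n \<omega>) u\<bar> \<le> e" using F.Zf_nonneg[of \<omega> n u] \<omega> by simp
    qed measurable
  qed
  then show ?thesis using r(3) by (intro exI[of _ "real r"]) auto
qed

text \<open>A reverse Fatou argument: the unconditional probabilities are asymptotically at most the mean of the
  limes superior of the weighted conditional ones, and this mean is small for small \<open>\<delta>\<close>. The suprema \<open>Y k\<close>
  over \<open>n \<ge> k\<close> decrease to a limit \<open>l\<close> below that limes superior.\<close>

lemma modulus_event_small:
  assumes c: "0 < c" and e: "0 < e" and \<eta>: "0 < \<eta>"
  shows "\<exists>\<delta>>0. \<forall>\<^sub>F n in sequentially.
    measure M (W_event M (\<lambda>\<omega>. apply_bcontfun (Zn n \<omega>)) (B_dom \<Theta> \<theta>s (An n) c) \<delta> e) \<le> \<eta>"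
proof -
  define W where "W n \<delta> = W_event M (\<lambda>\<omega>. apply_bcontfun (Zn n \<omega>)) (B_dom \<Theta> \<theta>s (An n) c) \<delta> e" for n \<delta>
  define w where "w n \<delta> = EM (indicator (W n \<delta>))" for n \<delta>
  define X where "X \<delta> \<omega> = real_of_ereal (limsup (\<lambda>n. ereal (w n \<delta> \<omega> * \<Psi> n \<omega>)))" for \<delta> \<omega>
  define dl where "dl j = 1 / real (Suc j)" for j
  have dl: "0 < dl j" for j by (simp add: dl_def)
  have WM[measurable]: "W n (dl j) \<in> sets M" for n j
    unfolding W_def by (rule F.W_event_measurable[OF c dl])
  have wm[measurable]: "w n (dl j) \<in> borel_measurable M" for n j
    unfolding w_def by (rule base.cond_expect_measurable_M[OF bounded_rv_measurable[OF bounded_rv_indicator]]) measurable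
  have "filterlim dl (at_right 0) sequentially"
    unfolding filterlim_at using dl LIMSEQ_Suc[OF lim_1_over_n] by (auto simp: dl_def[abs_def])
  moreover have "tendsto_in_prob M X (\<lambda>_. 0) (at_right 0)"
    using log_continuity[OF e c] unfolding X_def[abs_def] w_def W_def condit_prob_def .
  ultimately have "tendsto_in_prob M (\<lambda>j. X (dl j)) (\<lambda>_. 0) sequentially" by (rule tendsto_in_prob_compose[rotated])
  moreover have Xm[measurable]: "X (dl j) \<in> borel_measurable M" for j unfolding X_def by measurable
  ultimately have "(\<lambda>j. \<integral>\<omega>. min 1 \<bar>X (dl j) \<omega> - 0\<bar> \<partial>M) \<longlonglongrightarrow> 0"
    by (subst (asm) M.tendsto_in_prob_iff_integral) auto
  then have "\<forall>\<^sub>F j in sequentially. (\<integral>\<omega>. min 1 \<bar>X (dl j) \<omega> - 0\<bar> \<partial>M) < \<eta> / 2"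
    using \<eta> by (intro order_tendstoD(2)) auto
  then obtain j where j: "(\<integral>\<omega>. min 1 \<bar>X (dl j) \<omega>\<bar> \<partial>M) < \<eta> / 2" by (auto simp: eventually_sequentially)
  define x where "x n \<omega> = min 1 \<bar>w n (dl j) \<omega> * \<Psi> n \<omega>\<bar>" for n \<omega>
  have x01: "0 \<le> x n \<omega>" "x n \<omega> \<le> 1" for n \<omega> by (auto simp: x_def)
  have xm[measurable]: "x n \<in> borel_measurable M" for n unfolding x_def[abs_def] by measurable
  define Y where "Y k \<omega> = (SUP n\<in>{k..}. x n \<omega>)" for k \<omega>
  define l where "l \<omega> = (INF k. Y k \<omega>)" for \<omega>
  have bdd: "bdd_above ((\<lambda>n. x n \<omega>) ` A)" for \<omega> A by (rule bdd_aboveI[of _ 1]) (use x01 in auto)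
  have Y_ge: "x n \<omega> \<le> Y k \<omega>" if "k \<le> n" for n k \<omega>
    unfolding Y_def by (rule cSUP_upper[OF _ bdd]) (use that in auto)
  have Y_le: "Y k \<omega> \<le> b" if "\<And>n. k \<le> n \<Longrightarrow> x n \<omega> \<le> b" for k \<omega> b
    unfolding Y_def by (rule cSUP_least) (use that in auto)
  have Y01: "0 \<le> Y k \<omega>" "Y k \<omega> \<le> 1" for k \<omega>
    using order_trans[OF x01(1) Y_ge[OF order_refl]] by (auto intro: Y_le x01)
  have Ym[measurable]: "Y k \<in> borel_measurable M" for k
    unfolding Y_def[abs_def] by (rule borel_measurable_cSUP) (use bdd in auto)
  have bddY: "bdd_below (range (\<lambda>k. Y k \<omega>))" for \<omega> by (rule bdd_belowI[of _ 0]) (use Y01 in auto)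
  have lm[measurable]: "l \<in> borel_measurable M"
    unfolding l_def[abs_def] by (rule borel_measurable_cINF) (use bddY in auto)
  have l_le: "l \<omega> \<le> Y k \<omega>" for k \<omega> unfolding l_def by (rule cINF_lower[OF bddY]) simp
  have l0: "0 \<le> l \<omega>" for \<omega> unfolding l_def by (rule cINF_greatest) (use Y01 in auto)
  have "decseq (\<lambda>k. Y k \<omega>)" for \<omega>
    unfolding decseq_def by (auto intro!: Y_le Y_ge)
  then have Yl: "(\<lambda>k. Y k \<omega>) \<longlonglongrightarrow> l \<omega>" for \<omega>
    unfolding l_def by (rule LIMSEQ_decseq_INF[OF bddY])
  have "AE \<omega> in M. \<forall>n. 0 \<le> w n (dl j) \<omega> \<and> w n (dl j) \<omega> \<le> 1"
    unfolding w_def by (subst AE_all_countable) (intro allI base.cond_prob_01 WM)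
  then have lX: "AE \<omega> in M. l \<omega> \<le> min 1 \<bar>X (dl j) \<omega>\<bar>"
    using AE_space
  proof eventually_elim
    fix \<omega> assume w: "\<forall>n. 0 \<le> w n (dl j) \<omega> \<and> w n (dl j) \<omega> \<le> 1" and \<omega>: "\<omega> \<in> space M"
    define y where "y n = w n (dl j) \<omega> * \<Psi> n \<omega>" for n
    have y01: "0 \<le> y n" "y n \<le> 1" for n
      using w \<Psi>_01[OF \<omega>, of n] by (auto simp: y_def mult_le_one)
    have xy: "x n \<omega> = y n" for n using y01[of n] by (simp add: x_def y_def[symmetric])
    have "0 \<le> limsup (\<lambda>n. ereal (y n))"
      by (rule le_Limsup) (use y01 in auto)
    moreover have "limsup (\<lambda>n. ereal (y n)) \<le> 1"
      by (rule Limsup_bounded) (use y01 in auto)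
    ultimately obtain s where s: "limsup (\<lambda>n. ereal (y n)) = ereal s"
      by (cases "limsup (\<lambda>n. ereal (y n))") auto
    have Xs: "X (dl j) \<omega> = s" using s by (simp add: X_def y_def)
    have "l \<omega> \<le> s"
    proof (rule dense_ge)
      fix b assume "s < b"
      then have "limsup (\<lambda>n. ereal (y n)) < ereal b" using s by simp
      then have "\<forall>\<^sub>F n in sequentially. ereal (y n) < ereal b" by (rule Limsup_lessD)
      then obtain k where k: "\<forall>n\<ge>k. y n < b" by (auto simp: eventually_sequentially)
      then have "Y k \<omega> \<le> b" by (intro Y_le) (auto simp: xy less_imp_le)
      then show "l \<omega> \<le> b" using l_le order_trans by blast
    qed
    moreover have "l \<omega> \<le> 1" using l_le[of \<omega> 0] Y01(2)[of 0 \<omega>] by linarith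
    ultimately show "l \<omega> \<le> min 1 \<bar>X (dl j) \<omega>\<bar>" unfolding Xs by (simp add: abs_le_iff) 
  qed
  have "(\<lambda>k. \<integral>\<omega>. Y k \<omega> \<partial>M) \<longlonglongrightarrow> (\<integral>\<omega>. l \<omega> \<partial>M)"
    by (rule integral_dominated_convergence[where w="\<lambda>_. 1"]) (use Yl Y01 in auto)
  moreover have l_int: "(\<integral>\<omega>. l \<omega> \<partial>M) \<le> (\<integral>\<omega>. min 1 \<bar>X (dl j) \<omega>\<bar> \<partial>M)"
  proof (rule integral_mono_AE[OF _ _ lX])
    have "l \<omega> \<le> 1" for \<omega> using l_le[of \<omega> 0] Y01(2)[of 0 \<omega>] by linarith
    then show "integrable M l" by (intro M.bounded_rv_integrable bounded_rvI[of _ _ 1] lm) (use l0 in auto)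
  qed (intro M.bounded_rv_integrable M.bounded_rv_min1 Xm)
  ultimately have "\<forall>\<^sub>F k in sequentially. (\<integral>\<omega>. Y k \<omega> \<partial>M) < \<eta> / 2"
    by (intro order_tendstoD(2)[of _ "\<integral>\<omega>. l \<omega> \<partial>M"] le_less_trans[OF l_int j])
  then obtain k where k: "(\<integral>\<omega>. Y k \<omega> \<partial>M) < \<eta> / 2" by (auto simp: eventually_sequentially)
  have "\<forall>\<^sub>F n in sequentially. measure M (W n (dl j)) \<le> \<eta>"
    using \<Psi>_integral_small[OF half_gt_zero[OF \<eta>]] eventually_ge_at_top[of k]
  proof eventually_elim
    fix n assume n: "(\<integral>\<omega>. min 1 \<bar>\<Psi> n \<omega> - 1\<bar> \<partial>M) < \<eta> / 2" and kn: "k \<le> n"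
    have "(\<integral>\<omega>. x n \<omega> \<partial>M) \<le> (\<integral>\<omega>. Y k \<omega> \<partial>M)"
      by (rule integral_mono[OF _ _ Y_ge[OF kn]])
         (auto intro!: M.bounded_rv_integrable bounded_rvI[of "x n" M 1] bounded_rvI[of "Y k" M 1] simp: x01 Y01)
    then show "measure M (W n (dl j)) \<le> \<eta>"
      using prob_le_cond_prob[OF WM[of n j], of n] n k unfolding x_def w_def by linarith
  qed
  then show ?thesis using dl[of j] unfolding W_def by blast
qed

text \<open>The step length \<open>\<delta>\<close> for the crude bound on the logarithm is chosen first; it determines the number \<open>m\<close>
  of steps and thereby the threshold \<open>e exp (- m)\<close> for which the final \<open>\<delta>'\<close> is chosen.\<close>

lemma tight_modulus:
  assumes e: "0 < e" and c: "0 < c"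
  shows "\<exists>\<delta>>0. \<forall>\<^sub>F n in sequentially. \<exists>A\<in>sets M. measure M A \<le> e \<and>
      (\<forall>\<omega>\<in>space M - A. \<forall>u v. norm u < c \<longrightarrow> norm v < c \<longrightarrow> dist u v < \<delta> \<longrightarrow>
         \<bar>apply_bcontfun (Zn n \<omega>) u - apply_bcontfun (Zn n \<omega>) v\<bar> \<le> e)"
proof -
  define W where "W n \<delta> b = W_event M (\<lambda>\<omega>. apply_bcontfun (Zn n \<omega>)) (B_dom \<Theta> \<theta>s (An n) c) \<delta> b" for n \<delta> b
  obtain \<delta> where \<delta>: "0 < \<delta>" "\<forall>\<^sub>F n in sequentially. measure M (W n \<delta> 1) \<le> e / 2"
    using modulus_event_small[OF c zero_less_one half_gt_zero[OF e]] unfolding W_def by blast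
  obtain m :: nat where "c / \<delta> \<le> real m" using real_arch_simple by blast
  then have m: "c \<le> real m * \<delta>" using \<delta>(1) by (simp add: field_simps)
  have b: "0 < e * exp (- real m)" using e by simp
  obtain \<delta>' where \<delta>': "0 < \<delta>'" "\<forall>\<^sub>F n in sequentially. measure M (W n \<delta>' (e * exp (- real m))) \<le> e / 2"
    using modulus_event_small[OF c b half_gt_zero[OF e]] unfolding W_def by blast
  have "\<forall>\<^sub>F n in sequentially. \<exists>A\<in>sets M. measure M A \<le> e \<and>
      (\<forall>\<omega>\<in>space M - A. \<forall>u v. norm u < c \<longrightarrow> norm v < c \<longrightarrow> dist u v < \<delta>' \<longrightarrow>
         \<bar>apply_bcontfun (Zn n \<omega>) u - apply_bcontfun (Zn n \<omega>) v\<bar> \<le> e)"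
    using \<delta>(2) \<delta>'(2) ball_in_U[of c]
  proof eventually_elim
    fix n assume n: "measure M (W n \<delta> 1) \<le> e / 2" "measure M (W n \<delta>' (e * exp (- real m))) \<le> e / 2"
      and U: "\<forall>u. norm u \<le> c \<longrightarrow> u \<in> U_dom \<Theta> \<theta>s (An n)"
    have s: "W n \<delta> 1 \<in> sets M" "W n \<delta>' (e * exp (- real m)) \<in> sets M"
      unfolding W_def by (rule F.W_event_measurable[OF c \<delta>(1)] F.W_event_measurable[OF c \<delta>'(1)])+
    show "\<exists>A\<in>sets M. measure M A \<le> e \<and>
      (\<forall>\<omega>\<in>space M - A. \<forall>u v. norm u < c \<longrightarrow> norm v < c \<longrightarrow> dist u v < \<delta>' \<longrightarrow>
         \<bar>apply_bcontfun (Zn n \<omega>) u - apply_bcontfun (Zn n \<omega>) v\<bar> \<le> e)"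
    proof (rule bexI[of _ "W n \<delta> 1 \<union> W n \<delta>' (e * exp (- real m))"], intro conjI ballI allI impI)
      show "measure M (W n \<delta> 1 \<union> W n \<delta>' (e * exp (- real m))) \<le> e"
        using measure_Un_le[OF s] n by linarith
      fix \<omega> and u v :: "real^'p"
      assume \<omega>: "\<omega> \<in> space M - (W n \<delta> 1 \<union> W n \<delta>' (e * exp (- real m)))"
        and uv: "norm u < c" "norm v < c" "dist u v < \<delta>'"
      show "\<bar>apply_bcontfun (Zn n \<omega>) u - apply_bcontfun (Zn n \<omega>) v\<bar> \<le> e"
      proof (rule F.modulus_bound[OF _ c _ \<delta>(1) \<delta>'(1) m])
        show "\<omega> \<notin> W_event M (\<lambda>\<omega>. apply_bcontfun (Zn n \<omega>)) (B_dom \<Theta> \<theta>s (An n) c) \<delta> 1"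
          "\<omega> \<notin> W_event M (\<lambda>\<omega>. apply_bcontfun (Zn n \<omega>)) (B_dom \<Theta> \<theta>s (An n) c) \<delta>' (e * exp (- real m))"
          using \<omega> by (auto simp: W_def)
        show "norm (u - v) \<le> \<delta>'" using uv(3) by (simp add: dist_norm)
      qed (use \<omega> uv U in auto)
    qed (use s in auto)
  qed
  then show ?thesis using \<delta>'(1) by blast
qed

text \<open>If \<open>2^j < \<bar>u\<bar> \<le> 2^(j+1)\<close>, then \<open>\<bar>f u\<bar>\<close> is at most \<open>cj j\<close>, of order \<open>2^(j q)\<close>, and one of the events
  \<open>S n (2^j)\<close> and \<open>\<epsilon> (2^j) > 1\<close> occurs. The excess of \<open>\<bar>f u\<bar>\<close> over a level \<open>m J\<close> that dominates \<open>f\<close> on the ball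
  of radius \<open>2^J\<close> is therefore at most a sum over \<open>j \<ge> J\<close> of weighted indicators. For given \<open>\<omega>\<close> and large \<open>J\<close>
  the events about \<open>\<epsilon>\<close> disappear, and what remains is a geometric series with ratio \<open>2^(q - L) < 1\<close>.
  Dyadic radii are essential: with all integer radii the same argument would need \<open>L > q + 1\<close>.\<close>

lemma moment_tail:
  assumes f: "continuous_on UNIV f" and K1: "0 \<le> K1" "\<And>u. \<bar>f u\<bar> \<le> K1 * (1 + norm u powr q)"
    and q: "0 < q" "q < L"
  shows "AE \<omega> in M. \<forall>\<eta>>0. \<exists>m::nat. \<forall>n. \<Psi> n \<omega> * EM (\<lambda>\<omega>. max 0 (\<bar>f (F.uh n \<omega>)\<bar> - real m)) \<omega> \<le> \<eta>"
proof -
  have fm: "f \<in> borel_measurable borel" by (rule borel_measurable_continuous_onI[OF f])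
  have uhm[measurable]: "F.uh n \<in> borel_measurable M" for n by (rule F.uh_measurable)
  have fum[measurable]: "(\<lambda>\<omega>. f (F.uh n \<omega>)) \<in> borel_measurable M" for n
    by (rule measurable_compose[OF F.uh_measurable fm])
  define cj where "cj j = 2 * K1 * 2 powr (real (Suc j) * q)" for j
  define m where "m J = nat \<lceil>K1 * (1 + 2 powr (real J * q))\<rceil>" for J
  have m: "K1 * (1 + 2 powr (real J * q)) \<le> real (m J)" for J unfolding m_def by linarith
  have cj0: "0 \<le> cj j" for j using K1 by (simp add: cj_def)
  have "\<exists>J::nat. \<forall>\<omega>\<in>space M. norm (F.uh n \<omega>) \<le> 2 ^ J" for n
  proof -
    obtain b where b: "\<And>\<omega>. \<omega> \<in> space M \<Longrightarrow> norm (F.uh n \<omega>) \<le> b" using F.uh_bounded by blast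
    obtain J where "b < 2 ^ J" using real_arch_pow[of 2 b] by auto
    then show ?thesis using b by (intro exI[of _ J]) (auto intro: order_trans less_imp_le)
  qed
  \<comment> \<open>The range of the rescaled estimator is bounded for each \<open>n\<close>, so the dyadic sums are finite.\<close>
  then obtain Jn :: "nat \<Rightarrow> nat" where Jn: "\<And>n \<omega>. \<omega> \<in> space M \<Longrightarrow> norm (F.uh n \<omega>) \<le> 2 ^ Jn n" by metis
  have pw2: "(2 ^ J) powr q = 2 powr (real J * q)" for J :: nat
    by (simp add: powr_realpow[symmetric] powr_powr)
  define X where "X j = {\<omega> \<in> space C. 1 < \<epsilon> (2 ^ j) \<omega>}" for j :: nat
  have [measurable]: "\<epsilon> r \<in> borel_measurable C" for r by (rule \<epsilon>_C)
  have XC[measurable]: "X j \<in> sets C" for j unfolding X_def by measurable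
  have XM[measurable]: "X j \<in> sets M" for j using XC sets_C by blast
  define I where "I n j = (\<lambda>\<omega>. 1 * indicator (S n (2 ^ j)) \<omega> + 1 * indicator (X j) \<omega> :: real)" for n j :: nat
  have bI: "bounded_rv M (I n j)" for n j
    unfolding I_def by (intro bounded_rv_add bounded_rv_cmult bounded_rv_indicator S_sets XM)
  have I0: "0 \<le> I n j \<omega>" for n j \<omega> by (simp add: I_def)
  define h where "h n J = (\<lambda>\<omega>. max 0 (\<bar>f (F.uh n \<omega>)\<bar> - real (m J)))" for n J
  have pw: "h n J \<omega> \<le> (\<Sum>j=J..<Jn n. cj j * I n j \<omega>)" if \<omega>: "\<omega> \<in> space M" for n J \<omega>
  proof (cases "norm (F.uh n \<omega>) \<le> 2 ^ J")
    case True
    have "norm (F.uh n \<omega>) powr q \<le> (2 ^ J) powr q" using True q by (intro powr_mono2) auto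
    then have "K1 * (1 + norm (F.uh n \<omega>) powr q) \<le> K1 * (1 + 2 powr (real J * q))"
      using K1(1) pw2 by (intro mult_left_mono) auto
    then have "\<bar>f (F.uh n \<omega>)\<bar> \<le> real (m J)" using K1(2)[of "F.uh n \<omega>"] m[of J] by linarith
    then have "h n J \<omega> = 0" by (simp add: h_def)
    also have "0 \<le> (\<Sum>j=J..<Jn n. cj j * I n j \<omega>)" by (intro sum_nonneg mult_nonneg_nonneg cj0 I0)
    finally show ?thesis .
  next
    case False
    define i where "i = (LEAST i. norm (F.uh n \<omega>) \<le> 2 ^ i)"
    have i: "norm (F.uh n \<omega>) \<le> 2 ^ i" unfolding i_def by (rule LeastI[of _ "Jn n"]) (rule Jn[OF \<omega>])
    have iJn: "i \<le> Jn n" unfolding i_def by (rule Least_le) (rule Jn[OF \<omega>])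
    have iJ: "J < i"
    proof (rule ccontr)
      assume "\<not> J < i"
      then have "(2::real) ^ i \<le> 2 ^ J" by (intro power_increasing) auto
      then show False using i False by linarith
    qed
    then obtain j where j: "i = Suc j" by (cases i) auto
    have lt: "2 ^ j < norm (F.uh n \<omega>)"
      using not_less_Least[of j "\<lambda>i. norm (F.uh n \<omega>) \<le> 2 ^ i"] j by (simp add: i_def[symmetric] not_le)
    have jin: "j \<in> {J..<Jn n}" using iJ iJn j by auto
    have "norm (F.uh n \<omega>) powr q \<le> (2 ^ Suc j) powr q" using i j q by (intro powr_mono2) auto
    also have "\<dots> = 2 powr (real (Suc j) * q)" by (rule pw2)
    finally have "K1 * (1 + norm (F.uh n \<omega>) powr q) \<le> K1 * (2 powr (real (Suc j) * q) + 2 powr (real (Suc j) * q))"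
      using K1(1) q by (intro mult_left_mono add_mono) (auto intro!: ge_one_powr_ge_zero)
    also have "\<dots> = cj j" by (simp add: cj_def)
    finally have "h n J \<omega> \<le> cj j * 1" using K1(2)[of "F.uh n \<omega>"] cj0[of j] by (simp add: h_def)
    also have "\<dots> \<le> cj j * I n j \<omega>"
    proof (rule mult_left_mono[OF _ cj0])
      have "1 \<le> sup_or_zero (apply_bcontfun (Zn n \<omega>)) (V_dom \<Theta> \<theta>s (An n) (real (2 ^ j)))"
        by (rule F.uh_large[OF \<omega>]) (use lt in simp)
      then have "\<omega> \<in> S n (2 ^ j) \<or> \<omega> \<in> X j"
        using \<omega> space_C by (auto simp: S_def S_event_def X_def)
      then show "1 \<le> I n j \<omega>" by (auto simp: I_def)
    qed
    also have "\<dots> \<le> (\<Sum>j=J..<Jn n. cj j * I n j \<omega>)"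
      by (rule member_le_sum[OF jin]) (auto intro!: mult_nonneg_nonneg cj0 I0)
    finally show ?thesis .
  qed
  have bh: "bounded_rv M (h n J)" for n J
  proof -
    have bs: "bounded_rv M (\<lambda>\<omega>. \<Sum>j=J..<Jn n. cj j * I n j \<omega>)" by (intro bounded_rv_sum bounded_rv_cmult bI)
    obtain b where b: "\<And>\<omega>. \<omega> \<in> space M \<Longrightarrow> \<bar>\<Sum>j=J..<Jn n. cj j * I n j \<omega>\<bar> \<le> b"
      using bs by (rule bounded_rvE) blast
    show ?thesis
    proof (rule bounded_rvI[of _ _ b])
      show "h n J \<in> borel_measurable M" unfolding h_def by measurable
      fix \<omega> assume \<omega>: "\<omega> \<in> space M"
      have "0 \<le> h n J \<omega>" by (simp add: h_def)
      then show "\<bar>h n J \<omega>\<bar> \<le> b" using pw[OF \<omega>, of n J] b[OF \<omega>] by linarith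
    qed
  qed
  have "AE \<omega> in M. EM (h n J) \<omega> \<le> (\<Sum>j=J..<Jn n. cj j * (p n (2 ^ j) \<omega> + indicator (X j) \<omega>))" for n J
  proof -
    have "AE \<omega> in M. EM (h n J) \<omega> \<le> EM (\<lambda>\<omega>. \<Sum>j=J..<Jn n. cj j * I n j \<omega>) \<omega>"
      by (rule base.cond_expect_mono[OF bh]) (use pw in \<open>auto intro!: bounded_rv_sum bounded_rv_cmult bI\<close>)
    moreover have "AE \<omega> in M. EM (\<lambda>\<omega>. \<Sum>j=J..<Jn n. cj j * I n j \<omega>) \<omega> = (\<Sum>j=J..<Jn n. cj j * EM (I n j) \<omega>)"
      by (rule base.cond_expect_sum) (auto intro: bI)
    moreover have "AE \<omega> in M. \<forall>j. EM (I n j) \<omega> = p n (2 ^ j) \<omega> + indicator (X j) \<omega>"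
    proof (subst AE_all_countable, intro allI)
      fix j
      have "AE \<omega> in M. EM (I n j) \<omega> = 1 * EM (indicator (S n (2 ^ j))) \<omega> + 1 * EM (indicator (X j)) \<omega>"
        unfolding I_def by (rule base.cond_expect_lin) (intro bounded_rv_indicator S_sets XM)+
      moreover have "AE \<omega> in M. EM (indicator (X j)) \<omega> = indicator (X j) \<omega>"
        using base.cond_expect_base[OF bounded_rv_indicator[OF XC[of j]]] by simp
      ultimately show "AE \<omega> in M. EM (I n j) \<omega> = p n (2 ^ j) \<omega> + indicator (X j) \<omega>"
        by eventually_elim (simp add: p_def)
    qed
    ultimately show ?thesis by eventually_elim simp
  qed
  then have "AE \<omega> in M. \<forall>n J. EM (h n J) \<omega> \<le> (\<Sum>j=J..<Jn n. cj j * (p n (2 ^ j) \<omega> + indicator (X j) \<omega>))"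
    by (simp add: AE_all_countable)
  then show ?thesis using polynomial_bound \<epsilon>_lim AE_space
  proof eventually_elim
    fix \<omega>
    assume eh: "\<forall>n J. EM (h n J) \<omega> \<le> (\<Sum>j=J..<Jn n. cj j * (p n (2 ^ j) \<omega> + indicator (X j) \<omega>))"
      and "\<exists>K\<ge>0. \<forall>n r. 0 < r \<longrightarrow> p n r \<omega> * \<Psi> n \<omega> \<le> K * real r powr (- L)"
      and el: "(\<lambda>r. \<epsilon> r \<omega>) \<longlonglongrightarrow> 0" and \<omega>: "\<omega> \<in> space M"
    then obtain K where K: "0 \<le> K" "\<And>n r. 0 < r \<Longrightarrow> p n r \<omega> * \<Psi> n \<omega> \<le> K * real r powr (- L)" by blast
    have "\<forall>\<^sub>F r in sequentially. \<epsilon> r \<omega> < 1" by (rule order_tendstoD(2)[OF el]) simp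
    then obtain r0 where r0: "\<And>r. r0 \<le> r \<Longrightarrow> \<epsilon> r \<omega> < 1" by (auto simp: eventually_sequentially)
    define \<rho> where "\<rho> = (2::real) powr (q - L)"
    have \<rho>: "0 \<le> \<rho>" "\<rho> < 1" using q by (auto simp: \<rho>_def powr_less_one)
    define D where "D = 2 * K1 * 2 powr q * K / (1 - \<rho>)"
    have D0: "0 \<le> D" using K K1 \<rho> by (simp add: D_def)
    have bound: "\<Psi> n \<omega> * EM (h n J) \<omega> \<le> D * \<rho> ^ J" if J: "r0 \<le> J" for n J
    proof -
      have P: "0 \<le> \<Psi> n \<omega>" using \<Psi>_01[OF \<omega>, of n] by simp
      have X0: "indicator (X j) \<omega> = (0::real)" if "J \<le> j" for j
      proof -
        have "j < 2 ^ j" by (rule less_exp)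
        then have "\<epsilon> (2 ^ j) \<omega> < 1" using J that by (intro r0) linarith
        then show ?thesis by (auto simp: X_def indicator_def)
      qed
      have "\<Psi> n \<omega> * EM (h n J) \<omega> \<le> \<Psi> n \<omega> * (\<Sum>j=J..<Jn n. cj j * (p n (2 ^ j) \<omega> + indicator (X j) \<omega>))"
        using eh P by (intro mult_left_mono) auto
      also have "\<dots> = (\<Sum>j=J..<Jn n. cj j * (p n (2 ^ j) \<omega> * \<Psi> n \<omega>))"
        unfolding sum_distrib_left by (rule sum.cong) (auto simp: X0 algebra_simps)
      also have "\<dots> \<le> (\<Sum>j=J..<Jn n. 2 * K1 * 2 powr q * K * \<rho> ^ j)"
      proof (rule sum_mono)
        fix j
        have "cj j * (p n (2 ^ j) \<omega> * \<Psi> n \<omega>) \<le> cj j * (K * real (2 ^ j) powr (- L))"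
          by (intro mult_left_mono K cj0) auto
        also have "\<dots> = 2 * K1 * 2 powr q * K * \<rho> ^ j"
        proof -
          have "2 powr (real (Suc j) * q) * real (2 ^ j) powr (- L) = 2 powr (real (Suc j) * q) * 2 powr (real j * (- L))"
            by (simp add: powr_realpow[symmetric] powr_powr)
          also have "\<dots> = 2 powr q * 2 powr (real j * (q - L))"
            by (simp add: powr_add[symmetric] algebra_simps)
          also have "2 powr (real j * (q - L)) = \<rho> ^ j"
            by (simp add: \<rho>_def powr_realpow[symmetric] powr_powr mult.commute)
          finally show ?thesis by (simp add: cj_def algebra_simps)
        qed
        finally show "cj j * (p n (2 ^ j) \<omega> * \<Psi> n \<omega>) \<le> 2 * K1 * 2 powr q * K * \<rho> ^ j" .
      qed
      also have "\<dots> = 2 * K1 * 2 powr q * K * (\<Sum>j=J..<Jn n. \<rho> ^ j)" by (simp add: sum_distrib_left)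
      also have "\<dots> \<le> 2 * K1 * 2 powr q * K * (\<rho> ^ J / (1 - \<rho>))"
        using K K1 by (intro mult_left_mono geometric_tail_le \<rho>) auto
      finally show ?thesis by (simp add: D_def)
    qed
    show "\<forall>\<eta>>0. \<exists>m::nat. \<forall>n. \<Psi> n \<omega> * EM (\<lambda>\<omega>. max 0 (\<bar>f (F.uh n \<omega>)\<bar> - real m)) \<omega> \<le> \<eta>"
    proof (intro allI impI)
      fix \<eta> :: real assume \<eta>: "0 < \<eta>"
      have "(\<lambda>J. D * \<rho> ^ J) \<longlonglongrightarrow> D * 0" using \<rho> by (intro tendsto_intros LIMSEQ_power_zero) auto
      then have "\<forall>\<^sub>F J in sequentially. D * \<rho> ^ J < \<eta>" using \<eta> by (intro order_tendstoD(2)) auto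
      then have "\<forall>\<^sub>F J in sequentially. D * \<rho> ^ J < \<eta> \<and> r0 \<le> J"
        using eventually_ge_at_top by (rule eventually_conj)
      then obtain J where J: "D * \<rho> ^ J < \<eta>" "r0 \<le> J" by (auto simp: eventually_sequentially)
      have "\<Psi> n \<omega> * EM (h n J) \<omega> \<le> \<eta>" for n using bound[OF J(2), of n] J(1) by linarith
      then show "\<exists>m::nat. \<forall>n. \<Psi> n \<omega> * EM (\<lambda>\<omega>. max 0 (\<bar>f (F.uh n \<omega>)\<bar> - real m)) \<omega> \<le> \<eta>"
        unfolding h_def by blast
    qed
  qed
qed

end

section \<open>From sequences of times to the limit at infinity\<close>

text \<open>The times \<open>T \<in> TT\<close> at which \<open>g\<close> stays away from \<open>l\<close> would otherwise contain a sequence tending to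
  infinity, and its members can be taken beyond \<open>T0\<close>.\<close>

lemma tendsto_to_infinity_in:
  assumes "\<And>\<tau>. \<tau> \<in> seqs_to_infinity TT T0 \<Longrightarrow> (\<lambda>n. g (\<tau> n)) \<longlonglongrightarrow> (l::real)"
  shows "(g \<longlongrightarrow> l) (to_infinity_in TT)"
proof (rule ccontr)
  assume "\<not> ?thesis"
  then obtain e where e: "0 < e" "\<not> eventually (\<lambda>T. dist (g T) l < e) (to_infinity_in TT)"
    by (auto simp: tendsto_iff)
  have "\<exists>T\<ge>b. T \<in> TT \<and> \<not> dist (g T) l < e" for b
    using e(2) by (auto simp: to_infinity_in_def eventually_inf_principal eventually_at_top_linorder)
  then have "\<exists>T\<ge>max T0 (real n). T \<in> TT \<and> \<not> dist (g T) l < e" for n :: nat by blast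
  then obtain \<tau> where \<tau>: "\<And>n. max T0 (real n) \<le> \<tau> n" "\<And>n. \<tau> n \<in> TT" "\<And>n. \<not> dist (g (\<tau> n)) l < e"
    by metis
  have "filterlim \<tau> at_top sequentially"
    by (rule filterlim_at_top_mono[OF filterlim_real_sequentially]) (use \<tau>(1) in auto)
  then have "\<tau> \<in> seqs_to_infinity TT T0" using \<tau> by (auto simp: seqs_to_infinity_def)
  then have "\<forall>\<^sub>F n in sequentially. dist (g (\<tau> n)) l < e" using assms e(1) by (auto dest: tendstoD)
  then show False using \<tau>(3) by (auto simp: eventually_sequentially)
qed

lemma tendsto_in_prob_to_infinity_in:
  assumes "\<And>\<tau>. \<tau> \<in> seqs_to_infinity TT T0 \<Longrightarrow> tendsto_in_prob M (\<lambda>n. X (\<tau> n)) Y sequentially"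
  shows "tendsto_in_prob M X Y (to_infinity_in TT)"
  using assms unfolding tendsto_in_prob_def by (auto intro!: tendsto_to_infinity_in)

lemma filterlim_seqs_to_infinity:
  "\<tau> \<in> seqs_to_infinity TT T0 \<Longrightarrow> filterlim \<tau> (to_infinity_in TT) sequentially"
  by (auto simp: seqs_to_infinity_def to_infinity_in_def filterlim_inf filterlim_principal)

lemma seqs_to_infinity_nonempty:
  assumes "\<not> bdd_above TT" shows "\<exists>\<tau>. \<tau> \<in> seqs_to_infinity TT T0"
proof -
  have "\<exists>T\<in>TT. b < T" for b
    using assms by (auto simp: bdd_above_def not_le)
  then have "\<exists>T\<in>TT. max T0 (real n) \<le> T" for n :: nat by (meson less_imp_le)
  then obtain \<tau> where \<tau>: "\<And>n. \<tau> n \<in> TT" "\<And>n. max T0 (real n) \<le> \<tau> n" by metis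
  have "filterlim \<tau> at_top sequentially"
    by (rule filterlim_at_top_mono[OF filterlim_real_sequentially]) (use \<tau>(2) in auto)
  then show ?thesis using \<tau> by (auto simp: seqs_to_infinity_def)
qed

lemma polynomial_growth:
  fixes f :: "'n::euclidean_space \<Rightarrow> real"
  assumes f: "continuous_on UNIV f"
    and lim: "Limsup at_infinity (\<lambda>u. ereal (\<bar>f u\<bar> * norm u powr (- q))) < \<infinity>"
  obtains K where "0 \<le> K" "\<And>u. \<bar>f u\<bar> \<le> K * (1 + norm u powr q)"
proof -
  obtain c :: real where "Limsup at_infinity (\<lambda>u. ereal (\<bar>f u\<bar> * norm u powr (- q))) < ereal c"
    using less_PInf_Ex_of_nat[THEN iffD1, of "Limsup at_infinity (\<lambda>u. ereal (\<bar>f u\<bar> * norm u powr (- q)))"] lim by auto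
  then have "\<forall>\<^sub>F u in at_infinity. ereal (\<bar>f u\<bar> * norm u powr (- q)) < ereal c" by (rule Limsup_lessD)
  then obtain b where b: "\<And>u. b \<le> norm u \<Longrightarrow> \<bar>f u\<bar> * norm u powr (- q) < c"
    by (auto simp: eventually_at_infinity)
  have "compact (f ` cball 0 (max b 1))"
    by (intro compact_continuous_image continuous_on_subset[OF f]) auto
  then obtain K2 where "\<forall>x\<in>f ` cball 0 (max b 1). norm x \<le> K2"
    using compact_imp_bounded by (metis bounded_iff)
  then have K2: "\<And>u. norm u \<le> max b 1 \<Longrightarrow> \<bar>f u\<bar> \<le> K2" by simp
  define K where "K = max \<bar>c\<bar> \<bar>K2\<bar>"
  show ?thesis
  proof (rule that[of K])
    show "0 \<le> K" by (simp add: K_def)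
    fix u :: 'n
    show "\<bar>f u\<bar> \<le> K * (1 + norm u powr q)"
    proof (cases "norm u \<le> max b 1")
      case True
      have "\<bar>f u\<bar> \<le> K * 1" using K2[OF True] by (simp add: K_def)
      also have "\<dots> \<le> K * (1 + norm u powr q)" by (rule mult_left_mono) (auto simp: K_def)
      finally show ?thesis .
    next
      case False
      then have u: "0 < norm u" "b \<le> norm u" by auto
      have "\<bar>f u\<bar> = (\<bar>f u\<bar> * norm u powr (- q)) * norm u powr q"
        using u by (simp add: powr_minus field_simps)
      also have "\<dots> \<le> K * (1 + norm u powr q)"
        using b[OF u(2)] by (intro mult_mono) (auto simp: K_def)
      finally show ?thesis .
    qed
  qed
qed

section \<open>The limit theorem for likelihood ratio fields and their maximizers\<close>

theorem theorem2p3: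
  fixes M C G :: "'a measure" and N :: "'b measure" and \<pi> :: "'b \<Rightarrow> 'a"
    and TT :: "real set" and T0 :: real
    and \<Theta> :: "(real^'p) set" and \<theta>s :: "real^'p"
    and H :: "real \<Rightarrow> 'a \<Rightarrow> real^'p \<Rightarrow> real"
    and a :: "real \<Rightarrow> real^'p^'p"
    and ZT :: "real \<Rightarrow> 'a \<Rightarrow> ((real^'p) \<Rightarrow>\<^sub>C real)"
    and \<theta>hat :: "real \<Rightarrow> 'a \<Rightarrow> real^'p"
    and \<Psi> :: "real \<Rightarrow> 'a \<Rightarrow> real"
    and Z :: "'b \<Rightarrow> ((real^'p) \<Rightarrow>\<^sub>C real)" and uhat :: "'b \<Rightarrow> real^'p"
    and uhatT :: "real \<Rightarrow> 'a \<Rightarrow> real^'p"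
    and q L :: real
  assumes M: "prob_space M"
    and TT: "TT \<subseteq> {0..}" "\<not> bdd_above TT"
    and \<Theta>: "open \<Theta>" "connected \<Theta>" "bounded \<Theta>" and \<theta>s: "\<theta>s \<in> \<Theta>"
    and H_meas: "\<And>T. T \<in> TT \<Longrightarrow>
      (\<lambda>(\<omega>, \<theta>). H T \<omega> \<theta>) \<in> borel_measurable (M \<Otimes>\<^sub>M restrict_space borel (closure \<Theta>))"
    and H_cont: "\<And>T \<omega>. T \<in> TT \<Longrightarrow> \<omega> \<in> space M \<Longrightarrow> continuous_on (closure \<Theta>) (H T \<omega>)"
    and a_inv: "\<And>T. T \<in> TT \<Longrightarrow> invertible (a T)"
    and a_lim: "(a \<longlongrightarrow> 0) (to_infinity_in TT)"
    and ZT_U: "\<And>T \<omega> u. T \<in> TT \<Longrightarrow> \<omega> \<in> space M \<Longrightarrow> u \<in> U_dom \<Theta> \<theta>s (a T) \<Longrightarrow>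
      apply_bcontfun (ZT T \<omega>) u = exp (H T \<omega> (theta_dag \<theta>s (a T) u) - H T \<omega> \<theta>s)"
    and ZT_meas: "\<And>T. T \<in> TT \<Longrightarrow>
      (\<lambda>(\<omega>, u). apply_bcontfun (ZT T \<omega>) u) \<in> borel_measurable (M \<Otimes>\<^sub>M borel)"
    and ZT_nonneg: "\<And>T \<omega> u. T \<in> TT \<Longrightarrow> \<omega> \<in> space M \<Longrightarrow> 0 \<le> apply_bcontfun (ZT T \<omega>) u"
    and ZT_supp: "\<And>T \<omega>. T \<in> TT \<Longrightarrow> \<omega> \<in> space M \<Longrightarrow>
      compact (closure {u. apply_bcontfun (ZT T \<omega>) u \<noteq> 0})"
    and ZT_bd: "\<And>T \<omega>. T \<in> TT \<Longrightarrow> \<omega> \<in> space M \<Longrightarrow>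
      (SUP u\<in>- U_dom \<Theta> \<theta>s (a T). apply_bcontfun (ZT T \<omega>) u)
        \<le> (SUP u\<in>frontier (U_dom \<Theta> \<theta>s (a T)). apply_bcontfun (ZT T \<omega>) u)"
    and \<theta>hat_meas: "\<And>T. T \<in> TT \<Longrightarrow> \<theta>hat T \<in> measurable M (restrict_space borel (closure \<Theta>))"
    and \<theta>hat_max: "\<And>T \<omega> \<theta>. T \<in> TT \<Longrightarrow> \<omega> \<in> space M \<Longrightarrow> \<theta> \<in> closure \<Theta> \<Longrightarrow>
      H T \<omega> \<theta> \<le> H T \<omega> (\<theta>hat T \<omega>)"
    and uhatT_def: "\<And>T \<omega>. uhatT T \<omega> = matrix_inv (a T) *v (\<theta>hat T \<omega> - \<theta>s)"
    and G: "subalgebra M G" and C: "subalgebra G C"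
    and \<Psi>_meas: "\<And>T. T \<in> TT \<Longrightarrow> \<Psi> T \<in> borel_measurable C"
    and \<Psi>_range: "\<And>T \<omega>. T \<in> TT \<Longrightarrow> \<omega> \<in> space M \<Longrightarrow> \<Psi> T \<omega> \<in> {0..1}"
    and T0: "0 < T0"
    and ext: "prob_extension M N \<pi>"
    and Z_meas: "Z \<in> measurable N (restrict_space borel C_hat)"
    and uhat_meas: "uhat \<in> borel_measurable N"
    and q: "0 < q" and L: "Max {real CARD('p), q, 1} < L"
    and cond1: "\<exists>\<epsilon> :: nat \<Rightarrow> 'a \<Rightarrow> real.
      (\<forall>r. \<epsilon> r \<in> borel_measurable C \<and> (\<forall>\<omega>\<in>space M. 0 < \<epsilon> r \<omega>)) \<and>
      (AE \<omega> in M. (\<lambda>r. \<epsilon> r \<omega>) \<longlonglongrightarrow> 0) \<and>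
      (\<forall>\<tau>\<in>seqs_to_infinity TT T0. AE \<omega> in M.
        (SUP n. SUP r. ereal (real r powr L *
           condit_prob M id C
             (S_event M (\<lambda>\<omega>. apply_bcontfun (ZT (\<tau> n) \<omega>)) (V_dom \<Theta> \<theta>s (a (\<tau> n)) (real r)) (\<epsilon> r)) \<omega> *
           \<Psi> (\<tau> n) \<omega>)) < \<infinity>)"
    and cond2: "\<And>\<epsilon> c \<tau>. 0 < \<epsilon> \<Longrightarrow> 0 < c \<Longrightarrow> \<tau> \<in> seqs_to_infinity TT T0 \<Longrightarrow>
      tendsto_in_prob M
        (\<lambda>\<delta> \<omega>. real_of_ereal (limsup (\<lambda>n. ereal (
           condit_prob M id C
             (W_event M (\<lambda>\<omega>. apply_bcontfun (ZT (\<tau> n) \<omega>)) (B_dom \<Theta> \<theta>s (a (\<tau> n)) c) \<delta> \<epsilon>) \<omega> *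
           \<Psi> (\<tau> n) \<omega>))))
        (\<lambda>\<omega>. 0) (at_right 0)"
    and cond3i: "\<And>(k::nat) (u :: nat \<Rightarrow> real^'p) (f :: (nat \<Rightarrow> real) \<Rightarrow> real) Y.
      continuous_map (powertop_real {..<k}) euclideanreal f \<Longrightarrow>
      bounded (f ` topspace (powertop_real {..<k})) \<Longrightarrow>
      bounded_rv G Y \<Longrightarrow>
      tendsto_in_prob M
        (\<lambda>T. cond_expect M id C
           (\<lambda>\<omega>. f (\<lambda>i\<in>{..<k}. apply_bcontfun (ZT T \<omega>) (u i)) * \<Psi> T \<omega> * Y \<omega>))
        (cond_expect N \<pi> C (\<lambda>w. f (\<lambda>i\<in>{..<k}. apply_bcontfun (Z w) (u i)) * Y (\<pi> w)))
        (to_infinity_in TT)"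
    and cond3ii: "tendsto_in_prob M \<Psi> (\<lambda>\<omega>. 1) (to_infinity_in TT)"
    and cond4: "AE w in N. maximizes (apply_bcontfun (Z w)) (uhat w) \<and>
      (\<forall>u. maximizes (apply_bcontfun (Z w)) u \<longrightarrow> u = uhat w)"
  shows "(\<forall>(F :: ((real^'p) \<Rightarrow>\<^sub>C real) \<Rightarrow> real) Y.
            continuous_on C_hat F \<longrightarrow> bounded (F ` C_hat) \<longrightarrow> bounded_rv G Y \<longrightarrow>
            tendsto_in_prob M
              (\<lambda>T. cond_expect M id C (\<lambda>\<omega>. F (ZT T \<omega>) * Y \<omega>))
              (cond_expect N \<pi> C (\<lambda>w. F (Z w) * Y (\<pi> w)))
              (to_infinity_in TT))
       \<and> (\<forall>(f :: real^'p \<Rightarrow> real) Y.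
            continuous_on UNIV f \<longrightarrow>
            Limsup at_infinity (\<lambda>u. ereal (\<bar>f u\<bar> * norm u powr (- q))) < \<infinity> \<longrightarrow>
            bounded_rv G Y \<longrightarrow>
            (\<forall>T\<in>TT. AE \<omega> in M. cond_integrable M id C (\<lambda>\<omega>. f (uhatT T \<omega>) * Y \<omega>) \<omega>) \<and>
            (AE \<omega> in M. cond_integrable N \<pi> C (\<lambda>w. f (uhat w) * Y (\<pi> w)) \<omega>) \<and>
            tendsto_in_prob M
              (\<lambda>T. cond_expect M id C (\<lambda>\<omega>. f (uhatT T \<omega>) * Y \<omega>))
              (cond_expect N \<pi> C (\<lambda>w. f (uhat w) * Y (\<pi> w)))
              (to_infinity_in TT))
       \<and> stable_conv M N \<pi> G uhatT uhat (to_infinity_in TT)"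
proof -
  have C_M: "subalgebra M C" using G C by (auto simp: subalgebra_def)
  interpret stable_conditioning M N \<pi> C G
    by (intro stable_conditioning.intro conditioning.intro stable_conditioning_axioms.intro M ext C_M G)
  from cond1 obtain \<epsilon> where e: "(\<forall>r. \<epsilon> r \<in> borel_measurable C \<and> (\<forall>\<omega>\<in>space M. 0 < \<epsilon> r \<omega>)) \<and>
      (AE \<omega> in M. (\<lambda>r. \<epsilon> r \<omega>) \<longlonglongrightarrow> 0) \<and>
      (\<forall>\<tau>\<in>seqs_to_infinity TT T0. AE \<omega> in M.
        (SUP n. SUP r. ereal (real r powr L *
           condit_prob M id C
             (S_event M (\<lambda>\<omega>. apply_bcontfun (ZT (\<tau> n) \<omega>)) (V_dom \<Theta> \<theta>s (a (\<tau> n)) (real r)) (\<epsilon> r)) \<omega> *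
           \<Psi> (\<tau> n) \<omega>)) < \<infinity>)" ..
  note \<epsilon> = e[THEN conjunct1, rule_format, THEN conjunct1] e[THEN conjunct2, THEN conjunct1]
    e[THEN conjunct2, THEN conjunct2, rule_format]
  have qL: "q < L" "0 < L" using L by auto
  have field: "qle_field M \<Theta> \<theta>s (H T) (a T) (ZT T) (\<theta>hat T)" if T: "T \<in> TT" for T
  proof (intro qle_field.intro qle_field_axioms.intro M \<Theta> \<theta>s)
  qed (use T H_cont a_inv ZT_U ZT_meas ZT_nonneg ZT_supp ZT_bd \<theta>hat_meas \<theta>hat_max in auto)
  have uh: "qle_field.uh \<theta>s (a T) (\<theta>hat T) = uhatT T" if "T \<in> TT" for T
  proof -
    interpret F: qle_field M \<Theta> \<theta>s "H T" "a T" "ZT T" "\<theta>hat T" by (rule field[OF that])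
    show ?thesis by (simp add: fun_eq_iff F.uh_def F.rescale_def uhatT_def)
  qed
  have \<tau>TT: "\<tau> n \<in> TT" if "\<tau> \<in> seqs_to_infinity TT T0" for \<tau> n
    using that by (simp add: seqs_to_infinity_def)
  have seq: "qle_sequence M N \<pi> C G \<Theta> \<theta>s (\<lambda>n. H (\<tau> n)) (\<lambda>n. a (\<tau> n)) (\<lambda>n. ZT (\<tau> n)) (\<lambda>n. \<theta>hat (\<tau> n)) (\<lambda>n. \<Psi> (\<tau> n)) \<epsilon> L"
    if \<tau>: "\<tau> \<in> seqs_to_infinity TT T0" for \<tau>
  proof (intro qle_sequence.intro qle_sequence_axioms.intro)
    show "stable_conditioning M N \<pi> C G" by (rule stable_conditioning_axioms)
    show "(\<lambda>n. a (\<tau> n)) \<longlonglongrightarrow> 0" by (rule filterlim_compose[OF a_lim filterlim_seqs_to_infinity[OF \<tau>]])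
    show "tendsto_in_prob M (\<lambda>n. \<Psi> (\<tau> n)) (\<lambda>_. 1) sequentially"
      by (rule tendsto_in_prob_compose[OF cond3ii filterlim_seqs_to_infinity[OF \<tau>]])
    show "qle_field M \<Theta> \<theta>s (H (\<tau> n)) (a (\<tau> n)) (ZT (\<tau> n)) (\<theta>hat (\<tau> n))" for n
      by (rule field[OF \<tau>TT[OF \<tau>]])
    show "\<Psi> (\<tau> n) \<in> borel_measurable C" for n by (rule \<Psi>_meas[OF \<tau>TT[OF \<tau>]])
    show "\<Psi> (\<tau> n) \<omega> \<in> {0..1}" if "\<omega> \<in> space M" for n \<omega> by (rule \<Psi>_range[OF \<tau>TT[OF \<tau>] that])
    show "0 < L" by (rule qL)
  qed (rule \<epsilon> \<epsilon>(3)[OF \<tau>] cond2[OF _ _ \<tau>]; assumption)+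
  have conv: "field_convergence M N \<pi> C G (\<lambda>n. ZT (\<tau> n)) Z (\<lambda>n. \<Psi> (\<tau> n))"
    if \<tau>: "\<tau> \<in> seqs_to_infinity TT T0" for \<tau>
  proof -
    interpret Q: qle_sequence M N \<pi> C G \<Theta> \<theta>s "\<lambda>n. H (\<tau> n)" "\<lambda>n. a (\<tau> n)" "\<lambda>n. ZT (\<tau> n)" "\<lambda>n. \<theta>hat (\<tau> n)" "\<lambda>n. \<Psi> (\<tau> n)" \<epsilon> L
      by (rule seq[OF \<tau>])
    show ?thesis
    proof (intro field_convergence.intro field_convergence_axioms.intro)
      show "stable_conditioning M N \<pi> C G" by (rule stable_conditioning_axioms)
      show "(\<lambda>\<omega>. apply_bcontfun (ZT (\<tau> n) \<omega>) u) \<in> borel_measurable M" for n u by (rule Q.F.z_coord)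
      show "ZT (\<tau> n) \<omega> \<in> C_hat" if "\<omega> \<in> space M" for n \<omega> by (rule Q.F.Zf_C_hat[OF that])
    next
      fix k :: nat and u :: "nat \<Rightarrow> real^'p" and f :: "(nat \<Rightarrow> real) \<Rightarrow> real" and Y
      assume "continuous_map (powertop_real {..<k}) euclideanreal f"
        "bounded (f ` topspace (powertop_real {..<k}))" "bounded_rv G Y"
      then show "tendsto_in_prob M
        (\<lambda>n. EM (\<lambda>\<omega>. f (\<lambda>i\<in>{..<k}. apply_bcontfun (ZT (\<tau> n) \<omega>) (u i)) * \<Psi> (\<tau> n) \<omega> * Y \<omega>))
        (E (\<lambda>w. f (\<lambda>i\<in>{..<k}. apply_bcontfun (Z w) (u i)) * Y (\<pi> w))) sequentially"
        by (rule tendsto_in_prob_compose[OF cond3i filterlim_seqs_to_infinity[OF \<tau>]])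
    qed (rule Z_meas Q.\<Psi>_M Q.\<Psi>_01 Q.\<Psi>_1 Q.tight_tail Q.tight_modulus; assumption)+
  qed
  have F_conv: "cond_conv (\<lambda>n \<omega>. F (ZT (\<tau> n) \<omega>)) (\<lambda>w. F (Z w))"
    if \<tau>: "\<tau> \<in> seqs_to_infinity TT T0" and F: "continuous_on C_hat F" "bounded (F ` C_hat)" for \<tau> F
  proof -
    interpret V: field_convergence M N \<pi> C G "\<lambda>n. ZT (\<tau> n)" Z "\<lambda>n. \<Psi> (\<tau> n)" by (rule conv[OF \<tau>])
    show ?thesis by (rule V.continuous_functional_conv[OF F])
  qed
  have u_meas: "uhatT T \<in> borel_measurable M" if "T \<in> TT" for T
    using qle_field.uh_measurable[OF field[OF that]] uh[OF that] by simp
  have f_conv: "cond_conv (\<lambda>n \<omega>. f (uhatT (\<tau> n) \<omega>)) (\<lambda>w. f (uhat w))"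
    if \<tau>: "\<tau> \<in> seqs_to_infinity TT T0" and f: "continuous_on UNIV f" "bounded (range f)" for \<tau> f
  proof -
    interpret V: field_convergence M N \<pi> C G "\<lambda>n. ZT (\<tau> n)" Z "\<lambda>n. \<Psi> (\<tau> n)" by (rule conv[OF \<tau>])
    show ?thesis
    proof (rule V.argmax_conv[OF _ uhat_meas _ cond4 _ f])
      fix n
      interpret F: qle_field M \<Theta> \<theta>s "H (\<tau> n)" "a (\<tau> n)" "ZT (\<tau> n)" "\<theta>hat (\<tau> n)" by (rule field[OF \<tau>TT[OF \<tau>]])
      show "uhatT (\<tau> n) \<in> borel_measurable M" by (rule u_meas[OF \<tau>TT[OF \<tau>]])
      fix \<omega> assume \<omega>: "\<omega> \<in> space M"
      show "maximizes (apply_bcontfun (ZT (\<tau> n) \<omega>)) (uhatT (\<tau> n) \<omega>)"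
        using F.uh_maximizes[OF \<omega>] by (simp add: uh[OF \<tau>TT[OF \<tau>]])
      show "apply_bcontfun (ZT (\<tau> n) \<omega>) 0 = 1" by (rule F.z_zero[OF \<omega>])
    qed
  qed
  have bounded_f: "bounded_rv M (\<lambda>\<omega>. f (uhatT T \<omega>))" if f: "continuous_on UNIV f" and T: "T \<in> TT"
    for f :: "real^'p \<Rightarrow> real" and T
  proof -
    interpret F: qle_field M \<Theta> \<theta>s "H T" "a T" "ZT T" "\<theta>hat T" by (rule field[OF T])
    obtain b where b: "\<And>\<omega>. \<omega> \<in> space M \<Longrightarrow> norm (F.uh \<omega>) \<le> b" using F.uh_bounded by blast
    have "compact (f ` cball 0 b)" by (intro compact_continuous_image continuous_on_subset[OF f]) auto
    then obtain c where c: "\<forall>x\<in>f ` cball 0 b. norm x \<le> c" using compact_imp_bounded by (metis bounded_iff)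
    show ?thesis
    proof (rule bounded_rvI[of _ _ c])
      show "(\<lambda>\<omega>. f (uhatT T \<omega>)) \<in> borel_measurable M"
        by (rule measurable_compose[OF u_meas[OF T] borel_measurable_continuous_onI[OF f]])
      show "\<bar>f (uhatT T \<omega>)\<bar> \<le> c" if "\<omega> \<in> space M" for \<omega>
        using b[OF that] c by (simp add: uh[OF T])
    qed
  qed
  have unb: "AE \<omega> in M. cond_integrable N \<pi> C (\<lambda>w. f (uhat w) * Y (\<pi> w)) \<omega>"
      "tendsto_in_prob M (\<lambda>n. EM (\<lambda>\<omega>. f (uhatT (\<tau> n) \<omega>) * Y \<omega>)) (E (\<lambda>w. f (uhat w) * Y (\<pi> w))) sequentially"
    if f: "continuous_on UNIV f" "Limsup at_infinity (\<lambda>u. ereal (\<bar>f u\<bar> * norm u powr (- q))) < \<infinity>"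
      and Y: "bounded_rv G Y" and \<tau>: "\<tau> \<in> seqs_to_infinity TT T0" for f Y \<tau>
  proof -
    interpret Q: qle_sequence M N \<pi> C G \<Theta> \<theta>s "\<lambda>n. H (\<tau> n)" "\<lambda>n. a (\<tau> n)" "\<lambda>n. ZT (\<tau> n)" "\<lambda>n. \<theta>hat (\<tau> n)" "\<lambda>n. \<Psi> (\<tau> n)" \<epsilon> L
      by (rule seq[OF \<tau>])
    obtain K where K: "0 \<le> K" "\<And>u. \<bar>f u\<bar> \<le> K * (1 + norm u powr q)" using polynomial_growth[OF f] by blast
    have fm: "(\<lambda>w. f (uhat w)) \<in> borel_measurable N"
      by (rule measurable_compose[OF uhat_meas borel_measurable_continuous_onI[OF f(1)]])
    have ui: "AE \<omega> in M. \<forall>\<eta>>0. \<exists>m::nat. \<forall>n. \<Psi> (\<tau> n) \<omega> * EM (\<lambda>\<omega>. max 0 (\<bar>f (uhatT (\<tau> n) \<omega>)\<bar> - real m)) \<omega> \<le> \<eta>"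
      using Q.moment_tail[OF f(1) K q qL(1)] by (simp add: uh[OF \<tau>TT[OF \<tau>]])
    have cc: "cond_conv (\<lambda>n \<omega>. \<phi> (f (uhatT (\<tau> n) \<omega>))) (\<lambda>w. \<phi> (f (uhat w)))"
      if \<phi>: "continuous_on UNIV \<phi>" "bounded (range \<phi>)" for \<phi> :: "real \<Rightarrow> real"
    proof (rule f_conv[OF \<tau>])
      show "continuous_on UNIV (\<lambda>u. \<phi> (f u))" by (rule continuous_on_compose2[OF \<phi>(1) f(1)]) simp
      show "bounded (range (\<lambda>u. \<phi> (f u)))" by (rule bounded_subset[OF \<phi>(2)]) auto
    qed
    note u = cond_conv_unbounded[OF bounded_f[OF f(1) \<tau>TT[OF \<tau>]] fm cc Q.\<Psi>_M Q.\<Psi>_01 Q.\<Psi>_1 ui Y]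
    show "AE \<omega> in M. cond_integrable N \<pi> C (\<lambda>w. f (uhat w) * Y (\<pi> w)) \<omega>" by (rule u(1))
    show "tendsto_in_prob M (\<lambda>n. EM (\<lambda>\<omega>. f (uhatT (\<tau> n) \<omega>) * Y \<omega>)) (E (\<lambda>w. f (uhat w) * Y (\<pi> w))) sequentially" by (rule u(2))
  qed
  obtain \<tau>0 where \<tau>0: "\<tau>0 \<in> seqs_to_infinity TT T0" using seqs_to_infinity_nonempty[OF TT(2)] by blast
  show ?thesis
  proof (intro conjI allI impI ballI)
    fix F :: "((real^'p) \<Rightarrow>\<^sub>C real) \<Rightarrow> real" and Y
    assume "continuous_on C_hat F" "bounded (F ` C_hat)" "bounded_rv G Y"
    then show "tendsto_in_prob M (\<lambda>T. EM (\<lambda>\<omega>. F (ZT T \<omega>) * Y \<omega>)) (E (\<lambda>w. F (Z w) * Y (\<pi> w))) (to_infinity_in TT)"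
      by (intro tendsto_in_prob_to_infinity_in) (use F_conv in \<open>auto simp: cond_conv_def\<close>)
  next
    fix f :: "real^'p \<Rightarrow> real" and Y
    assume f: "continuous_on UNIV f" "Limsup at_infinity (\<lambda>u. ereal (\<bar>f u\<bar> * norm u powr (- q))) < \<infinity>"
      and Y: "bounded_rv G Y"
    show "AE \<omega> in M. cond_integrable M id C (\<lambda>\<omega>. f (uhatT T \<omega>) * Y \<omega>) \<omega>" if "T \<in> TT" for T
      by (rule base.cond_integrable_bounded[OF bounded_rv_mult[OF bounded_f[OF f(1) that] bounded_rv_G[OF Y]]])
    show "AE \<omega> in M. cond_integrable N \<pi> C (\<lambda>w. f (uhat w) * Y (\<pi> w)) \<omega>"
      by (rule unb(1)[OF f Y \<tau>0])
    show "tendsto_in_prob M (\<lambda>T. EM (\<lambda>\<omega>. f (uhatT T \<omega>) * Y \<omega>)) (E (\<lambda>w. f (uhat w) * Y (\<pi> w))) (to_infinity_in TT)"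
      by (rule tendsto_in_prob_to_infinity_in[OF unb(2)[OF f Y]])
  next
    show "stable_conv M N \<pi> G uhatT uhat (to_infinity_in TT)"
      unfolding stable_conv_def
    proof (intro allI impI)
      fix f :: "real^'p \<Rightarrow> real" and Y
      assume f: "continuous_on UNIV f" and b: "bounded (range f)" and Y: "bounded_rv G Y"
      obtain c where c: "\<And>u. \<bar>f u\<bar> \<le> c" using b by (auto simp: bounded_iff)
      show "((\<lambda>T. \<integral>\<omega>. f (uhatT T \<omega>) * Y \<omega> \<partial>M) \<longlongrightarrow> (\<integral>w. f (uhat w) * Y (\<pi> w) \<partial>N)) (to_infinity_in TT)"
      proof (rule tendsto_to_infinity_in)
        fix \<tau> assume \<tau>: "\<tau> \<in> seqs_to_infinity TT T0"
        show "(\<lambda>n. \<integral>\<omega>. f (uhatT (\<tau> n) \<omega>) * Y \<omega> \<partial>M) \<longlonglongrightarrow> (\<integral>w. f (uhat w) * Y (\<pi> w) \<partial>N)"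
        proof (rule cond_conv_integral[OF bounded_f[OF f \<tau>TT[OF \<tau>]] c _ f_conv[OF \<tau> f b] Y])
          show "bounded_rv N (\<lambda>w. f (uhat w))"
            by (rule bounded_rvI[OF measurable_compose[OF uhat_meas borel_measurable_continuous_onI[OF f]] c])
        qed
      qed
    qed
  qed
qed

end
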